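(* Let $\rho$ be an approximate analytic metric on the unit disk $\mathbb U$ and let $w$ be a $\rho$-harmonic quasiconformal mapping of $\mathbb U$ onto itself. Let $(z_n)$ be any sequence of points of $\mathbb U$, and let $p_n$ and $q_n$ be Möbius transformations of $\mathbb U$ onto itself such that $p_n(w(z_n))=0$ and $q_n(0)=z_n$. Then there exist a metric $\rho_0$ in the unit disk $\mathbb U$, a $\rho_0$-harmonic mapping $w_0$ and a subsequence of $w_n=p_n\circ w\circ q_n$ that converges to $w_0$, uniformly on compact subsets of $\mathbb U$.
   Context: $\mathbb U=\{z\in\mathbb C:|z|<1\}$. A metric on $\mathbb U$ is a conformal metric $\rho(w)|dw|$ with a positive $C^1$ density $\rho$. It is called approximate analytic if there is a constant $M$ with $|(\log\rho^2)_w|=\frac{|\nabla\rho|}{\rho}\le M$ on $\mathbb U$. A $C^2$ mapping $f$ is $\rho$-harmonic if $f_{z\bar z}+\big((\log\rho^2)_w\circ f\big)\,f_z f_{\bar z}=0$. A $C^2$ map is quasiconformal if it is an orientation-preserving homeomorphism onto its image and $|f_{\bar z}|\le k|f_z|$ for some constant $0\le k<1$. *)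

theory Defs
  imports "HOL-Complex_Analysis.Complex_Analysis"
begin

abbreviation unit_disk :: "complex set" ("\<bbbU>")
  where "\<bbbU> \<equiv> ball 0 1"

text \<open>Real partial derivatives along the two coordinate axes of the complex plane; all
  differentiability below is real (Frechet) differentiability.\<close>

definition pd_x :: "(complex \<Rightarrow> 'b::real_normed_vector) \<Rightarrow> complex \<Rightarrow> 'b"
  where "pd_x f z = frechet_derivative f (at z) 1"

definition pd_y :: "(complex \<Rightarrow> 'b::real_normed_vector) \<Rightarrow> complex \<Rightarrow> 'b"
  where "pd_y f z = frechet_derivative f (at z) \<i>"

text \<open>Only meant for open sets.\<close>

definition C1_on :: "complex set \<Rightarrow> (complex \<Rightarrow> 'b::real_normed_vector) \<Rightarrow> bool"
  where "C1_on S f \<longleftrightarrow>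
    (\<forall>z\<in>S. f differentiable (at z)) \<and> continuous_on S (pd_x f) \<and> continuous_on S (pd_y f)"

definition C2_on :: "complex set \<Rightarrow> (complex \<Rightarrow> 'b::real_normed_vector) \<Rightarrow> bool"
  where "C2_on S f \<longleftrightarrow> C1_on S f \<and> C1_on S (pd_x f) \<and> C1_on S (pd_y f)"

text \<open>Wirtinger derivatives.\<close>

definition dz :: "(complex \<Rightarrow> complex) \<Rightarrow> complex \<Rightarrow> complex"
  where "dz f z = (pd_x f z - \<i> * pd_y f z) / 2"

definition dzbar :: "(complex \<Rightarrow> complex) \<Rightarrow> complex \<Rightarrow> complex"
  where "dzbar f z = (pd_x f z + \<i> * pd_y f z) / 2"

text \<open>A conformal metric on the disk is represented by its density; the values of the density
  outside the disk are irrelevant.\<close>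

definition disk_metric :: "(complex \<Rightarrow> real) \<Rightarrow> bool"
  where "disk_metric \<rho> \<longleftrightarrow> (\<forall>w\<in>\<bbbU>. \<rho> w > 0) \<and> C1_on \<bbbU> \<rho>"

definition dlog_density :: "(complex \<Rightarrow> real) \<Rightarrow> complex \<Rightarrow> complex"
  where "dlog_density \<rho> = dz (\<lambda>w. complex_of_real (ln ((\<rho> w)\<^sup>2)))"

definition approximate_analytic :: "(complex \<Rightarrow> real) \<Rightarrow> bool"
  where "approximate_analytic \<rho> \<longleftrightarrow>
    disk_metric \<rho> \<and> (\<exists>M. \<forall>w\<in>\<bbbU>. cmod (dlog_density \<rho> w) \<le> M)"

text \<open>Harmonic self-mappings of the disk: the range condition is what gives the composition of
  the logarithmic derivative of the density with the map a meaning.\<close>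

definition rho_harmonic :: "(complex \<Rightarrow> real) \<Rightarrow> (complex \<Rightarrow> complex) \<Rightarrow> bool"
  where "rho_harmonic \<rho> f \<longleftrightarrow>
    f ` \<bbbU> \<subseteq> \<bbbU> \<and> C2_on \<bbbU> f \<and>
    (\<forall>z\<in>\<bbbU>. dzbar (dz f) z + dlog_density \<rho> (f z) * dz f z * dzbar f z = 0)"

text \<open>Orientation preservation is meant topologically (local degree 1), so that the Jacobian
  is allowed to vanish at some points.\<close>

definition orientation_preserving_on :: "complex set \<Rightarrow> (complex \<Rightarrow> complex) \<Rightarrow> bool"
  where "orientation_preserving_on S f \<longleftrightarrow>
    (\<forall>z r. 0 < r \<and> cball z r \<subseteq> S \<longrightarrow> winding_number (f \<circ> circlepath z r) (f z) = 1)"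

definition quasiconformal_on :: "complex set \<Rightarrow> (complex \<Rightarrow> complex) \<Rightarrow> bool"
  where "quasiconformal_on S f \<longleftrightarrow>
    C2_on S f \<and> (\<exists>g. homeomorphism S (f ` S) f g) \<and> orientation_preserving_on S f \<and>
    (\<exists>k. 0 \<le> k \<and> k < 1 \<and> (\<forall>z\<in>S. cmod (dzbar f z) \<le> k * cmod (dz f z)))"

text \<open>The denominator must be required not to vanish, because division by zero is total.\<close>

definition disk_moebius :: "(complex \<Rightarrow> complex) \<Rightarrow> bool"
  where "disk_moebius p \<longleftrightarrow> p ` \<bbbU> = \<bbbU> \<and>
    (\<exists>a b c d. a * d - b * c \<noteq> 0 \<and> (\<forall>z\<in>\<bbbU>. c * z + d \<noteq> 0 \<and> p z = moebius a b c d z))"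

end

theory Submission
  imports Defs
begin

text \<open>After normalization the maps \<open>w\<^sub>n\<close> are quasiconformal self-maps of the disk fixing the origin. The
  length-area method (Courant-Lebesgue) makes them equicontinuous and, applied to logarithms of the
  maps, keeps them away from the unit circle on compact sets; so a subsequence converges locally
  uniformly to some \<open>w\<^sub>0\<close> with values in the disk. Pass to a further subsequence such that
  \<open>a\<^sub>n = w (z\<^sub>n)\<close> converges to \<open>a\<close>.

  If \<open>a\<close> is an interior point, then so is \<open>lim z\<^sub>n\<close>, the Moebius transformations converge, and \<open>w\<^sub>0\<close> is
  a Moebius conjugate of \<open>w\<close>; the metric is the pull-back of \<open>\<rho>\<close>. If \<open>\<bar>a\<bar> = 1\<close>, rescale: the maps
  \<open>v\<^sub>n = (w \<circ> q\<^sub>n - a\<^sub>n) / (1 - \<bar>a\<^sub>n\<bar>\<^sup>2)\<close> are locally bounded and satisfy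
  \<open>\<bar>\<Delta> v\<^sub>n\<bar> \<le> \<epsilon>\<^sub>n \<bar>\<nabla> v\<^sub>n\<bar>\<^sup>2\<close> with \<open>\<epsilon>\<^sub>n \<rightarrow> 0\<close>, since \<open>(log \<rho>\<^sup>2)\<^sub>w\<close> is bounded. Hence
  \<open>Re (c v\<^sub>n) + C \<epsilon>\<^sub>n \<bar>v\<^sub>n\<bar>\<^sup>2\<close> is, for a suitable constant \<open>C\<close>, subharmonic for every
  unimodular \<open>c\<close>, so the limit of the \<open>v\<^sub>n\<close> is harmonic. It is the image of \<open>w\<^sub>0\<close> under a Moebius map \<open>\<psi>\<close> from the disk to a half-plane, so \<open>w\<^sub>0\<close> is
  harmonic for the pull-back \<open>\<bar>\<psi>'\<bar>\<close> of the Euclidean metric.\<close>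

section \<open>Wirtinger calculus\<close>

text \<open>No bounds on the derivatives of the maps \<open>p n \<circ> w \<circ> q n\<close> are at
  hand, so the differential equation itself cannot be passed to the limit. In the boundary case
  harmonicity of the limit is therefore read off from a property of order zero that survives uniform
  convergence: comparison with real parts of polynomials on a circle. The term \<epsilon> |v|^2 is
  what makes this possible, as its Laplacian contains the squared gradient and absorbs a right-hand
  side that is quadratic in the gradient. The divisor 1 - |a|^2 is the one for which (w o q - a) /
  (1 - |a|^2) becomes f / (\<alpha> + cnj a * f), where f is the normalized map and \<alpha> the
  rotation contained in p. This quotient is bounded wherever |f| stays below 1 by a fixed amount,
  and the divisor is at the same time \<epsilon>, up to the bound for the logarithmic derivative of
  the density. So the limit must not only exist but stay inside the open disk.\<close>

lemma pd_x_eq: "pd_x f z = dz f z + dzbar f z"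
  by (simp add: dz_def dzbar_def field_simps)

lemma pd_y_eq: "pd_y f z = \<i> * (dz f z - dzbar f z)"
proof -
  have "dz f z - dzbar f z = - (\<i> * pd_y f z)"
    by (simp add: dz_def dzbar_def field_simps)
  thus ?thesis by simp
qed

text \<open>Every real-linear map of the plane is h -> a * h + b * cnj h for exactly one pair (a,
  b). Carrying the pair together with differentiability turns chain and product rules into
  computations with pairs.\<close>

definition has_wirtinger :: "(complex \<Rightarrow> complex) \<Rightarrow> complex \<Rightarrow> complex \<Rightarrow> complex \<Rightarrow> bool"
  where "has_wirtinger f a b z \<longleftrightarrow> (f has_derivative (\<lambda>h. a * h + b * cnj h)) (at z)"

lemma pd_eqI:
  assumes "(f has_derivative f') (at z)"
  shows "pd_x f z = f' 1" "pd_y f z = f' \<i>"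
  using frechet_derivative_at[OF assms] by (simp_all add: pd_x_def pd_y_def)

lemma has_wirtinger_unique:
  assumes "has_wirtinger f a b z"
  shows "dz f z = a" "dzbar f z = b"
proof -
  have "pd_x f z = a + b" "pd_y f z = \<i> * (a - b)"
    using pd_eqI[OF assms[unfolded has_wirtinger_def]] by (simp_all add: algebra_simps)
  thus "dz f z = a" "dzbar f z = b"
    by (simp_all add: dz_def dzbar_def flip: mult.assoc)
qed

lemma differentiable_imp_has_wirtinger:
  assumes "f differentiable (at z)"
  shows "has_wirtinger f (dz f z) (dzbar f z) z"
proof -
  obtain f' where f': "(f has_derivative f') (at z)"
    using assms by (auto simp: differentiable_def)
  have "f' h = dz f z * h + dzbar f z * cnj h" for h
  proof -
    interpret bounded_linear f' using f' by (rule has_derivative_bounded_linear)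
    have "h = Re h *\<^sub>R 1 + Im h *\<^sub>R \<i>" by (simp add: complex_eq_iff)
    hence "f' h = Re h *\<^sub>R f' 1 + Im h *\<^sub>R f' \<i>" by (metis add scaleR)
    also have "\<dots> = Re h * pd_x f z + Im h * pd_y f z"
      by (simp add: pd_eqI[OF f'] scaleR_conv_of_real)
    also have "\<dots> = dz f z * h + dzbar f z * cnj h"
      unfolding pd_x_eq pd_y_eq by (simp add: complex_eq_iff algebra_simps)
    finally show ?thesis .
  qed
  hence "f' = (\<lambda>h. dz f z * h + dzbar f z * cnj h)" by (rule ext)
  with f' show ?thesis by (simp add: has_wirtinger_def)
qed

lemma has_wirtinger_transform:
  assumes "has_wirtinger f a b z" "open S" "z \<in> S" "\<And>x. x \<in> S \<Longrightarrow> f x = g x"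
  shows "has_wirtinger g a b z"
  using has_derivative_transform_within_open[OF assms(1)[unfolded has_wirtinger_def] assms(2,3,4)]
  by (simp add: has_wirtinger_def)

lemma has_wirtinger_compose:
  assumes "has_wirtinger f a b z" "has_wirtinger g c d (f z)"
  shows "has_wirtinger (\<lambda>x. g (f x)) (c * a + d * cnj b) (c * b + d * cnj a) z"
  using diff_chain_at[OF assms(1,2)[unfolded has_wirtinger_def]]
  unfolding has_wirtinger_def o_def by (rule has_derivative_eq_rhs) (auto simp: algebra_simps)

lemma has_wirtinger_mult:
  assumes "has_wirtinger f a b z" "has_wirtinger g c d z"
  shows "has_wirtinger (\<lambda>x. f x * g x) (f z * c + g z * a) (f z * d + g z * b) z"
  using has_derivative_mult[OF assms[unfolded has_wirtinger_def]]
  unfolding has_wirtinger_def by (rule has_derivative_eq_rhs) (auto simp: algebra_simps)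

lemma has_wirtinger_add:
  assumes "has_wirtinger f a b z" "has_wirtinger g c d z"
  shows "has_wirtinger (\<lambda>x. f x + g x) (a + c) (b + d) z"
  using has_derivative_add[OF assms[unfolded has_wirtinger_def]]
  unfolding has_wirtinger_def by (rule has_derivative_eq_rhs) (auto simp: algebra_simps)

lemma has_wirtinger_cnj:
  assumes "has_wirtinger f a b z"
  shows "has_wirtinger (\<lambda>x. cnj (f x)) (cnj b) (cnj a) z"
  using has_derivative_cnj[OF assms[unfolded has_wirtinger_def]]
  unfolding has_wirtinger_def by (rule has_derivative_eq_rhs) (auto simp: algebra_simps)

lemma has_wirtinger_field_derivative:
  assumes "(f has_field_derivative a) (at z)"
  shows "has_wirtinger f a 0 z"
  using assms unfolding has_wirtinger_def has_field_derivative_def by simp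

section \<open>Closure properties of the classes C1 and C2\<close>

lemma C1_onI:
  assumes "\<And>z. z \<in> S \<Longrightarrow> (f has_derivative f' z) (at z)"
    and "continuous_on S (\<lambda>z. f' z 1)" "continuous_on S (\<lambda>z. f' z \<i>)"
  shows "C1_on S f"
  unfolding C1_on_def
proof (intro conjI ballI)
  show "continuous_on S (pd_x f)" "continuous_on S (pd_y f)"
    using assms(2,3) pd_eqI[OF assms(1)] by (simp_all cong: continuous_on_cong)
qed (use assms(1) in \<open>auto simp: differentiable_def\<close>)

lemma C1_on_wirtingerI:
  assumes "\<And>z. z \<in> S \<Longrightarrow> has_wirtinger f (a z) (b z) z" "continuous_on S a" "continuous_on S b"
  shows "C1_on S f"
  by (rule C1_onI[of _ _ "\<lambda>z h. a z * h + b z * cnj h"])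
     (use assms in \<open>auto simp: has_wirtinger_def intro!: continuous_intros\<close>)

lemma C1_on_wirtingerD:
  assumes "C1_on S f"
  shows "z \<in> S \<Longrightarrow> has_wirtinger f (dz f z) (dzbar f z) z"
    and "continuous_on S (dz f)" "continuous_on S (dzbar f)"
  using assms unfolding C1_on_def dz_def dzbar_def
  by (auto intro!: continuous_intros differentiable_imp_has_wirtinger[unfolded dz_def dzbar_def])

lemma C1_on_imp_continuous_on: "C1_on S f \<Longrightarrow> continuous_on S f"
  unfolding C1_on_def
  by (meson differentiable_imp_continuous_within continuous_at_imp_continuous_on)

lemma C1_on_subset: "C1_on S f \<Longrightarrow> T \<subseteq> S \<Longrightarrow> C1_on T f"
  unfolding C1_on_def by (auto intro: continuous_on_subset)

lemma C2_on_subset: "C2_on S f \<Longrightarrow> T \<subseteq> S \<Longrightarrow> C2_on T f"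
  unfolding C2_on_def by (auto intro: C1_on_subset)

lemma C1_on_transform:
  fixes f g :: "complex \<Rightarrow> complex"
  assumes f: "C1_on S f" and "open S" "\<And>x. x \<in> S \<Longrightarrow> f x = g x"
  shows "C1_on S g"
  by (rule C1_on_wirtingerI[of _ _ "dz f" "dzbar f"])
     (use assms(2,3) C1_on_wirtingerD[OF f] in \<open>auto intro: has_wirtinger_transform\<close>)

lemma C1_on_add:
  fixes f g :: "complex \<Rightarrow> complex"
  assumes f: "C1_on S f" and g: "C1_on S g"
  shows "C1_on S (\<lambda>x. f x + g x)"
  by (rule C1_on_wirtingerI[of _ _ "\<lambda>x. dz f x + dz g x" "\<lambda>x. dzbar f x + dzbar g x"])
     (auto intro!: continuous_intros has_wirtinger_add C1_on_wirtingerD[OF f] C1_on_wirtingerD[OF g])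

lemma C1_on_mult:
  fixes f g :: "complex \<Rightarrow> complex"
  assumes f: "C1_on S f" and g: "C1_on S g"
  shows "C1_on S (\<lambda>x. f x * g x)"
  by (rule C1_on_wirtingerI[of _ _ "\<lambda>x. f x * dz g x + g x * dz f x" "\<lambda>x. f x * dzbar g x + g x * dzbar f x"])
     (intro continuous_intros has_wirtinger_mult C1_on_wirtingerD[OF f] C1_on_wirtingerD[OF g]
        C1_on_imp_continuous_on f g; assumption)+

lemma C1_on_cnj:
  assumes f: "C1_on S f"
  shows "C1_on S (\<lambda>x. cnj (f x))"
  by (rule C1_on_wirtingerI[of _ _ "\<lambda>x. cnj (dzbar f x)" "\<lambda>x. cnj (dz f x)"])
     (auto intro!: continuous_intros has_wirtinger_cnj C1_on_wirtingerD[OF f])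

lemma C1_on_const: "C1_on S (\<lambda>x. c :: complex)"
  by (rule C1_onI[of _ _ "\<lambda>_ _. 0"]) auto

lemma C1_on_cmult: "C1_on S f \<Longrightarrow> C1_on S (\<lambda>x. c * f x :: complex)"
  by (intro C1_on_mult C1_on_const)

lemma C1_on_compose:
  fixes f g :: "complex \<Rightarrow> complex"
  assumes f: "C1_on S f" and g: "C1_on T g" and fS: "f ` S \<subseteq> T"
  shows "C1_on S (\<lambda>x. g (f x))"
proof -
  have "continuous_on S (\<lambda>x. dz g (f x))" "continuous_on S (\<lambda>x. dzbar g (f x))"
    using continuous_on_compose2[OF C1_on_wirtingerD(2)[OF g] C1_on_imp_continuous_on[OF f] fS]
      continuous_on_compose2[OF C1_on_wirtingerD(3)[OF g] C1_on_imp_continuous_on[OF f] fS] by auto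
  thus ?thesis
    by (intro C1_on_wirtingerI[of _ _ "\<lambda>z. dz g (f z) * dz f z + dzbar g (f z) * cnj (dzbar f z)"
        "\<lambda>z. dz g (f z) * dzbar f z + dzbar g (f z) * cnj (dz f z)"] has_wirtinger_compose)
       (use fS in \<open>auto intro!: continuous_intros C1_on_wirtingerD[OF f] C1_on_wirtingerD(1)[OF g]\<close>)
qed

lemma C1_on_holomorphic:
  assumes "f holomorphic_on S" "open S"
  shows "C1_on S f"
  by (rule C1_on_wirtingerI[of _ _ "deriv f" "\<lambda>_. 0"])
     (use assms in \<open>auto intro!: has_wirtinger_field_derivative holomorphic_derivI
        holomorphic_on_imp_continuous_on holomorphic_deriv\<close>)

text \<open>The Wirtinger derivatives are an invertible linear combination of the partial ones, so
  second-order smoothness can be checked on either pair. Later proofs can then differentiate with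
  \<open>has_wirtinger\<close> alone.\<close>

lemma C2_on_iff: "C2_on S f \<longleftrightarrow> C1_on S f \<and> C1_on S (dz f) \<and> C1_on S (dzbar f)"
proof -
  have "C1_on S (pd_x f) \<and> C1_on S (pd_y f) \<longleftrightarrow> C1_on S (dz f) \<and> C1_on S (dzbar f)"
  proof (intro iffI conjI; elim conjE)
    assume *: "C1_on S (pd_x f)" "C1_on S (pd_y f)"
    have "C1_on S (\<lambda>z. 1/2 * pd_x f z + (- \<i>/2) * pd_y f z)"
         "C1_on S (\<lambda>z. 1/2 * pd_x f z + (\<i>/2) * pd_y f z)"
      by (intro C1_on_add C1_on_cmult *)+
    moreover have "(\<lambda>z. 1/2 * pd_x f z + (- \<i>/2) * pd_y f z) = dz f"
       "(\<lambda>z. 1/2 * pd_x f z + (\<i>/2) * pd_y f z) = dzbar f"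
      by (auto simp: fun_eq_iff dz_def dzbar_def field_simps)
    ultimately show "C1_on S (dz f)" "C1_on S (dzbar f)" by auto
  next
    assume *: "C1_on S (dz f)" "C1_on S (dzbar f)"
    have "C1_on S (\<lambda>z. 1 * dz f z + 1 * dzbar f z)"
         "C1_on S (\<lambda>z. \<i> * dz f z + (-\<i>) * dzbar f z)"
      by (intro C1_on_add C1_on_cmult *)+
    moreover have "(\<lambda>z. 1 * dz f z + 1 * dzbar f z) = pd_x f"
       "(\<lambda>z. \<i> * dz f z + (-\<i>) * dzbar f z) = pd_y f"
      by (auto simp: fun_eq_iff pd_x_eq pd_y_eq algebra_simps)
    ultimately show "C1_on S (pd_x f)" "C1_on S (pd_y f)" by auto
  qed
  thus ?thesis unfolding C2_on_def by blast
qed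

lemma C2_on_holomorphic:
  assumes "f holomorphic_on S" "open S"
  shows "C2_on S f"
proof -
  have W: "has_wirtinger f (deriv f z) 0 z" if "z \<in> S" for z
    using assms that by (auto intro!: has_wirtinger_field_derivative holomorphic_derivI)
  have "C1_on S (deriv f)" by (intro C1_on_holomorphic holomorphic_deriv assms)
  hence "C1_on S (dz f)"
    by (rule C1_on_transform) (use assms has_wirtinger_unique[OF W] in auto)
  moreover have "C1_on S (dzbar f)"
    by (rule C1_on_transform[OF C1_on_const[of S 0]]) (use assms has_wirtinger_unique[OF W] in auto)
  ultimately show ?thesis unfolding C2_on_iff using C1_on_holomorphic[OF assms] by auto
qed

lemma C2_on_add:
  fixes f g :: "complex \<Rightarrow> complex"
  assumes f: "C2_on S f" and g: "C2_on S g" and S: "open S"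
  shows "C2_on S (\<lambda>x. f x + g x)"
proof -
  have f1: "C1_on S f" "C1_on S (dz f)" "C1_on S (dzbar f)" using f by (auto simp: C2_on_iff)
  have g1: "C1_on S g" "C1_on S (dz g)" "C1_on S (dzbar g)" using g by (auto simp: C2_on_iff)
  have W: "has_wirtinger (\<lambda>x. f x + g x) (dz f x + dz g x) (dzbar f x + dzbar g x) x" if "x \<in> S" for x
    by (intro has_wirtinger_add C1_on_wirtingerD(1)[OF f1(1)] C1_on_wirtingerD(1)[OF g1(1)] that)
  show ?thesis unfolding C2_on_iff
    using C1_on_transform[OF C1_on_add[OF f1(2) g1(2)] S, of "dz (\<lambda>x. f x + g x)"]
      C1_on_transform[OF C1_on_add[OF f1(3) g1(3)] S, of "dzbar (\<lambda>x. f x + g x)"]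
      has_wirtinger_unique[OF W] C1_on_add[OF f1(1) g1(1)] by auto
qed

lemma C2_on_compose:
  fixes f g :: "complex \<Rightarrow> complex"
  assumes f: "C2_on S f" and g: "C2_on T g" and fS: "f ` S \<subseteq> T" and S: "open S"
  shows "C2_on S (\<lambda>x. g (f x))"
proof -
  have f1: "C1_on S f" "C1_on S (dz f)" "C1_on S (dzbar f)" using f by (auto simp: C2_on_iff)
  have g1: "C1_on T g" "C1_on T (dz g)" "C1_on T (dzbar g)" using g by (auto simp: C2_on_iff)
  have W: "has_wirtinger (\<lambda>x. g (f x)) (dz g (f z) * dz f z + dzbar g (f z) * cnj (dzbar f z))
     (dz g (f z) * dzbar f z + dzbar g (f z) * cnj (dz f z)) z" if "z \<in> S" for z
    by (intro has_wirtinger_compose C1_on_wirtingerD[OF f1(1)] C1_on_wirtingerD(1)[OF g1(1)] that)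
       (use fS that in auto)
  have 1: "C1_on S (\<lambda>z. dz g (f z) * dz f z + dzbar g (f z) * cnj (dzbar f z))"
   and 2: "C1_on S (\<lambda>z. dz g (f z) * dzbar f z + dzbar g (f z) * cnj (dz f z))"
    by (intro C1_on_add C1_on_mult C1_on_cnj f1 C1_on_compose[OF f1(1) g1(2) fS]
        C1_on_compose[OF f1(1) g1(3) fS])+
  show ?thesis unfolding C2_on_iff
    using C1_on_transform[OF 1 S, of "dz (\<lambda>x. g (f x))"]
      C1_on_transform[OF 2 S, of "dzbar (\<lambda>x. g (f x))"]
      has_wirtinger_unique[OF W] C1_on_compose[OF f1(1) g1(1) fS] by auto
qed

section \<open>Second-order chain rules with one holomorphic factor\<close>

text \<open>As h has no antiholomorphic derivative, the only extra second-order term is h'' f_z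
  f_zbar. It has the shape of the nonlinear term in the harmonic map equation, which is why a
  holomorphic change of target coordinate can be absorbed by a change of density.\<close>

lemma dzbar_dz_holomorphic_compose:
  assumes f: "C2_on S f" and S: "open S" and h: "h holomorphic_on T" and T: "open T"
    and fS: "f ` S \<subseteq> T" and z: "z \<in> S"
  shows "dz (\<lambda>x. h (f x)) z = deriv h (f z) * dz f z"
    and "dzbar (\<lambda>x. h (f x)) z = deriv h (f z) * dzbar f z"
    and "dzbar (dz (\<lambda>x. h (f x))) z =
      deriv h (f z) * dzbar (dz f) z + deriv (deriv h) (f z) * dz f z * dzbar f z"
proof -
  have f1: "C1_on S f" "C1_on S (dz f)" "C1_on S (dzbar f)" using f by (auto simp: C2_on_iff)
  have W: "has_wirtinger (\<lambda>x. h (f x)) (deriv h (f x) * dz f x) (deriv h (f x) * dzbar f x) x"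
    if "x \<in> S" for x
    using has_wirtinger_compose[OF C1_on_wirtingerD(1)[OF f1(1) that]
        has_wirtinger_field_derivative[OF holomorphic_derivI[OF h T]]] fS that by auto
  show "dz (\<lambda>x. h (f x)) z = deriv h (f z) * dz f z"
    and "dzbar (\<lambda>x. h (f x)) z = deriv h (f z) * dzbar f z"
    using has_wirtinger_unique[OF W[OF z]] by auto
  have "deriv h holomorphic_on T" by (intro holomorphic_deriv h T)
  hence "has_wirtinger (\<lambda>x. deriv h (f x)) (deriv (deriv h) (f z) * dz f z)
      (deriv (deriv h) (f z) * dzbar f z) z"
    using has_wirtinger_compose[OF C1_on_wirtingerD(1)[OF f1(1) z]
        has_wirtinger_field_derivative[OF holomorphic_derivI[OF _ T]], of "deriv h"] fS z by auto
  from has_wirtinger_mult[OF this C1_on_wirtingerD(1)[OF f1(2) z]]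
  have "has_wirtinger (dz (\<lambda>x. h (f x)))
     (deriv h (f z) * dz (dz f) z + dz f z * (deriv (deriv h) (f z) * dz f z))
     (deriv h (f z) * dzbar (dz f) z + dz f z * (deriv (deriv h) (f z) * dzbar f z)) z"
    by (rule has_wirtinger_transform[OF _ S z]) (use has_wirtinger_unique[OF W] in auto)
  from has_wirtinger_unique(2)[OF this]
  show "dzbar (dz (\<lambda>x. h (f x))) z =
      deriv h (f z) * dzbar (dz f) z + deriv (deriv h) (f z) * dz f z * dzbar f z"
    by (simp add: algebra_simps)
qed

text \<open>The derivative of q is holomorphic, so \<open>dzbar\<close> does not see it and the
  mixed second derivative is just multiplied by |q'|^2. The product of the two first derivatives
  scales in modulus by the same factor.\<close>

lemma dzbar_dz_compose_holomorphic:
  assumes f: "C2_on T f" and S: "open S" and q: "q holomorphic_on S"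
    and qS: "q ` S \<subseteq> T" and z: "z \<in> S"
  shows "dz (\<lambda>x. f (q x)) z = deriv q z * dz f (q z)"
    and "dzbar (\<lambda>x. f (q x)) z = cnj (deriv q z) * dzbar f (q z)"
    and "dzbar (dz (\<lambda>x. f (q x))) z = deriv q z * cnj (deriv q z) * dzbar (dz f) (q z)"
proof -
  have f1: "C1_on T f" "C1_on T (dz f)" "C1_on T (dzbar f)" using f by (auto simp: C2_on_iff)
  have W: "has_wirtinger (\<lambda>x. f (q x)) (dz f (q x) * deriv q x) (dzbar f (q x) * cnj (deriv q x)) x"
    if "x \<in> S" for x
    using has_wirtinger_compose[OF has_wirtinger_field_derivative[OF holomorphic_derivI[OF q S that]]
       C1_on_wirtingerD(1)[OF f1(1)]] qS that by auto
  show "dz (\<lambda>x. f (q x)) z = deriv q z * dz f (q z)"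
    and "dzbar (\<lambda>x. f (q x)) z = cnj (deriv q z) * dzbar f (q z)"
    using has_wirtinger_unique[OF W[OF z]] by auto
  have 1: "has_wirtinger (\<lambda>x. dz f (q x)) (dz (dz f) (q z) * deriv q z) (dzbar (dz f) (q z) * cnj (deriv q z)) z"
    using has_wirtinger_compose[OF has_wirtinger_field_derivative[OF holomorphic_derivI[OF q S z]]
       C1_on_wirtingerD(1)[OF f1(2)]] qS z by auto
  have 2: "has_wirtinger (deriv q) (deriv (deriv q) z) 0 z"
    by (intro has_wirtinger_field_derivative holomorphic_derivI[OF _ S z] holomorphic_deriv q S)
  from has_wirtinger_mult[OF 1 2]
  have "has_wirtinger (dz (\<lambda>x. f (q x)))
     (dz f (q z) * deriv (deriv q) z + deriv q z * (dz (dz f) (q z) * deriv q z))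
     (dz f (q z) * 0 + deriv q z * (dzbar (dz f) (q z) * cnj (deriv q z))) z"
    by (rule has_wirtinger_transform[OF _ S z]) (use has_wirtinger_unique[OF W] in auto)
  from has_wirtinger_unique(2)[OF this]
  show "dzbar (dz (\<lambda>x. f (q x))) z = deriv q z * cnj (deriv q z) * dzbar (dz f) (q z)"
    by (simp add: algebra_simps)
qed

section \<open>The maximum principle for almost harmonic maps\<close>

text \<open>The second difference of F over a square of side h, taken in either order, is h^2 times
  a nearby value of one of the mixed derivatives, by two applications of the mean value theorem.
  Continuity at the origin does the rest.\<close>

lemma mixed_partials_commute_real:
  fixes F Fx Fy Fxy Fyx :: "real \<Rightarrow> real \<Rightarrow> real"
  assumes "d > 0"
    and Fx: "\<And>s t. \<bar>s\<bar> < d \<Longrightarrow> \<bar>t\<bar> < d \<Longrightarrow> ((\<lambda>s. F s t) has_real_derivative Fx s t) (at s)"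
    and Fy: "\<And>s t. \<bar>s\<bar> < d \<Longrightarrow> \<bar>t\<bar> < d \<Longrightarrow> ((\<lambda>t. F s t) has_real_derivative Fy s t) (at t)"
    and Fxy: "\<And>s t. \<bar>s\<bar> < d \<Longrightarrow> \<bar>t\<bar> < d \<Longrightarrow> ((\<lambda>t. Fx s t) has_real_derivative Fxy s t) (at t)"
    and Fyx: "\<And>s t. \<bar>s\<bar> < d \<Longrightarrow> \<bar>t\<bar> < d \<Longrightarrow> ((\<lambda>s. Fy s t) has_real_derivative Fyx s t) (at s)"
    and cont: "isCont (\<lambda>p. Fxy (fst p) (snd p)) (0,0)" "isCont (\<lambda>p. Fyx (fst p) (snd p)) (0,0)"
  shows "Fxy 0 0 = Fyx 0 0"
proof -
  have "\<bar>Fxy 0 0 - Fyx 0 0\<bar> \<le> e" if "e > 0" for e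
  proof -
    obtain d1 where d1: "d1 > 0" "\<And>s t. dist (s,t) (0,0) < d1 \<Longrightarrow> \<bar>Fxy s t - Fxy 0 0\<bar> < e/2"
      using cont(1)[unfolded continuous_at_eps_delta, rule_format, of "e/2"] \<open>e > 0\<close>
      by (auto simp: dist_real_def)
    obtain d2 where d2: "d2 > 0" "\<And>s t. dist (s,t) (0,0) < d2 \<Longrightarrow> \<bar>Fyx s t - Fyx 0 0\<bar> < e/2"
      using cont(2)[unfolded continuous_at_eps_delta, rule_format, of "e/2"] \<open>e > 0\<close>
      by (auto simp: dist_real_def)
    \<comment> \<open>Points of the square of side h lie within 2 h of the origin, and this has to
      be below d1 and d2; hence the third.\<close>
    define h where "h = min d (min d1 d2) / 3"
    have h: "h > 0" "h < d" "2 * h < d1" "2 * h < d2"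
      using \<open>d > 0\<close> d1(1) d2(1) by (auto simp: h_def min_def)
    have near: "dist (s,t) (0::real,0::real) \<le> 2 * h" if "0 < s" "s < h" "0 < t" "t < h" for s t
    proof -
      have "dist (s,t) (0::real,0::real) \<le> dist s 0 + dist t 0"
        by (simp add: dist_Pair_Pair sqrt_sum_squares_le_sum_abs)
      thus ?thesis using that by simp
    qed
    have "\<exists>s. 0 < s \<and> s < h \<and> (F h h - F h 0) - (F 0 h - F 0 0) = (h - 0) * (Fx s h - Fx s 0)"
      by (rule MVT2[OF h(1)]) (use h in \<open>auto intro!: derivative_intros Fx\<close>)
    then obtain s where s: "0 < s" "s < h" "(F h h - F h 0) - (F 0 h - F 0 0) = h * (Fx s h - Fx s 0)"
      by auto
    have "\<exists>t. 0 < t \<and> t < h \<and> Fx s h - Fx s 0 = (h - 0) * Fxy s t"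
      by (rule MVT2[OF h(1)]) (use h s in \<open>auto intro!: derivative_intros Fxy\<close>)
    then obtain t where t: "0 < t" "t < h" "Fx s h - Fx s 0 = h * Fxy s t" by auto
    have "\<exists>t. 0 < t \<and> t < h \<and> (F h h - F 0 h) - (F h 0 - F 0 0) = (h - 0) * (Fy h t - Fy 0 t)"
      by (rule MVT2[OF h(1)]) (use h in \<open>auto intro!: derivative_intros Fy\<close>)
    then obtain t' where t': "0 < t'" "t' < h" "(F h h - F 0 h) - (F h 0 - F 0 0) = h * (Fy h t' - Fy 0 t')"
      by auto
    have "\<exists>s. 0 < s \<and> s < h \<and> Fy h t' - Fy 0 t' = (h - 0) * Fyx s t'"
      by (rule MVT2[OF h(1)]) (use h t' in \<open>auto intro!: derivative_intros Fyx\<close>)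
    then obtain s' where s': "0 < s'" "s' < h" "Fy h t' - Fy 0 t' = h * Fyx s' t'" by auto
    have "h * (h * Fxy s t) = h * (h * Fyx s' t')"
      using s(3) t(3) t'(3) s'(3) by (simp add: algebra_simps)
    hence "Fxy s t = Fyx s' t'" using h by simp
    moreover have "\<bar>Fxy s t - Fxy 0 0\<bar> < e/2" using near[OF s(1,2) t(1,2)] h by (intro d1) auto
    moreover have "\<bar>Fyx s' t' - Fyx 0 0\<bar> < e/2" using near[OF s'(1,2) t'(1,2)] h by (intro d2) auto
    ultimately show ?thesis by linarith
  qed
  hence "\<bar>Fxy 0 0 - Fyx 0 0\<bar> \<le> 0" by (rule dense_ge)
  thus ?thesis by simp
qed

text \<open>The free offset b makes the rule serve both for a horizontal line at another height and,
  with b = 0, for the line through a.\<close>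

lemma pd_x_line:
  fixes f :: "complex \<Rightarrow> complex"
  assumes "C1_on S f" "a + of_real s * 1 + b \<in> S"
  shows "((\<lambda>s. f (a + of_real s * 1 + b)) has_vector_derivative pd_x f (a + of_real s * 1 + b)) (at s)"
proof -
  have 1: "((\<lambda>s. a + of_real s * 1 + b) has_derivative (\<lambda>h. of_real h)) (at s)"
    by (auto intro!: derivative_eq_intros)
  show ?thesis unfolding has_vector_derivative_def
    by (rule has_derivative_eq_rhs[OF has_derivative_compose[OF 1
      C1_on_wirtingerD(1)[OF assms, unfolded has_wirtinger_def]]])
      (auto simp: pd_x_eq fun_eq_iff scaleR_conv_of_real algebra_simps)
qed

lemma pd_y_line:
  fixes f :: "complex \<Rightarrow> complex"
  assumes "C1_on S f" "a + of_real s * \<i> + b \<in> S"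
  shows "((\<lambda>s. f (a + of_real s * \<i> + b)) has_vector_derivative pd_y f (a + of_real s * \<i> + b)) (at s)"
proof -
  have 1: "((\<lambda>s. a + of_real s * \<i> + b) has_derivative (\<lambda>h. of_real h * \<i>)) (at s)"
    by (auto intro!: derivative_eq_intros)
  show ?thesis unfolding has_vector_derivative_def
    by (rule has_derivative_eq_rhs[OF has_derivative_compose[OF 1
      C1_on_wirtingerD(1)[OF assms, unfolded has_wirtinger_def]]])
      (auto simp: pd_y_eq fun_eq_iff scaleR_conv_of_real algebra_simps)
qed

lemma has_real_derivative_Re_cmult:
  assumes "(f has_vector_derivative f') (at s)"
  shows "((\<lambda>s. Re (c * f s)) has_real_derivative Re (c * f')) (at s)"
proof -
  have "((\<lambda>s. c * f s) has_vector_derivative c * f') (at s)"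
    using assms by (rule has_vector_derivative_mult_right)
  from bounded_linear.has_vector_derivative[OF bounded_linear_Re this]
  show ?thesis by (simp add: has_real_derivative_iff_has_vector_derivative)
qed

lemma mixed_partials_commute:
  fixes f :: "complex \<Rightarrow> complex"
  assumes f: "C2_on S f" and S: "open S" and z: "z \<in> S"
  shows "pd_y (pd_x f) z = pd_x (pd_y f) z"
proof -
  have f1: "C1_on S f" "C1_on S (pd_x f)" "C1_on S (pd_y f)" using f by (auto simp: C2_on_def)
  obtain d where d: "d > 0" "ball z d \<subseteq> S" using S z openE by blast
  have mem: "z + of_real s * 1 + of_real t * \<i> \<in> S" if "\<bar>s\<bar> < d/2" "\<bar>t\<bar> < d/2" for s t
  proof -
    have "norm (of_real s * 1 + of_real t * \<i>) \<le> \<bar>s\<bar> + \<bar>t\<bar>"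
      by (rule norm_triangle_le) (auto simp: norm_mult)
    also have "\<dots> < d" using that by simp
    finally have "z + (of_real s * 1 + of_real t * \<i>) \<in> ball z d"
      by (simp only: mem_ball dist_norm norm_minus_commute[of z] add_diff_cancel_left')
    thus ?thesis using d by (auto simp: add.assoc)
  qed
  \<comment> \<open>The real-variable lemma is applied to Re (c * f); c = 1 and c = -i then recover
    the real and imaginary parts.\<close>
  have "Re (c * pd_y (pd_x f) z) = Re (c * pd_x (pd_y f) z)" for c
  proof -
    have cont: "isCont (\<lambda>p. Re (c * g (z + of_real (fst p) * 1 + of_real (snd p) * \<i>))) (0,0)"
      if g: "continuous_on S g" for g :: "complex \<Rightarrow> complex"
    proof -
      have "isCont g z" using g S z by (simp add: continuous_on_eq_continuous_at)
      hence "isCont g (z + of_real (fst (0::real,0::real)) * 1 + of_real (snd (0::real,0::real)) * \<i>)" by simp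
      hence "isCont (\<lambda>p. g (z + of_real (fst p) * 1 + of_real (snd p) * \<i>)) (0::real,0::real)"
        by (rule isCont_o2[rotated]) (intro continuous_intros)
      thus ?thesis by (rule continuous_Re[OF continuous_mult[OF continuous_const]])
    qed
    have cc: "continuous_on S (pd_y (pd_x f))" "continuous_on S (pd_x (pd_y f))"
      using f1 by (auto simp: C1_on_def)
    note D = has_real_derivative_Re_cmult[where c = c]
    have "Re (c * pd_y (pd_x f) (z + of_real 0 * 1 + of_real 0 * \<i>))
        = Re (c * pd_x (pd_y f) (z + of_real 0 * 1 + of_real 0 * \<i>))"
    proof (rule mixed_partials_commute_real[of "d/2"
        "\<lambda>s t. Re (c * f (z + of_real s * 1 + of_real t * \<i>))"
        "\<lambda>s t. Re (c * pd_x f (z + of_real s * 1 + of_real t * \<i>))"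
        "\<lambda>s t. Re (c * pd_y f (z + of_real s * 1 + of_real t * \<i>))"
        "\<lambda>s t. Re (c * pd_y (pd_x f) (z + of_real s * 1 + of_real t * \<i>))"
        "\<lambda>s t. Re (c * pd_x (pd_y f) (z + of_real s * 1 + of_real t * \<i>))"])
      show "d / 2 > 0" using d by simp
      fix s t :: real assume st: "\<bar>s\<bar> < d/2" "\<bar>t\<bar> < d/2"
      note m = mem[OF st]
      show "((\<lambda>s. Re (c * f (z + of_real s * 1 + of_real t * \<i>))) has_real_derivative
         Re (c * pd_x f (z + of_real s * 1 + of_real t * \<i>))) (at s)"
        by (rule D[OF pd_x_line[OF f1(1) m]])
      show "((\<lambda>t. Re (c * f (z + of_real s * 1 + of_real t * \<i>))) has_real_derivative
         Re (c * pd_y f (z + of_real s * 1 + of_real t * \<i>))) (at t)"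
        by (rule D) (use pd_y_line[OF f1(1), of "z + of_real s * 1" t 0] m in simp)
      show "((\<lambda>t. Re (c * pd_x f (z + of_real s * 1 + of_real t * \<i>))) has_real_derivative
         Re (c * pd_y (pd_x f) (z + of_real s * 1 + of_real t * \<i>))) (at t)"
        by (rule D) (use pd_y_line[OF f1(2), of "z + of_real s * 1" t 0] m in simp)
      show "((\<lambda>s. Re (c * pd_y f (z + of_real s * 1 + of_real t * \<i>))) has_real_derivative
         Re (c * pd_x (pd_y f) (z + of_real s * 1 + of_real t * \<i>))) (at s)"
        by (rule D[OF pd_x_line[OF f1(3) m]])
    qed (rule cont[OF cc(1)], rule cont[OF cc(2)])
    thus ?thesis by simp
  qed
  from this[of 1] this[of "-\<i>"] show ?thesis by (simp add: complex_eq_iff)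
qed

lemma laplacian_eq:
  fixes f :: "complex \<Rightarrow> complex"
  assumes f: "C2_on S f" and S: "open S" and z: "z \<in> S"
  shows "pd_x (pd_x f) z + pd_y (pd_y f) z = 4 * dzbar (dz f) z"
proof -
  have f1: "C1_on S (pd_x f)" "C1_on S (pd_y f)" using f by (auto simp: C2_on_def)
  have "has_wirtinger (\<lambda>w. 1/2 * pd_x f w + (-\<i>/2) * pd_y f w)
     ((1/2 * dz (pd_x f) z + pd_x f z * 0) + ((-\<i>/2) * dz (pd_y f) z + pd_y f z * 0))
     ((1/2 * dzbar (pd_x f) z + pd_x f z * 0) + ((-\<i>/2) * dzbar (pd_y f) z + pd_y f z * 0)) z"
    by (intro has_wirtinger_add has_wirtinger_mult C1_on_wirtingerD(1)[OF f1(1) z] C1_on_wirtingerD(1)[OF f1(2) z])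
       (auto simp: has_wirtinger_def)
  moreover have "(\<lambda>w. 1/2 * pd_x f w + (-\<i>/2) * pd_y f w) = dz f"
    by (auto simp: dz_def fun_eq_iff field_simps)
  ultimately have "dzbar (dz f) z = 1/2 * dzbar (pd_x f) z + (-\<i>/2) * dzbar (pd_y f) z"
    using has_wirtinger_unique(2)[of "dz f"] by auto
  also have "\<dots> = (pd_x (pd_x f) z + pd_y (pd_y f) z) / 4"
    using mixed_partials_commute[OF assms] unfolding dzbar_def by (simp add: field_simps)
  finally have "dzbar (dz f) z = (pd_x (pd_x f) z + pd_y (pd_y f) z) / 4" .
  thus ?thesis unfolding \<open>dzbar (dz f) z = (pd_x (pd_x f) z + pd_y (pd_y f) z) / 4\<close> by simp
qed

section \<open>Maximum principle\<close>

text \<open>As u' vanishes at the maximum, a positive second derivative would make u' positive just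
  to the right of 0, and the mean value theorem would give a larger value of u.\<close>

lemma second_derivative_test:
  fixes u u' :: "real \<Rightarrow> real"
  assumes "d > 0" and u: "\<And>t. \<bar>t\<bar> < d \<Longrightarrow> (u has_real_derivative u' t) (at t)"
    and u'': "(u' has_real_derivative u2) (at 0)"
    and max: "\<And>t. \<bar>t\<bar> < d \<Longrightarrow> u t \<le> u 0"
  shows "u2 \<le> 0"
proof (rule ccontr)
  assume "\<not> u2 \<le> 0"
  have "u' 0 = 0"
    by (rule DERIV_local_max[OF u[of 0] \<open>d > 0\<close>]) (use \<open>d > 0\<close> max in auto)
  obtain d' where d': "d' > 0" "\<And>h. 0 < h \<Longrightarrow> h < d' \<Longrightarrow> u' 0 < u' (0 + h)"
    using DERIV_pos_inc_right[OF u''] \<open>\<not> u2 \<le> 0\<close> by auto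
  define h where "h = min d d' / 2"
  have h: "0 < h" "h < d" "h < d'" using d' \<open>d > 0\<close> by (auto simp: h_def)
  have "\<exists>t. 0 < t \<and> t < h \<and> u h - u 0 = (h - 0) * u' t"
    by (rule MVT2[OF h(1)]) (use h in \<open>auto intro!: u\<close>)
  then obtain t where t: "0 < t" "t < h" "u h - u 0 = h * u' t" by auto
  have "u' t > 0" using d'(2)[of t] t h \<open>u' 0 = 0\<close> by simp
  hence "h * u' t > 0" using h by simp
  thus False using t(3) max[of h] h by simp
qed

text \<open>The test in the form needed below, along a line: G is the comparison term, V the map
  whose squared norm absorbs the gradient, W the position, whose squared norm makes the inequality
  strict.\<close>

lemma second_derivative_test_complex:
  fixes G V W G1 V1 W1 :: "real \<Rightarrow> complex"
  assumes "d > 0"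
    and G: "\<And>t. \<bar>t\<bar> < d \<Longrightarrow> (G has_vector_derivative G1 t) (at t)" "(G1 has_vector_derivative G2) (at 0)"
    and V: "\<And>t. \<bar>t\<bar> < d \<Longrightarrow> (V has_vector_derivative V1 t) (at t)" "(V1 has_vector_derivative V2) (at 0)"
    and W: "\<And>t. \<bar>t\<bar> < d \<Longrightarrow> (W has_vector_derivative W1 t) (at t)" "(W1 has_vector_derivative W2) (at 0)"
    and max: "\<And>t. \<bar>t\<bar> < d \<Longrightarrow> Re (G t) + e * (norm (V t))\<^sup>2 + \<eta> * (norm (W t))\<^sup>2
      \<le> Re (G 0) + e * (norm (V 0))\<^sup>2 + \<eta> * (norm (W 0))\<^sup>2"
  shows "Re G2 + 2 * e * ((norm (V1 0))\<^sup>2 + Re (cnj (V 0) * V2))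
     + 2 * \<eta> * ((norm (W1 0))\<^sup>2 + Re (cnj (W 0) * W2)) \<le> 0"
proof -
  have comp: "((\<lambda>t. Re (f t)) has_real_derivative Re f') (at t)"
     "((\<lambda>t. Im (f t)) has_real_derivative Im f') (at t)"
    if "(f has_vector_derivative f') (at t)" for f f' t
    using bounded_linear.has_vector_derivative[OF bounded_linear_Re that]
      bounded_linear.has_vector_derivative[OF bounded_linear_Im that]
    by (simp_all add: has_real_derivative_iff_has_vector_derivative)
  have sq: "((\<lambda>t. (norm (f t))\<^sup>2) has_real_derivative 2 * (Re (f t) * Re f' + Im (f t) * Im f')) (at t)"
    if "(f has_vector_derivative f') (at t)" for f f' t
    unfolding cmod_power2 by (auto intro!: derivative_eq_intros comp that)
  have sq2: "((\<lambda>t. 2 * (Re (f t) * Re (f' t) + Im (f t) * Im (f' t))) has_real_derivative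
      2 * ((norm (f' t))\<^sup>2 + Re (cnj (f t) * f''))) (at t)"
    if "(f has_vector_derivative f' t) (at t)" "(f' has_vector_derivative f'') (at t)" for f f' f'' t
    unfolding cmod_power2
    by (auto intro!: derivative_eq_intros comp that simp: algebra_simps power2_eq_square)
  have "Re G2 + e * (2 * ((norm (V1 0))\<^sup>2 + Re (cnj (V 0) * V2)))
     + \<eta> * (2 * ((norm (W1 0))\<^sup>2 + Re (cnj (W 0) * W2))) \<le> 0"
  proof (rule second_derivative_test[OF \<open>d > 0\<close>,
      of "\<lambda>t. Re (G t) + e * (norm (V t))\<^sup>2 + \<eta> * (norm (W t))\<^sup>2"
        "\<lambda>t. Re (G1 t) + e * (2 * (Re (V t) * Re (V1 t) + Im (V t) * Im (V1 t)))
           + \<eta> * (2 * (Re (W t) * Re (W1 t) + Im (W t) * Im (W1 t)))"])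
    show "((\<lambda>t. Re (G t) + e * (cmod (V t))\<^sup>2 + \<eta> * (cmod (W t))\<^sup>2) has_real_derivative
          Re (G1 t) + e * (2 * (Re (V t) * Re (V1 t) + Im (V t) * Im (V1 t))) +
          \<eta> * (2 * (Re (W t) * Re (W1 t) + Im (W t) * Im (W1 t)))) (at t)" if "\<bar>t\<bar> < d" for t
      by (intro DERIV_add DERIV_cmult comp sq G V W that)
    show "((\<lambda>t. Re (G1 t) + e * (2 * (Re (V t) * Re (V1 t) + Im (V t) * Im (V1 t))) +
          \<eta> * (2 * (Re (W t) * Re (W1 t) + Im (W t) * Im (W1 t)))) has_real_derivative
          Re G2 + e * (2 * ((cmod (V1 0))\<^sup>2 + Re (cnj (V 0) * V2))) +
          \<eta> * (2 * ((cmod (W1 0))\<^sup>2 + Re (cnj (W 0) * W2)))) (at 0)"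
      by (intro DERIV_add DERIV_cmult comp sq2 G V W) (use \<open>d > 0\<close> in auto)
  qed (rule max)
  thus ?thesis by (simp add: algebra_simps)
qed

text \<open>The tests along the two axes are added. Second derivatives combine to Laplacians,
  |v_x|^2 + |v_y|^2 to twice |v_z|^2 + |v_zbar|^2, and 4 * \<eta> is the Laplacian of \<eta>
  |x|^2.\<close>

lemma local_max_laplacian:
  fixes g v :: "complex \<Rightarrow> complex"
  assumes g: "C2_on S g" and v: "C2_on S v" and S: "open S" and z: "z \<in> S"
    and max: "\<And>x. x \<in> S \<Longrightarrow> Re (g x) + e * (norm (v x))\<^sup>2 + \<eta> * (norm x)\<^sup>2
        \<le> Re (g z) + e * (norm (v z))\<^sup>2 + \<eta> * (norm z)\<^sup>2"
  shows "Re (4 * dzbar (dz g) z) + 2 * e * (2 * ((norm (dz v z))\<^sup>2 + (norm (dzbar v z))\<^sup>2)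
    + Re (cnj (v z) * (4 * dzbar (dz v) z))) + 4 * \<eta> \<le> 0"
proof -
  obtain d where d: "d > 0" "ball z d \<subseteq> S" using S z openE by blast
  have mem: "z + of_real t * 1 \<in> S" "z + of_real t * \<i> \<in> S" if "\<bar>t\<bar> < d" for t
    using d(2) that by (auto simp: dist_norm norm_mult subset_iff)
  have g1: "C1_on S g" "C1_on S (pd_x g)" "C1_on S (pd_y g)" using g by (auto simp: C2_on_def)
  have v1: "C1_on S v" "C1_on S (pd_x v)" "C1_on S (pd_y v)" using v by (auto simp: C2_on_def)
  have X: "((\<lambda>t. f (z + of_real t * 1)) has_vector_derivative pd_x f (z + of_real t * 1)) (at t)"
    if "C1_on S f" "\<bar>t\<bar> < d" for f :: "complex \<Rightarrow> complex" and t
    using pd_x_line[of S f z t 0] mem(1)[OF that(2)] that(1) by simp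
  have Y: "((\<lambda>t. f (z + of_real t * \<i>)) has_vector_derivative pd_y f (z + of_real t * \<i>)) (at t)"
    if "C1_on S f" "\<bar>t\<bar> < d" for f :: "complex \<Rightarrow> complex" and t
    using pd_y_line[of S f z t 0] mem(2)[OF that(2)] that(1) by simp
  have L: "((\<lambda>t. z + of_real t * c) has_vector_derivative c) (at t)" for t c
    by (auto intro!: derivative_eq_intros)
  have x: "Re (pd_x (pd_x g) z) + 2 * e * ((norm (pd_x v z))\<^sup>2 + Re (cnj (v z) * pd_x (pd_x v) z))
     + 2 * \<eta> \<le> 0"
    using second_derivative_test_complex[OF d(1),
        of "\<lambda>t. g (z + of_real t * 1)" "\<lambda>t. pd_x g (z + of_real t * 1)" "pd_x (pd_x g) (z + of_real 0 * 1)"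
        "\<lambda>t. v (z + of_real t * 1)" "\<lambda>t. pd_x v (z + of_real t * 1)" "pd_x (pd_x v) (z + of_real 0 * 1)"
        "\<lambda>t. z + of_real t * 1" "\<lambda>t. 1" 0 e \<eta>, OF X[OF g1(1)] X[OF g1(2)] X[OF v1(1)] X[OF v1(2)] L]
      max[OF mem(1)] d(1) by simp
  have y: "Re (pd_y (pd_y g) z) + 2 * e * ((norm (pd_y v z))\<^sup>2 + Re (cnj (v z) * pd_y (pd_y v) z))
     + 2 * \<eta> \<le> 0"
    using second_derivative_test_complex[OF d(1),
        of "\<lambda>t. g (z + of_real t * \<i>)" "\<lambda>t. pd_y g (z + of_real t * \<i>)" "pd_y (pd_y g) (z + of_real 0 * \<i>)"
        "\<lambda>t. v (z + of_real t * \<i>)" "\<lambda>t. pd_y v (z + of_real t * \<i>)" "pd_y (pd_y v) (z + of_real 0 * \<i>)"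
        "\<lambda>t. z + of_real t * \<i>" "\<lambda>t. \<i>" 0 e \<eta>, OF Y[OF g1(1)] Y[OF g1(3)] Y[OF v1(1)] Y[OF v1(3)] L]
      max[OF mem(2)] d(1) by simp
  have n: "(norm (pd_x v z))\<^sup>2 + (norm (pd_y v z))\<^sup>2 = 2 * ((norm (dz v z))\<^sup>2 + (norm (dzbar v z))\<^sup>2)"
    unfolding pd_x_eq pd_y_eq cmod_power2 by (simp add: algebra_simps power2_eq_square)
  have "Re (pd_x (pd_x g) z + pd_y (pd_y g) z) + 2 * e * ((norm (pd_x v z))\<^sup>2 + (norm (pd_y v z))\<^sup>2
     + Re (cnj (v z) * (pd_x (pd_x v) z + pd_y (pd_y v) z))) + 4 * \<eta> \<le> 0"
    using add_mono[OF x y] by (simp add: algebra_simps)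
  thus ?thesis unfolding laplacian_eq[OF g S z] laplacian_eq[OF v S z] n .
qed

text \<open>Let Q = |v_z|^2 + |v_zbar|^2. At an interior maximum of Re (c v - h) + e |v|^2 + \<eta>'
  |x|^2 the Laplacian of e |v|^2 contributes 4 e Q, while Re (c v) and the remaining part of that
  Laplacian cost at most 2 e Q each, the latter because e * B \<le> 1/2. The surplus 4 \<eta>'
  excludes such a point, so the maximum lies on the sphere.\<close>

lemma almost_harmonic_maximum_principle:
  fixes v h :: "complex \<Rightarrow> complex"
  assumes v: "C2_on S v" and h: "h holomorphic_on S" and S: "open S" "cball z0 r \<subseteq> S"
    and c: "norm c = 1" and e: "e \<ge> 0" "e * B \<le> 1/2" and "r > 0"
    and lap: "\<And>z. z \<in> ball z0 r \<Longrightarrow>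
      norm (4 * dzbar (dz v) z) \<le> 2 * e * ((norm (dz v z))\<^sup>2 + (norm (dzbar v z))\<^sup>2)"
    and B: "\<And>z. z \<in> cball z0 r \<Longrightarrow> norm (v z) \<le> B"
    and bd: "\<And>z. z \<in> sphere z0 r \<Longrightarrow> Re (c * v z - h z) \<le> \<delta>"
    and z: "z \<in> cball z0 r"
  shows "Re (c * v z - h z) \<le> \<delta> + e * B\<^sup>2"
proof -
  define g where "g = (\<lambda>z. c * v z + - h z)"
  define R where "R = norm z0 + r"
  have v1: "C1_on S v" "C1_on S (dz v)" using v by (auto simp: C2_on_iff)
  have h': "(\<lambda>z. - h z) holomorphic_on S" "(*) c holomorphic_on UNIV"
    using h by (auto intro!: holomorphic_intros)
  have g: "C2_on S g" unfolding g_def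
    by (intro C2_on_add S C2_on_holomorphic h' C2_on_compose[OF v C2_on_holomorphic[OF h'(2)]]) auto
  have dg: "dzbar (dz g) z = c * dzbar (dz v) z" if z: "z \<in> S" for z
  proof -
    have W: "has_wirtinger g (c * dz v x + v x * 0 + - deriv h x) (c * dzbar v x + v x * 0 + 0) x" if "x \<in> S" for x
      unfolding g_def
      by (intro has_wirtinger_add has_wirtinger_mult C1_on_wirtingerD(1)[OF v1(1) that]
            has_wirtinger_field_derivative DERIV_minus holomorphic_derivI[OF h S(1) that])
         (auto simp: has_wirtinger_def)
    have "has_wirtinger (dz g) (c * dz (dz v) z + dz v z * 0 + - deriv (deriv h) z)
       (c * dzbar (dz v) z + dz v z * 0 + 0) z"
    proof (rule has_wirtinger_transform[OF _ S(1) z])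
      show "has_wirtinger (\<lambda>x. c * dz v x + - deriv h x) (c * dz (dz v) z + dz v z * 0 + - deriv (deriv h) z)
       (c * dzbar (dz v) z + dz v z * 0 + 0) z"
        by (intro has_wirtinger_add has_wirtinger_mult C1_on_wirtingerD(1)[OF v1(2) z]
            has_wirtinger_field_derivative DERIV_minus holomorphic_derivI[OF _ S(1) z] holomorphic_deriv h S)
           (auto simp: has_wirtinger_def)
    qed (use has_wirtinger_unique[OF W] in auto)
    thus ?thesis using has_wirtinger_unique(2) by auto
  qed
  have "Re (g z) \<le> \<delta> + e * B\<^sup>2 + \<eta>" if "\<eta> > 0" for \<eta>
  proof -
    \<comment> \<open>\<open>R\<close> bounds the norm on the closed ball, so the strictness term
      costs at most \<eta>; the 1 keeps the divisor positive.\<close>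
    define \<eta>' where "\<eta>' = \<eta> / (R\<^sup>2 + 1)"
    have \<eta>': "\<eta>' > 0" "\<eta>' * R\<^sup>2 \<le> \<eta>"
      using that by (auto simp: \<eta>'_def field_simps add_pos_nonneg add_nonneg_pos)
    define u where "u = (\<lambda>x. Re (g x) + e * (norm (v x))\<^sup>2 + \<eta>' * (norm x)\<^sup>2)"
    have "continuous_on S g" "continuous_on S v"
      using g v by (auto simp: C2_on_def intro: C1_on_imp_continuous_on)
    hence "continuous_on (cball z0 r) u"
      unfolding u_def by (intro continuous_intros) (use S(2) continuous_on_subset in blast)+
    moreover have "cball z0 r \<noteq> {}" using \<open>r > 0\<close> by simp
    ultimately obtain x where x: "x \<in> cball z0 r" "\<And>y. y \<in> cball z0 r \<Longrightarrow> u y \<le> u x"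
      using continuous_attains_sup[OF compact_cball] by metis
    have "x \<in> sphere z0 r"
    proof (rule ccontr)
      assume "x \<notin> sphere z0 r"
      with x have xb: "x \<in> ball z0 r" by auto
      hence xS: "x \<in> S" using S(2) by auto
      define Q where "Q = (norm (dz v x))\<^sup>2 + (norm (dzbar v x))\<^sup>2"
      define D where "D = 4 * dzbar (dz v) x"
      have sub: "ball z0 r \<subseteq> S" using S(2) by auto
      have "Re (4 * dzbar (dz g) x) + 2 * e * (2 * Q + Re (cnj (v x) * D)) + 4 * \<eta>' \<le> 0"
        unfolding Q_def D_def
        by (rule local_max_laplacian[OF C2_on_subset[OF g sub] C2_on_subset[OF v sub] open_ball xb])
           (use x(2) in \<open>auto simp: u_def\<close>)
      moreover have "Re (4 * dzbar (dz g) x) = Re (c * D)" using dg[OF xS] by (simp add: D_def)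
      moreover have D: "norm D \<le> 2 * e * Q" using lap[OF xb] by (simp add: D_def Q_def)
      moreover have "\<bar>Re (c * D)\<bar> \<le> norm D"
        using abs_Re_le_cmod[of "c * D"] c by (simp add: norm_mult)
      moreover have "2 * e * \<bar>Re (cnj (v x) * D)\<bar> \<le> norm D"
      proof -
        have "\<bar>Re (cnj (v x) * D)\<bar> \<le> norm (v x) * norm D"
          using abs_Re_le_cmod[of "cnj (v x) * D"] by (simp add: norm_mult)
        also have "\<dots> \<le> B * norm D" using B[of x] x(1) by (intro mult_right_mono) auto
        finally have "2 * e * \<bar>Re (cnj (v x) * D)\<bar> \<le> 2 * e * (B * norm D)"
          using e(1) by (intro mult_left_mono) auto
        also have "\<dots> = 2 * (e * B) * norm D" by simp
        also have "\<dots> \<le> 1 * norm D" using e(2) by (intro mult_right_mono) auto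
        finally show ?thesis by simp
      qed
      moreover have "2 * e * Re (cnj (v x) * D) \<ge> - (2 * e * \<bar>Re (cnj (v x) * D)\<bar>)"
        using e(1) mult_left_mono[of "- \<bar>Re (cnj (v x) * D)\<bar>" "Re (cnj (v x) * D)" "2 * e"] by simp
      moreover have "2 * e * (2 * Q + Re (cnj (v x) * D)) = 2 * (2 * e * Q) + 2 * e * Re (cnj (v x) * D)"
        by (rule distrib_left[of "2 * e" "2 * Q", unfolded mult.left_commute[of "2 * e" 2 Q]])
      ultimately show False using \<eta>'(1) by linarith
    qed
    have "norm x \<le> R" using x(1) norm_triangle_sub[of x z0] by (simp add: R_def dist_norm norm_minus_commute)
    hence "\<eta>' * (norm x)\<^sup>2 \<le> \<eta>' * R\<^sup>2" using \<eta>' by (intro mult_left_mono power_mono) auto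
    moreover have "e * (norm (v x))\<^sup>2 \<le> e * B\<^sup>2" using B[OF x(1)] e by (intro mult_left_mono power_mono) auto
    moreover have "Re (g x) \<le> \<delta>" using bd[OF \<open>x \<in> sphere z0 r\<close>] by (simp add: g_def)
    ultimately have "u x \<le> \<delta> + e * B\<^sup>2 + \<eta>" using \<eta>'(2) by (simp add: u_def)
    moreover have "Re (g z) \<le> u z" using e \<eta>' by (simp add: u_def)
    ultimately show ?thesis using x(2)[OF z] by linarith
  qed
  hence "Re (g z) \<le> \<delta> + e * B\<^sup>2" by (rule field_le_epsilon)
  thus ?thesis by (simp add: g_def)
qed

section \<open>Harmonicity from comparison with polynomials\<close>

text \<open>Passing to exp (f / \<delta>) turns the bound on the real part into bounds 1/e and e for
  a modulus. The Cauchy inequality bounds the derivative of this exponential by e / s, and dividing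
  by the lower bound gives the factor \<open>exp 2\<close>.\<close>

lemma Re_bounded_imp_deriv_bound:
  assumes f: "f holomorphic_on ball z0 R" and z: "cball z s \<subseteq> ball z0 R" "s > 0" and "\<delta> > 0"
    and bd: "\<And>x. x \<in> ball z0 R \<Longrightarrow> \<bar>Re (f x)\<bar> \<le> \<delta>"
  shows "norm (deriv f z) \<le> \<delta> * exp 2 / s"
proof -
  define g where "g = (\<lambda>x. exp (f x / of_real \<delta>))"
  have "z \<in> cball z s" using z(2) by simp
  hence z0: "z \<in> ball z0 R" using z(1) by blast
  have g: "g holomorphic_on ball z0 R" unfolding g_def by (intro holomorphic_intros f) (use \<open>\<delta> > 0\<close> in auto)
  have b: "norm (g x) \<le> exp 1" "norm (g x) \<ge> exp (-1)" if "x \<in> ball z0 R" for x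
  proof -
    have "norm (g x) = exp (Re (f x) / \<delta>)" by (simp add: g_def norm_exp_eq_Re)
    moreover have "Re (f x) / \<delta> \<le> 1" "-1 \<le> Re (f x) / \<delta>"
      using bd[OF that] \<open>\<delta> > 0\<close> by (auto simp: abs_le_iff divide_le_eq le_divide_eq)
    ultimately show "norm (g x) \<le> exp 1" "norm (g x) \<ge> exp (-1)" by simp_all
  qed
  have "norm ((deriv ^^ 1) g z) \<le> fact 1 * exp 1 / s ^ 1"
  proof (rule Cauchy_inequality)
    show "g holomorphic_on ball z s" "continuous_on (cball z s) g"
      by (rule holomorphic_on_subset[OF g order_trans[OF ball_subset_cball z(1)]])
         (rule holomorphic_on_imp_continuous_on[OF holomorphic_on_subset[OF g z(1)]])
    show "norm (g x) \<le> exp 1" if "norm (z - x) = s" for x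
      using that z by (intro b) (auto simp: dist_norm)
  qed (use z in auto)
  hence 1: "norm (deriv g z) \<le> exp 1 / s" by simp
  have "(g has_field_derivative (g z * (deriv f z / of_real \<delta>))) (at z)"
    unfolding g_def by (rule derivative_eq_intros holomorphic_derivI[OF f open_ball z0] refl)+
      (use \<open>\<delta> > 0\<close> in auto)
  hence "deriv g z = g z * (deriv f z / of_real \<delta>)" by (rule DERIV_imp_deriv)
  hence "norm (g z) * (norm (deriv f z) / \<delta>) \<le> exp 1 / s"
    using 1 \<open>\<delta> > 0\<close> by (simp add: norm_mult norm_divide)
  moreover have "exp (-1) * (norm (deriv f z) / \<delta>) \<le> norm (g z) * (norm (deriv f z) / \<delta>)"
    using b(2)[OF z0] \<open>\<delta> > 0\<close> by (intro mult_right_mono) auto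
  ultimately have "exp (-1) * (norm (deriv f z) / \<delta>) \<le> exp 1 / s" by linarith
  hence "exp 1 * (exp (-1) * (norm (deriv f z) / \<delta>)) \<le> exp 1 * (exp 1 / s)"
    by (rule mult_left_mono) simp
  also have "exp 1 * (exp (-1) * (norm (deriv f z) / \<delta>)) = norm (deriv f z) / \<delta>"
    by (simp add: exp_minus field_simps)
  also have "exp 1 * (exp 1 / s) = exp 2 / s" by (simp flip: exp_add)
  finally show ?thesis using \<open>\<delta> > 0\<close> by (simp add: field_simps)
qed

text \<open>On the sphere \<^term>\<open>cnj z = r\<^sup>2 / z\<close>, so a polynomial in \<^term>\<open>z\<close> and
  \<^term>\<open>cnj z\<close> has the same real part as a holomorphic polynomial.\<close>

lemma real_polynomial_on_sphere_eq_Re_poly: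
  assumes g: "real_polynomial_function (g :: complex \<Rightarrow> real)" and "r > 0"
  shows "\<exists>p. \<forall>z \<in> sphere 0 r. g z = Re (poly p z)"
proof -
  \<comment> \<open>A polynomial in two variables is encoded as a polynomial in \<open>cnj z\<close>
    whose coefficients are polynomials in \<open>z\<close>.\<close>
  have "\<exists>Q :: complex poly poly. \<forall>z. of_real (g z) = poly (poly Q [:cnj z:]) z"
    using g
  proof induction
    case (linear g)
    then interpret bounded_linear g .
    have lin: "g z = Re z * g 1 + Im z * g \<i>" for z
    proof -
      have "z = Re z *\<^sub>R 1 + Im z *\<^sub>R \<i>" by (simp add: complex_eq_iff)
      hence "g z = Re z *\<^sub>R g 1 + Im z *\<^sub>R g \<i>" by (metis add scaleR)
      thus ?thesis by simp
    qed
    have "of_real (g z) = poly (poly [:[:0, Complex (g 1 / 2) (- g \<i> / 2):], [:Complex (g 1 / 2) (g \<i> / 2):]:] [:cnj z:]) z" for z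
      unfolding lin[of z] by (simp add: complex_eq_iff)
    thus ?case by blast
  next
    case (const c)
    show ?case by (intro exI[of _ "[:[:of_real c:]:]"]) simp
  next
    case (add f g)
    then obtain P Q where "\<forall>z. of_real (f z) = poly (poly P [:cnj z:]) z"
      "\<forall>z. of_real (g z) = poly (poly Q [:cnj z:]) z" by blast
    thus ?case by (intro exI[of _ "P + Q"]) simp
  next
    case (mult f g)
    then obtain P Q where "\<forall>z. of_real (f z) = poly (poly P [:cnj z:]) z"
      "\<forall>z. of_real (g z) = poly (poly Q [:cnj z:]) z" by blast
    thus ?case by (intro exI[of _ "P * Q"]) simp
  qed
  then obtain Q :: "complex poly poly" where Q: "of_real (g z) = poly (poly Q [:cnj z:]) z" for z by blast
  \<comment> \<open>The functions whose real part agrees on the sphere with that of a polynomial.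
    They are closed under sums, so it suffices to treat monomials.\<close>
  define H where "H = (\<lambda>f. \<exists>p. \<forall>z\<in>sphere 0 r. Re (f z) = Re (poly p z))"
  have H_sum: "H (\<lambda>z. \<Sum>i\<in>A. f i z)" if "finite A" "\<And>i. i \<in> A \<Longrightarrow> H (f i)" for f and A :: "nat set"
    using that
  proof (induction A)
    case empty
    thus ?case unfolding H_def by (intro exI[of _ 0]) simp
  next
    case (insert i A)
    then obtain p q where "\<forall>z\<in>sphere 0 r. Re (f i z) = Re (poly p z)"
       "\<forall>z\<in>sphere 0 r. Re (\<Sum>i\<in>A. f i z) = Re (poly q z)"
      unfolding H_def by blast
    thus ?case using insert unfolding H_def by (intro exI[of _ "p + q"]) simp
  qed
  have cnj_mult: "z * cnj z = of_real (r\<^sup>2)" if "z \<in> sphere 0 r" for z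
    using that by (simp add: complex_norm_square[symmetric])
  have H_monom: "H (\<lambda>z. c * z ^ i * cnj z ^ j)" for c i j
  proof (cases "j \<le> i")
    case True
    have "c * z ^ i * cnj z ^ j = poly (monom (c * of_real (r\<^sup>2) ^ j) (i - j)) z" if "z \<in> sphere 0 r" for z
    proof -
      have "c * z ^ i * cnj z ^ j = c * z ^ (i - j) * (z * cnj z) ^ j"
        using True by (simp add: power_mult_distrib mult_ac flip: power_add)
      thus ?thesis unfolding cnj_mult[OF that] poly_monom by (simp only: mult_ac)
    qed
    thus ?thesis unfolding H_def by metis
  next
    case False
    \<comment> \<open>With more conjugates than factors z the monomial is on the sphere the
      conjugate of a polynomial, and conjugation keeps the real part.\<close>
    have "Re (c * z ^ i * cnj z ^ j) = Re (poly (monom (cnj c * of_real (r\<^sup>2) ^ i) (j - i)) z)" if "z \<in> sphere 0 r" for z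
    proof -
      have "c * z ^ i * cnj z ^ j = c * cnj z ^ (j - i) * (z * cnj z) ^ i"
        using False by (simp add: power_mult_distrib mult_ac flip: power_add)
      also have "\<dots> = cnj (poly (monom (cnj c * of_real (r\<^sup>2) ^ i) (j - i)) z)"
        by (simp add: cnj_mult[OF that] poly_monom)
      finally show ?thesis by simp
    qed
    thus ?thesis unfolding H_def by metis
  qed
  have "H (\<lambda>z. \<Sum>j\<le>degree Q. \<Sum>i\<le>degree (coeff Q j). coeff (coeff Q j) i * z ^ i * cnj z ^ j)"
    by (intro H_sum H_monom) auto
  moreover have "of_real (g z) = (\<Sum>j\<le>degree Q. \<Sum>i\<le>degree (coeff Q j). coeff (coeff Q j) i * z ^ i * cnj z ^ j)" for z
  proof -
    have "poly (poly Q [:cnj z:]) z = (\<Sum>j\<le>degree Q. poly (coeff Q j) z * cnj z ^ j)"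
      by (simp add: poly_altdef[of Q] poly_sum)
    thus ?thesis unfolding Q by (simp add: poly_altdef sum_distrib_right)
  qed
  ultimately have "H (\<lambda>z. of_real (g z))" by simp
  thus ?thesis by (simp add: H_def)
qed

text \<open>A substitute for solving the Dirichlet problem. Stone-Weierstrass approximates g on the
  sphere by real parts of polynomials, the assumed maximum principle carries the error into the
  ball, and the polynomials converge once their imaginary parts are normalized.\<close>

lemma Re_holomorphic_of_poly_maximum_principle:
  fixes g :: "complex \<Rightarrow> real"
  assumes "r > 0" and g: "continuous_on (cball 0 r) g"
    and max: "\<And>p \<delta> z. (\<And>z. z \<in> sphere 0 r \<Longrightarrow> \<bar>g z - Re (poly p z)\<bar> \<le> \<delta>) \<Longrightarrow>
       z \<in> cball 0 r \<Longrightarrow> \<bar>g z - Re (poly p z)\<bar> \<le> \<delta>"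
  shows "\<exists>F. F holomorphic_on ball 0 r \<and> (\<forall>z\<in>ball 0 r. g z = Re (F z))"
proof -
  have "\<exists>p. \<forall>z\<in>cball 0 r. \<bar>g z - Re (poly p z)\<bar> \<le> \<delta>" if \<delta>: "\<delta> > 0" for \<delta>
  proof -
    have "continuous_on (sphere 0 r) g" by (rule continuous_on_subset[OF g]) auto
    then obtain q where q: "real_polynomial_function q" "\<And>z. z \<in> sphere 0 r \<Longrightarrow> \<bar>g z - q z\<bar> < \<delta>"
      using Stone_Weierstrass_real_polynomial_function[OF compact_sphere _ \<delta>] by metis
    obtain p where "\<forall>z \<in> sphere 0 r. q z = Re (poly p z)"
      using real_polynomial_on_sphere_eq_Re_poly[OF q(1) \<open>r > 0\<close>] by blast
    hence "\<And>z. z \<in> sphere 0 r \<Longrightarrow> \<bar>g z - Re (poly p z)\<bar> \<le> \<delta>" using q(2) by (simp add: less_imp_le)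
    from max[OF this] show ?thesis by blast
  qed
  hence "\<exists>p. \<forall>n. \<forall>z\<in>cball 0 r. \<bar>g z - Re (poly (p n) z)\<bar> \<le> inverse (real (Suc n))"
    by (intro choice allI) simp
  then obtain p where p: "\<And>n z. z \<in> cball 0 r \<Longrightarrow> \<bar>g z - Re (poly (p n) z)\<bar> \<le> inverse (real (Suc n))"
    by blast
  \<comment> \<open>Real parts determine a holomorphic function only up to an imaginary constant;
    making Im vanish at 0 removes this freedom and leaves the real parts unchanged.\<close>
  define q where "q = (\<lambda>n z. poly (p n) z - \<i> * Im (poly (p n) 0))"
  have q_hol: "q n holomorphic_on A" for n A unfolding q_def by (intro holomorphic_intros)
  have Re_q: "Re (q n z) = Re (poly (p n) z)" for n z by (simp add: q_def)
  have unif: "uniformly_convergent_on (cball 0 s) q" if s: "0 < s" "s < r" for s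
    unfolding uniformly_convergent_eq_Cauchy uniformly_Cauchy_on_def
  proof (intro allI impI)
    fix e :: real assume "e > 0"
    define t where "t = r - s"
    have "t > 0" using s by (simp add: t_def)
    \<comment> \<open>If the real parts differ by at most \<delta> then |q m - q n| \<le> \<delta> *
      C: the 1 accounts for the value at 0, the rest for the derivative bound \<delta> * exp 2 /
      (t/2) along a radius of length at most s.\<close>
    define C where "C = 1 + 2 * exp 2 / t * s"
    have "C > 0" using \<open>t > 0\<close> s by (simp add: C_def add_pos_nonneg)
    obtain M where M: "inverse (real (Suc M)) < e / (4 * C)"
      using reals_Archimedean[of "e / (4 * C)"] \<open>e > 0\<close> \<open>C > 0\<close> by auto
    have "dist (q m z) (q n z) < e" if z: "z \<in> cball 0 s" and mn: "m \<ge> M" "n \<ge> M" for z m n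
    proof -
      define f where "f = (\<lambda>z. q m z - q n z)"
      define \<delta> where "\<delta> = 2 * inverse (real (Suc M))"
      have d0: "\<delta> > 0" by (simp add: \<delta>_def)
      have f: "f holomorphic_on A" for A unfolding f_def by (intro holomorphic_intros q_hol)
      have inv: "inverse (real (Suc m)) \<le> inverse (real (Suc M))" "inverse (real (Suc n)) \<le> inverse (real (Suc M))"
        using mn by (auto intro!: le_imp_inverse_le)
      have bd: "\<bar>Re (f x)\<bar> \<le> \<delta>" if "x \<in> ball 0 r" for x
      proof -
        have "Re (f x) = Re (poly (p m) x) - Re (poly (p n) x)" by (simp add: f_def Re_q)
        moreover have "\<bar>g x - Re (poly (p m) x)\<bar> \<le> inverse (real (Suc m))"
          "\<bar>g x - Re (poly (p n) x)\<bar> \<le> inverse (real (Suc n))" using p[of x] that by auto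
        ultimately show ?thesis using inv unfolding \<delta>_def by linarith
      qed
      have t2: "cball x (t/2) \<subseteq> ball 0 r" if "x \<in> cball 0 s" for x :: complex
      proof
        fix y assume "y \<in> cball x (t/2)"
        hence "norm (y - x) \<le> t/2" by (simp add: dist_norm norm_minus_commute)
        moreover have "norm x \<le> s" using that by simp
        ultimately show "y \<in> ball 0 r"
          using norm_triangle_sub[of y x] \<open>t > 0\<close> unfolding t_def by simp
      qed
      have "norm (f z - f 0) \<le> \<delta> * exp 2 / (t/2) * norm (z - 0)"
      proof (rule field_differentiable_bound[OF convex_cball])
        show "(f has_field_derivative deriv f x) (at x within cball 0 s)" if "x \<in> cball 0 s" for x
          by (rule DERIV_subset[OF holomorphic_derivI[OF f open_UNIV]]) auto
        show "norm (deriv f x) \<le> \<delta> * exp 2 / (t/2)" if "x \<in> cball 0 s" for x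
          by (rule Re_bounded_imp_deriv_bound[OF f t2[OF that] _ d0 bd]) (use \<open>t > 0\<close> in auto)
      qed (use z s in auto)
      also have "\<dots> \<le> \<delta> * exp 2 / (t/2) * s"
        using z d0 \<open>t > 0\<close> by (intro mult_left_mono) auto
      finally have 1: "norm (f z - f 0) \<le> \<delta> * (2 * exp 2 / t * s)" by (simp add: field_simps)
      have "Im (f 0) = 0" by (simp add: f_def q_def)
      hence "f 0 = of_real (Re (f 0))" by (simp add: complex_eq_iff)
      hence "norm (f 0) = \<bar>Re (f 0)\<bar>" by (metis norm_of_real)
      hence 2: "norm (f 0) \<le> \<delta>" using bd[of 0] \<open>r > 0\<close> by simp
      have "norm (f z) \<le> \<delta> + \<delta> * (2 * exp 2 / t * s)"
        using 1 2 norm_triangle_sub[of "f z" "f 0"] by linarith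
      also have "\<dots> = \<delta> * C" by (simp add: C_def algebra_simps)
      also have "\<dots> < e"
        using M \<open>C > 0\<close> \<open>e > 0\<close> by (simp add: \<delta>_def field_simps)
      finally show ?thesis by (simp add: f_def dist_norm)
    qed
    thus "\<exists>M. \<forall>x\<in>cball 0 s. \<forall>m\<ge>M. \<forall>n\<ge>M. dist (q m x) (q n x) < e" by blast
  qed
  define F where "F = (\<lambda>z. lim (\<lambda>n. q n z))"
  have lim: "uniform_limit (cball 0 s) q F sequentially" if "0 < s" "s < r" for s
    using unif[OF that] uniformly_convergent_uniform_limit_iff[of "cball 0 s" q] by (simp add: F_def)
  have "F holomorphic_on ball 0 r"
  proof (rule holomorphic_uniform_sequence[OF open_ball q_hol])
    fix x :: complex assume x: "x \<in> ball 0 r"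
    define d where "d = (r - norm x) / 2"
    have "d > 0" using x by (simp add: d_def)
    have sub: "cball x d \<subseteq> cball 0 (norm x + d)"
    proof
      fix y assume "y \<in> cball x d"
      hence "norm (y - x) \<le> d" by (simp add: dist_norm norm_minus_commute)
      thus "y \<in> cball 0 (norm x + d)" using norm_triangle_sub[of y x] by simp
    qed
    have s: "0 < norm x + d" "norm x + d < r"
      using x \<open>d > 0\<close> add_nonneg_pos[OF norm_ge_zero, of d x] by (auto simp: d_def field_simps)
    have "cball 0 (norm x + d) \<subseteq> ball 0 r" using s by auto
    thus "\<exists>d>0. cball x d \<subseteq> ball 0 r \<and> uniform_limit (cball x d) q F sequentially"
      using \<open>d > 0\<close> sub uniform_limit_on_subset[OF lim[OF s] sub] by blast
  qed
  moreover have "g z = Re (F z)" if z: "z \<in> ball 0 r" for z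
  proof -
    have s: "0 < (norm z + r) / 2" "(norm z + r) / 2 < r" "z \<in> cball 0 ((norm z + r) / 2)"
      using z \<open>r > 0\<close> by (auto simp: add_pos_nonneg field_simps)
    have "(\<lambda>n. q n z) \<longlonglongrightarrow> F z" by (rule tendsto_uniform_limitI[OF lim[OF s(1,2)] s(3)])
    hence "(\<lambda>n. Re (poly (p n) z)) \<longlonglongrightarrow> Re (F z)" using tendsto_Re Re_q by (metis (no_types, lifting) ext)
    moreover have "(\<lambda>n. Re (poly (p n) z)) \<longlonglongrightarrow> g z"
    proof (rule Lim_null_comparison[THEN LIM_zero_cancel])
      show "\<forall>\<^sub>F n in sequentially. norm (Re (poly (p n) z) - g z) \<le> inverse (real (Suc n))"
        using p[of z] z by (intro always_eventually) (auto simp: abs_minus_commute)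
      show "(\<lambda>n. inverse (real (Suc n))) \<longlonglongrightarrow> 0" by (rule LIMSEQ_inverse_real_of_nat)
    qed
    ultimately show ?thesis using LIMSEQ_unique by blast
  qed
  ultimately show ?thesis by blast
qed

text \<open>The map splits as P + cnj Q with P = (F + i G) / 2 and Q = (F - i G) / 2. Only the
  derivative of P survives \<open>dz\<close>, and \<open>dzbar\<close> annihilates it.\<close>

lemma dzbar_dz_Re_Im_holomorphic:
  assumes F: "F holomorphic_on S" and G: "G holomorphic_on S" and S: "open S"
    and v: "\<And>z. z \<in> S \<Longrightarrow> v z = Complex (Re (F z)) (Re (G z))"
  shows "C2_on S v" "z \<in> S \<Longrightarrow> dzbar (dz v) z = 0"
proof -
  define P where "P = (\<lambda>z. (F z + \<i> * G z) / 2)"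
  define Q where "Q = (\<lambda>z. (F z - \<i> * G z) / 2)"
  have P: "P holomorphic_on S" and Q: "Q holomorphic_on S"
    unfolding P_def Q_def by (intro holomorphic_intros F G; simp)+
  have veq: "P z + cnj (Q z) = v z" if "z \<in> S" for z
    by (simp add: v[OF that] P_def Q_def complex_eq_iff field_simps)
  have W: "has_wirtinger v (deriv P z) (cnj (deriv Q z)) z" if "z \<in> S" for z
  proof (rule has_wirtinger_transform[OF _ S that veq])
    have "has_wirtinger (\<lambda>x. P x + cnj (Q x)) (deriv P z + cnj 0) (0 + cnj (deriv Q z)) z"
      by (intro has_wirtinger_add has_wirtinger_cnj has_wirtinger_field_derivative
          holomorphic_derivI[OF P S that] holomorphic_derivI[OF Q S that])
    thus "has_wirtinger (\<lambda>x. P x + cnj (Q x)) (deriv P z) (cnj (deriv Q z)) z" by simp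
  qed
  have "C1_on S (deriv P)" "C1_on S (deriv Q)"
    by (intro C1_on_holomorphic holomorphic_deriv P Q S)+
  hence "C1_on S (dz v)" "C1_on S (dzbar v)"
    using C1_on_transform[OF _ S, of "deriv P" "dz v"] C1_on_transform[OF C1_on_cnj S, of "deriv Q" "dzbar v"]
      has_wirtinger_unique[OF W] by auto
  moreover have "C1_on S v"
    using C1_on_transform[OF C1_on_add[OF C1_on_holomorphic[OF P S] C1_on_cnj[OF C1_on_holomorphic[OF Q S]]] S, of v] veq
    by blast
  ultimately show "C2_on S v" by (simp add: C2_on_iff)
  assume z: "z \<in> S"
  have "has_wirtinger (deriv P) (deriv (deriv P) z) 0 z"
    by (intro has_wirtinger_field_derivative holomorphic_derivI[OF _ S z] holomorphic_deriv P S)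
  from has_wirtinger_transform[OF this S z, of "dz v"] show "dzbar (dz v) z = 0"
    using has_wirtinger_unique[OF W] has_wirtinger_unique(2) by auto
qed

text \<open>Only the maximum principle is passed to the limit, where its error terms vanish with
  \<open>e n\<close>. Used for c and -c it gives Re (c * v0) the two-sided comparison with
  polynomials; c = 1 and c = -i yield the two real components.\<close>

lemma almost_harmonic_limit:
  fixes v :: "nat \<Rightarrow> complex \<Rightarrow> complex"
  assumes S: "open S" "cball 0 r \<subseteq> S" "r > 0" and v: "\<And>n. C2_on S (v n)"
    and B: "\<And>n z. z \<in> cball 0 r \<Longrightarrow> norm (v n z) \<le> B"
    and e: "\<And>n. e n \<ge> 0" "e \<longlonglongrightarrow> 0"
    and lap: "\<And>n z. z \<in> ball 0 r \<Longrightarrow> norm (dzbar (dz (v n)) z) \<le> e n * norm (dz (v n) z) * norm (dzbar (v n) z)"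
    and lim: "uniform_limit (cball 0 r) v v0 sequentially"
  shows "C2_on (ball 0 r) v0" "z \<in> ball 0 r \<Longrightarrow> dzbar (dz v0) z = 0"
proof -
  have cont: "continuous_on (cball 0 r) v0"
  proof (intro uniform_limit_theorem[OF _ lim] always_eventually allI)
    show "continuous_on (cball 0 r) (v n)" for n
      using v[of n] by (intro continuous_on_subset[OF C1_on_imp_continuous_on S(2)]) (simp add: C2_on_def)
  qed simp
  have one_sided: "Re (c * v0 z - h z) \<le> \<delta>"
    if c: "norm c = 1" and h: "h holomorphic_on S" and z: "z \<in> cball 0 r"
      and bd: "\<And>z. z \<in> sphere 0 r \<Longrightarrow> Re (c * v0 z - h z) \<le> \<delta>" for c h \<delta> z
  proof -
    have "Re (c * v0 z - h z) \<le> \<delta> + \<eta>" if "\<eta> > 0" for \<eta>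
    proof -
      \<comment> \<open>One third of \<eta> each pays for replacing \<open>v0\<close> by
        \<open>v n\<close> on the sphere, for replacing it back at z, and for the error of the
        maximum principle, which is applied with 2 * \<open>e n\<close>.\<close>
      have close': "\<forall>\<^sub>F n in sequentially. \<forall>x\<in>cball 0 r. dist (v n x) (v0 x) < \<eta> / 3"
        using uniform_limitD[OF lim, of "\<eta> / 3"] that by simp
      have T: "(\<lambda>n. 2 * e n * B) \<longlonglongrightarrow> 2 * 0 * B" "(\<lambda>n. 2 * e n * B\<^sup>2) \<longlonglongrightarrow> 2 * 0 * B\<^sup>2"
        by (intro tendsto_intros e)+
      have "\<forall>\<^sub>F n in sequentially. 2 * e n * B < 1/2" "\<forall>\<^sub>F n in sequentially. 2 * e n * B\<^sup>2 < \<eta>/3"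
        using order_tendstoD(2)[OF T(1), of "1/2"] order_tendstoD(2)[OF T(2), of "\<eta>/3"] that by simp_all
      with close' have "\<forall>\<^sub>F n in sequentially. (\<forall>x\<in>cball 0 r. dist (v n x) (v0 x) < \<eta> / 3) \<and>
          2 * e n * B < 1/2 \<and> 2 * e n * B\<^sup>2 < \<eta>/3" by eventually_elim auto
      then obtain n where n: "\<And>x. x \<in> cball 0 r \<Longrightarrow> dist (v n x) (v0 x) < \<eta> / 3"
          "2 * e n * B < 1/2" "2 * e n * B\<^sup>2 < \<eta>/3"
        by (metis (no_types, lifting) eventually_happens sequentially_bot)
      have close: "\<bar>Re (c * v n x) - Re (c * v0 x)\<bar> \<le> \<eta> / 3" if "x \<in> cball 0 r" for x
      proof -
        have "\<bar>Re (c * v n x) - Re (c * v0 x)\<bar> = \<bar>Re (c * (v n x - v0 x))\<bar>"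
          by (simp add: algebra_simps)
        also have "\<dots> \<le> norm (c * (v n x - v0 x))" by (rule abs_Re_le_cmod)
        also have "\<dots> \<le> \<eta>/3" using n(1)[OF that] c by (simp add: norm_mult dist_norm)
        finally show ?thesis .
      qed
      have "Re (c * v n z - h z) \<le> (\<delta> + \<eta>/3) + 2 * e n * B\<^sup>2"
      proof (rule almost_harmonic_maximum_principle[OF v h S(1,2) c _ _ S(3) _ B _ z])
        fix x :: complex assume x: "x \<in> ball 0 r"
        have "2 * (norm (dz (v n) x) * norm (dzbar (v n) x)) \<le> (norm (dz (v n) x))\<^sup>2 + (norm (dzbar (v n) x))\<^sup>2"
          using sum_squares_bound by (simp add: mult.assoc)
        hence "4 * e n * (norm (dz (v n) x) * norm (dzbar (v n) x))
           \<le> 2 * e n * ((norm (dz (v n) x))\<^sup>2 + (norm (dzbar (v n) x))\<^sup>2)"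
          using mult_left_mono[of _ _ "2 * e n"] e(1)[of n] by fastforce
        moreover have "norm (4 * dzbar (dz (v n)) x) \<le> 4 * e n * (norm (dz (v n) x) * norm (dzbar (v n) x))"
          using lap[OF x, of n] by (simp add: norm_mult algebra_simps)
        moreover have "2 * e n * ((norm (dz (v n) x))\<^sup>2 + (norm (dzbar (v n) x))\<^sup>2) \<le>
            2 * (2 * e n) * ((norm (dz (v n) x))\<^sup>2 + (norm (dzbar (v n) x))\<^sup>2)"
          using e(1)[of n] by (intro mult_right_mono) auto
        ultimately show "norm (4 * dzbar (dz (v n)) x) \<le>
            2 * (2 * e n) * ((norm (dz (v n) x))\<^sup>2 + (norm (dzbar (v n) x))\<^sup>2)" by linarith
      next
        fix x :: complex assume x: "x \<in> sphere 0 r"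
        have "x \<in> cball 0 r" using x by simp
        from abs_le_D1[OF close[OF this]] bd[OF x]
        show "Re (c * v n x - h x) \<le> \<delta> + \<eta>/3" unfolding minus_complex.simps by linarith
      qed (use e(1)[of n] n(2) in auto)
      thus ?thesis using abs_le_D2[OF close[OF z]] n(3) unfolding minus_complex.simps by linarith
    qed
    thus ?thesis by (rule field_le_epsilon)
  qed
  have part: "\<exists>F. F holomorphic_on ball 0 r \<and> (\<forall>z\<in>ball 0 r. Re (c * v0 z) = Re (F z))" if c: "norm c = 1" for c
  proof (rule Re_holomorphic_of_poly_maximum_principle[OF S(3)])
    show "continuous_on (cball 0 r) (\<lambda>z. Re (c * v0 z))" by (intro continuous_intros cont)
    fix p \<delta> and z :: complex assume bd: "\<And>z. z \<in> sphere 0 r \<Longrightarrow> \<bar>Re (c * v0 z) - Re (poly p z)\<bar> \<le> \<delta>" and z: "z \<in> cball 0 r"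
    have hol: "poly p holomorphic_on S" "(\<lambda>z. - poly p z) holomorphic_on S" by (intro holomorphic_intros)+
    have "Re (c * v0 z - poly p z) \<le> \<delta>"
      by (rule one_sided[OF c hol(1) z]) (use bd in \<open>auto simp: abs_le_iff\<close>)
    moreover have "Re ((-c) * v0 z - (- poly p z)) \<le> \<delta>"
      by (rule one_sided[OF _ hol(2) z]) (use bd c in \<open>auto simp: abs_le_iff\<close>)
    ultimately show "\<bar>Re (c * v0 z) - Re (poly p z)\<bar> \<le> \<delta>" by simp
  qed
  obtain F where F: "F holomorphic_on ball 0 r" "\<And>z. z \<in> ball 0 r \<Longrightarrow> Re (v0 z) = Re (F z)"
    using part[of 1] by auto
  obtain G where G: "G holomorphic_on ball 0 r" "\<And>z. z \<in> ball 0 r \<Longrightarrow> Im (v0 z) = Re (G z)"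
    using part[of "-\<i>"] by auto
  have "v0 z = Complex (Re (F z)) (Re (G z))" if "z \<in> ball 0 r" for z
    using F(2)[OF that] G(2)[OF that] by (simp add: complex_eq_iff)
  from dzbar_dz_Re_Im_holomorphic[OF F(1) G(1) open_ball this]
  show "C2_on (ball 0 r) v0" "z \<in> ball 0 r \<Longrightarrow> dzbar (dz v0) z = 0" by auto
qed

section \<open>The Courant-Lebesgue lemma\<close>

text \<open>The area formula is available for \<^typ>\<open>real ^ 2\<close>, Fubini's theorem for
  \<^typ>\<open>real \<times> real\<close>; this lemma connects the two.\<close>

lemma has_integral_prod_of_real2:
  fixes f :: "real ^ 2 \<Rightarrow> real"
  assumes "(f has_integral i) (cbox (vector [a, c]) (vector [b, d]))"
  shows "((\<lambda>p. f (vector [fst p, snd p])) has_integral i) (cbox (a, c) (b, d))"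
proof -
  define g :: "real \<times> real \<Rightarrow> real ^ 2" where "g = (\<lambda>p. vector [fst p, snd p])"
  define h :: "real ^ 2 \<Rightarrow> real \<times> real" where "h = (\<lambda>x. (x $ 1, x $ 2))"
  have hg: "h (g x) = x" and gh: "g (h y) = y" for x y
    by (simp_all add: g_def h_def vec_eq_iff forall_2)
  have g_cbox: "g ` cbox u v = cbox (g u) (g v)" and h_cbox: "h ` cbox x y = cbox (h x) (h y)" for u v x y
  proof -
    have g_mem: "g p \<in> cbox (g u) (g v) \<longleftrightarrow> p \<in> cbox u v" for p u v
      by (cases p; cases u; cases v) (auto simp: g_def mem_box_cart forall_2 cbox_Pair_eq)
    have "x \<in> g ` cbox u v" if "x \<in> cbox (g u) (g v)" for x
      using g_mem[of "h x" u v] that gh[of x] by (intro image_eqI[of _ _ "h x"]) simp_all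
    thus "g ` cbox u v = cbox (g u) (g v)" using g_mem[of _ u v] by blast
    have "h v \<in> cbox (h x) (h y)" if "v \<in> cbox x y" for v
      using g_mem[of "h v" "h x" "h y"] that unfolding gh by simp
    moreover have "p \<in> h ` cbox x y" if "p \<in> cbox (h x) (h y)" for p
      using g_mem[of p "h x" "h y"] that hg[of p] unfolding gh by (intro image_eqI[of _ _ "g p"]) simp_all
    ultimately show "h ` cbox x y = cbox (h x) (h y)" by blast
  qed
  have content: "measure lborel (g ` cbox u v) = 1 * measure lborel (cbox u v)" for u v
  proof (cases "cbox u v = {}")
    case False
    hence ne: "cbox (g u) (g v) \<noteq> {}" unfolding g_cbox[symmetric] by simp
    obtain u1 u2 v1 v2 where uv: "u = (u1, u2)" "v = (v1, v2)" by (cases u; cases v)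
    have "u1 \<le> v1" "u2 \<le> v2" using False by (auto simp: uv cbox_Pair_eq)
    thus ?thesis unfolding g_cbox content_cbox_cart[OF ne]
      by (simp add: uv content_Pair g_def UNIV_2)
  qed simp
  have "((\<lambda>x. f (g x)) has_integral (1 / 1) *\<^sub>R i) (h ` cbox (vector [a, c]) (vector [b, d]))"
  proof (rule has_integral_twiddle[OF _ hg gh])
    have "bounded_linear g"
      unfolding g_def by (intro linear_conv_bounded_linear[THEN iffD1] linearI) (auto simp: vec_eq_iff forall_2)
    thus "isCont g x" for x by (rule linear_continuous_at)
    show "\<exists>w z. g ` cbox u v = cbox w z" for u v using g_cbox by blast
    show "\<exists>w z. h ` cbox u v = cbox w z" for u v using h_cbox by blast
  qed (use assms content in auto)
  moreover have "h ` cbox (vector [a, c]) (vector [b, d]) = cbox (a, c) (b, d)"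
    unfolding h_cbox by (simp add: h_def)
  ultimately show ?thesis by (simp add: g_def)
qed

text \<open>For an injective map the integral of the Jacobian is the area of the image. Injectivity
  is asked only on the open rectangle because the lemma will be applied to f composed with an
  exponential, which identifies the edges Im = 0 and Im = 2 pi.\<close>

lemma integral_jacobian_le_area:
  fixes G :: "complex \<Rightarrow> complex"
  assumes G: "C1_on T G" and T: "\<And>s t. s \<in> {a..b} \<Longrightarrow> t \<in> {c..d} \<Longrightarrow> Complex s t \<in> T"
    and inj: "inj_on G {z. a < Re z \<and> Re z < b \<and> c < Im z \<and> Im z < d}"
    and img: "\<And>s t. s \<in> {a..b} \<Longrightarrow> t \<in> {c..d} \<Longrightarrow> G (Complex s t) \<in> cbox p q"
    and ab: "a < b" "c < d"
  shows "integral {a..b} (\<lambda>s. integral {c..d} (\<lambda>t.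
       \<bar>(norm (dz G (Complex s t)))\<^sup>2 - (norm (dzbar G (Complex s t)))\<^sup>2\<bar>))
     \<le> (Re q - Re p) * (Im q - Im p)"
proof -
  define L :: "real ^ 2 \<Rightarrow> complex" where "L = (\<lambda>x. Complex (x $ 1) (x $ 2))"
  define M :: "complex \<Rightarrow> real ^ 2" where "M = (\<lambda>z. vector [Re z, Im z])"
  define J where "J = (\<lambda>z. \<bar>(norm (dz G z))\<^sup>2 - (norm (dzbar G z))\<^sup>2\<bar>)"
  define f' where "f' = (\<lambda>x h. M (dz G (L x) * L h + dzbar G (L x) * cnj (L h)))"
  \<comment> \<open>The change of variables takes place on the open box \<open>S\<close>,
    integrability comes from continuity on the closed box \<open>C\<close>, and the boundary does
    not affect the integral.\<close>
  define S where "S = box (vector [a, c]) (vector [b, d] :: real ^ 2)"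
  define C where "C = cbox (vector [a, c]) (vector [b, d] :: real ^ 2)"
  have linL: "bounded_linear L"
    unfolding L_def by (intro linear_conv_bounded_linear[THEN iffD1] linearI) (auto simp: complex_eq_iff)
  have linM: "bounded_linear M"
    unfolding M_def by (intro linear_conv_bounded_linear[THEN iffD1] linearI) (auto simp: vec_eq_iff forall_2)
  have S_C: "S \<subseteq> C" unfolding S_def C_def by (rule box_subset_cbox)
  have LC: "L x \<in> T" "G (L x) \<in> cbox p q" if "x \<in> C" for x
    using that T[of "x$1" "x$2"] img[of "x$1" "x$2"] by (auto simp: C_def mem_box_cart forall_2 L_def)
  have der: "((\<lambda>x. M (G (L x))) has_derivative f' x) (at x within S)" if "x \<in> S" for x
  proof -
    have "x \<in> C" using that S_C by auto
    have "((\<lambda>x. G (L x)) has_derivative (\<lambda>h. dz G (L x) * L h + dzbar G (L x) * cnj (L h))) (at x)"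
      by (rule has_derivative_compose[OF bounded_linear_imp_has_derivative[OF linL]
         C1_on_wirtingerD(1)[OF G LC(1)[OF \<open>x \<in> C\<close>], unfolded has_wirtinger_def]])
    from bounded_linear.has_derivative[OF linM this] show ?thesis
      unfolding f'_def by (rule has_derivative_at_withinI)
  qed
  have det: "\<bar>det (matrix (f' x))\<bar> = J (L x)" for x
  proof -
    have "L (axis 1 1) = 1" "L (axis 2 1) = \<i>"
      by (simp_all add: L_def axis_def complex_eq_iff)
    hence "det (matrix (f' x)) = (norm (dz G (L x)))\<^sup>2 - (norm (dzbar G (L x)))\<^sup>2"
      unfolding cmod_power2 by (simp add: det_2 matrix_def f'_def M_def power2_eq_square algebra_simps)
    thus ?thesis by (simp add: J_def)
  qed
  have injS: "inj_on (\<lambda>x. M (G (L x))) S"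
  proof (rule inj_onI)
    fix x y assume xy: "x \<in> S" "y \<in> S" and eq: "M (G (L x)) = M (G (L y))"
    have "G (L x) = G (L y)" using arg_cong[OF eq, of "\<lambda>v :: real ^ 2. v $ 1"] arg_cong[OF eq, of "\<lambda>v :: real ^ 2. v $ 2"]
      by (simp add: M_def complex_eq_iff)
    hence "L x = L y"
      by (rule inj_onD[OF inj]) (use xy in \<open>auto simp: S_def mem_box_cart forall_2 L_def\<close>)
    thus "x = y" by (simp add: L_def vec_eq_iff forall_2)
  qed
  have contJ: "continuous_on T J"
    unfolding J_def by (intro continuous_intros C1_on_wirtingerD[OF G])
  have "continuous_on C (\<lambda>x. J (L x))"
    by (rule continuous_on_compose2[OF contJ])
       (use LC(1) linear_continuous_on[OF linL] in auto)
  hence int: "(\<lambda>x. J (L x)) integrable_on C" unfolding C_def by (rule integrable_continuous)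
  hence intS: "(\<lambda>x. \<bar>det (matrix (f' x))\<bar>) integrable_on S"
    unfolding det S_def C_def integrable_on_open_interval .
  have "S \<in> sets lebesgue" by (simp add: S_def)
  note cv = measurable_differentiable_image_eq[OF this der injS, THEN iffD2, OF _ intS]
    measure_differentiable_image_eq[OF this der injS intS]
  have "integral C (\<lambda>x. J (L x)) = measure lebesgue ((\<lambda>x. M (G (L x))) ` S)"
    using cv(2) unfolding det S_def C_def integral_open_interval by simp
  also have "\<dots> \<le> measure lebesgue (cbox (M p) (M q))"
  proof (rule measure_mono_fmeasurable)
    show "(\<lambda>x. M (G (L x))) ` S \<subseteq> cbox (M p) (M q)"
      using LC(2) S_C by (force simp: M_def mem_box_cart forall_2 in_cbox_complex_iff)
  qed (use cv(1) in \<open>auto intro: fmeasurableD\<close>)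
  also have "\<dots> = (Re q - Re p) * (Im q - Im p)"
  proof -
    have "(vector [a, c] :: real ^ 2) \<in> C" using ab by (auto simp: C_def mem_box_cart forall_2)
    from LC(2)[OF this] have "M (G (L (vector [a, c]))) \<in> cbox (M p) (M q)"
      by (auto simp: mem_box_cart forall_2 M_def in_cbox_complex_iff)
    hence "cbox (M p) (M q) \<noteq> {}" by blast
    thus ?thesis by (simp add: content_cbox_cart UNIV_2 M_def)
  qed
  finally have bound: "integral C (\<lambda>x. J (L x)) \<le> (Re q - Re p) * (Im q - Im p)" .
  have "((\<lambda>x. J (L x)) has_integral integral C (\<lambda>x. J (L x))) C" using int by (rule integrable_integral)
  from has_integral_prod_of_real2[OF this[unfolded C_def]]
  have "((\<lambda>p. J (Complex (fst p) (snd p))) has_integral integral C (\<lambda>x. J (L x))) (cbox (a, c) (b, d))"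
    by (simp add: L_def C_def)
  hence "integral (cbox (a, c) (b, d)) (\<lambda>p. J (Complex (fst p) (snd p))) = integral C (\<lambda>x. J (L x))"
    by (rule integral_unique)
  moreover have "continuous_on (cbox (a, c) (b, d)) (\<lambda>p. J (Complex (fst p) (snd p)))"
    by (rule continuous_on_compose2[OF contJ])
       (auto intro!: continuous_intros T simp: cbox_Pair_eq)
  hence "integral (cbox (a, c) (b, d)) (\<lambda>p. J (Complex (fst p) (snd p)))
     = integral (cbox a b) (\<lambda>s. integral (cbox c d) (\<lambda>t. J (Complex (fst (s,t)) (snd (s,t)))))"
    by (rule integral_prod_continuous)
  ultimately show ?thesis using bound by (simp add: J_def)
qed

text \<open>Cauchy-Schwarz against the constant 1, from integrating the square of g - m with m the
  mean of g.\<close>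

lemma integral_square_le:
  fixes g :: "real \<Rightarrow> real"
  assumes g: "continuous_on {c..d} g" and "c < d"
  shows "(integral {c..d} g)\<^sup>2 \<le> (d - c) * integral {c..d} (\<lambda>t. (g t)\<^sup>2)"
proof -
  define I where "I = integral {c..d} g"
  define m where "m = I / (d - c)"
  have i1: "g integrable_on {c..d}" and i2: "(\<lambda>t. (g t)\<^sup>2) integrable_on {c..d}"
    by (intro integrable_continuous_real continuous_intros g)+
  have "((\<lambda>t. (g t)\<^sup>2 - 2 * m * g t + m\<^sup>2) has_integral
     integral {c..d} (\<lambda>t. (g t)\<^sup>2) - 2 * m * I + m\<^sup>2 * (d - c)) {c..d}"
    unfolding I_def
    using has_integral_const_real[of "m\<^sup>2" c d] \<open>c < d\<close>
    by (intro has_integral_add has_integral_diff has_integral_mult_right integrable_integral i1 i2) (simp add: mult.commute)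
  hence "0 \<le> integral {c..d} (\<lambda>t. (g t)\<^sup>2) - 2 * m * I + m\<^sup>2 * (d - c)"
  proof (rule has_integral_nonneg)
    fix t show "0 \<le> (g t)\<^sup>2 - 2 * m * g t + m\<^sup>2"
      using zero_le_power2[of "g t - m"] by (simp add: power2_eq_square algebra_simps)
  qed
  also have "m\<^sup>2 * (d - c) = m * I" using \<open>c < d\<close> by (simp add: m_def power2_eq_square)
  finally have "m * I \<le> integral {c..d} (\<lambda>t. (g t)\<^sup>2)" by (simp add: mult.commute)
  hence "(d - c) * (m * I) \<le> (d - c) * integral {c..d} (\<lambda>t. (g t)\<^sup>2)"
    using \<open>c < d\<close> by (intro mult_left_mono) auto
  moreover have "(d - c) * (m * I) = I\<^sup>2" using \<open>c < d\<close> by (simp add: m_def power2_eq_square)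
  ultimately show ?thesis by (simp add: I_def)
qed

text \<open>The length-area argument: some vertical segment carries at most about an average share
  of the area, on it the squared speed is at most (1 + k) / (1 - k) times the Jacobian, and
  Cauchy-Schwarz converts this into a bound on length.\<close>

lemma short_segment_in_rectangle:
  fixes G :: "complex \<Rightarrow> complex"
  assumes G: "C1_on T G" and T: "\<And>s t. s \<in> {a..b} \<Longrightarrow> t \<in> {c..d} \<Longrightarrow> Complex s t \<in> T"
    and inj: "inj_on G {z. a < Re z \<and> Re z < b \<and> c < Im z \<and> Im z < d}"
    and img: "\<And>s t. s \<in> {a..b} \<Longrightarrow> t \<in> {c..d} \<Longrightarrow> G (Complex s t) \<in> cbox p q"
    and ab: "a < b" "c < d" and k: "0 \<le> k" "k < 1"
    and qc: "\<And>z. z \<in> T \<Longrightarrow> norm (dzbar G z) \<le> k * norm (dz G z)"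
    and A: "(Re q - Re p) * (Im q - Im p) \<le> A" "A > 0"
  shows "\<exists>s\<in>{a..b}. \<forall>t\<in>{c..d}. norm (G (Complex s t) - G (Complex s c))
     \<le> sqrt ((d - c) * ((1 + k) / (1 - k)) * (2 * A / (b - a)))"
proof -
  define J where "J = (\<lambda>z. \<bar>(norm (dz G z))\<^sup>2 - (norm (dzbar G z))\<^sup>2\<bar>)"
  define K where "K = (1 + k) / (1 - k)"
  have "K \<ge> 0" using k by (simp add: K_def)
  have contJ: "continuous_on T J"
    unfolding J_def by (intro continuous_intros C1_on_wirtingerD[OF G])
  have "continuous_on (cbox (a, c) (b, d)) (\<lambda>p. J (Complex (fst p) (snd p)))"
    by (rule continuous_on_compose2[OF contJ])
       (auto intro!: continuous_intros T simp: cbox_Pair_eq)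
  from integral_integrable_2dim[OF this]
  have int: "(\<lambda>s. integral {c..d} (\<lambda>t. J (Complex s t))) integrable_on {a..b}" by simp
  \<comment> \<open>The average is at most A / (b - a); the factor 2 lets the non-strict comparison
    of integrals end in the contradiction 2 A \<le> A.\<close>
  have "\<exists>s\<in>{a..b}. integral {c..d} (\<lambda>t. J (Complex s t)) \<le> 2 * A / (b - a)"
  proof (rule ccontr)
    assume "\<not> ?thesis"
    hence le: "integral {a..b} (\<lambda>s. 2 * A / (b - a)) \<le> integral {a..b} (\<lambda>s. integral {c..d} (\<lambda>t. J (Complex s t)))"
      by (intro integral_le int) (auto simp: not_le intro: less_imp_le)
    have "2 * A = integral {a..b} (\<lambda>s. 2 * A / (b - a))" using ab by (simp add: field_simps)
    also note le
    also have "integral {a..b} (\<lambda>s. integral {c..d} (\<lambda>t. J (Complex s t))) \<le> A"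
      using integral_jacobian_le_area[OF G T inj img ab] A(1) by (simp add: J_def)
    finally show False using A(2) by simp
  qed
  then obtain s where s: "s \<in> {a..b}" "integral {c..d} (\<lambda>t. J (Complex s t)) \<le> 2 * A / (b - a)" by blast
  define g where "g = (\<lambda>t. norm (pd_y G (Complex s t)))"
  have line: "continuous_on {c..d} (\<lambda>t. h (Complex s t))" if "continuous_on T h" for h :: "complex \<Rightarrow> real"
    by (rule continuous_on_compose2[OF that]) (auto intro!: continuous_intros T s)
  have contg: "continuous_on {c..d} g"
    unfolding g_def by (rule line) (use G in \<open>auto simp: C1_on_def intro: continuous_on_norm\<close>)
  \<comment> \<open>With x = |G_z| and y = |G_zbar| the speed is at most x + y, the Jacobian is (x +
    y) (x - y), and y \<le> k x gives x + y \<le> K (x - y).\<close>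
  have sq: "(g t)\<^sup>2 \<le> K * J (Complex s t)" if "t \<in> {c..d}" for t
  proof -
    define x y where "x = norm (dz G (Complex s t))" and "y = norm (dzbar G (Complex s t))"
    have xy: "0 \<le> y" "y \<le> k * x" "0 \<le> x" using qc[OF T[OF s(1) that]] by (auto simp: x_def y_def)
    have "k * x \<le> x" using k xy by (simp add: mult_left_le_one_le)
    hence "y \<le> x" using xy by linarith
    have "g t \<le> x + y"
      using norm_triangle_ineq4[of "dz G (Complex s t)" "dzbar G (Complex s t)"]
      by (simp add: g_def pd_y_eq norm_mult x_def y_def)
    hence "(g t)\<^sup>2 \<le> (x + y) * (x + y)" unfolding power2_eq_square
      by (intro mult_mono) (auto simp: g_def x_def y_def)
    also have "\<dots> \<le> (x + y) * (K * (x - y))"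
    proof (rule mult_left_mono)
      have "(1 - k) * (x + y) \<le> (1 + k) * (x - y)" using xy k by (simp add: algebra_simps)
      thus "x + y \<le> K * (x - y)" using k by (simp add: K_def field_simps)
    qed (use xy in auto)
    also have "\<dots> = K * (x\<^sup>2 - y\<^sup>2)" by (simp add: power2_eq_square algebra_simps)
    also have "\<dots> = K * J (Complex s t)"
      using \<open>y \<le> x\<close> xy by (simp add: J_def x_def y_def power_mono)
    finally show ?thesis .
  qed
  have "(integral {c..d} g)\<^sup>2 \<le> (d - c) * integral {c..d} (\<lambda>t. (g t)\<^sup>2)"
    by (rule integral_square_le[OF contg ab(2)])
  also have "integral {c..d} (\<lambda>t. (g t)\<^sup>2) \<le> integral {c..d} (\<lambda>t. K * J (Complex s t))"
    by (intro integral_le integrable_continuous_real continuous_intros contg line contJ sq)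
  also have "\<dots> = K * integral {c..d} (\<lambda>t. J (Complex s t))" by simp
  also have "\<dots> \<le> K * (2 * A / (b - a))" by (rule mult_left_mono[OF s(2) \<open>K \<ge> 0\<close>])
  finally have "(integral {c..d} g)\<^sup>2 \<le> (d - c) * K * (2 * A / (b - a))" using ab by simp
  hence len: "integral {c..d} g \<le> sqrt ((d - c) * K * (2 * A / (b - a)))" by (rule real_le_rsqrt)
  have "norm (G (Complex s t) - G (Complex s c)) \<le> integral {c..d} g" if t: "t \<in> {c..d}" for t
  proof -
    have der: "((\<lambda>t. G (Complex s t)) has_vector_derivative pd_y G (Complex s t)) (at t within {c..t'})"
      if "t \<in> {c..t'}" "t' \<le> d" for t t'
      using pd_y_line[OF G, of "of_real s" t 0] T[OF s(1), of t] that
      by (auto simp: complex_eq_iff Complex_eq mult.commute intro: has_vector_derivative_at_within)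
    have "((\<lambda>t. pd_y G (Complex s t)) has_integral (G (Complex s t) - G (Complex s c))) {c..t}"
      by (rule fundamental_theorem_of_calculus) (use t der in auto)
    moreover have "g integrable_on {c..t}"
      by (intro integrable_continuous_real continuous_on_subset[OF contg]) (use t in auto)
    ultimately have "norm (G (Complex s t) - G (Complex s c)) \<le> integral {c..t} g"
      by (metis (no_types, lifting) g_def has_integral_iff integral_norm_bound_integral order_refl)
    also have "\<dots> \<le> integral {c..d} g"
    proof (rule integral_subset_le)
      show "g integrable_on {c..t}" "g integrable_on {c..d}"
        by (intro integrable_continuous_real continuous_on_subset[OF contg]; use t in auto)+
    qed (use t in \<open>auto simp: g_def\<close>)
    finally show ?thesis .
  qed
  with len s(1) show ?thesis unfolding K_def by (meson order_trans)
qed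

text \<open>A topological maximum principle: by invariance of domain the image of the open ball is
  open, so the distance from y cannot be largest at an interior point.\<close>

lemma inj_image_in_cball_of_sphere:
  fixes f :: "complex \<Rightarrow> complex"
  assumes f: "continuous_on S f" "inj_on f S" and S: "cball z0 s \<subseteq> S" and "s > 0"
    and sph: "f ` sphere z0 s \<subseteq> cball y L" and x: "x \<in> cball z0 s"
  shows "f x \<in> cball y L"
proof (rule ccontr)
  assume neg: "f x \<notin> cball y L"
  have "continuous_on (cball z0 s) (\<lambda>x. dist y (f x))"
    by (intro continuous_intros continuous_on_subset[OF f(1) S])
  then obtain m where m: "m \<in> cball z0 s" "\<And>x. x \<in> cball z0 s \<Longrightarrow> dist y (f x) \<le> dist y (f m)"
    using continuous_attains_sup[OF compact_cball, of z0 s] x by (metis empty_iff)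
  have big: "dist y (f m) > L" using m(2)[OF x] neg by simp
  hence "m \<in> ball z0 s" using sph m(1) by force
  have sub: "ball z0 s \<subseteq> S" using S by auto
  have "open (f ` ball z0 s)"
    by (rule invariance_of_domain[OF continuous_on_subset[OF f(1) sub] open_ball inj_on_subset[OF f(2) sub]])
  then obtain e where e: "e > 0" "ball (f m) e \<subseteq> f ` ball z0 s"
    using \<open>m \<in> ball z0 s\<close> openE by blast
  define D where "D = dist y (f m)"
  have "D > 0"
  proof -
    obtain u where "u \<in> sphere z0 s" using \<open>s > 0\<close>
      by (metis add_diff_cancel_left' dist_norm mem_sphere norm_minus_commute norm_of_real abs_of_pos)
    hence "L \<ge> 0" using sph by (metis image_subset_iff mem_cball order_trans zero_le_dist)
    thus ?thesis using big unfolding D_def by linarith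
  qed
  \<comment> \<open>The point \<open>f m\<close> moved by e / 2 straight away from y: still in the
    open image, but farther from y.\<close>
  define c where "c = f m + of_real (e / (2 * D)) * (f m - y)"
  have "dist (f m) c = e / 2"
    using \<open>D > 0\<close> e(1) by (simp add: c_def dist_norm norm_mult norm_divide D_def norm_minus_commute)
  hence "c \<in> f ` ball z0 s" using e by auto
  then obtain u where u: "u \<in> ball z0 s" "c = f u" by blast
  have "c - y = of_real (1 + e / (2 * D)) * (f m - y)" by (simp add: c_def algebra_simps)
  hence "dist y c = (1 + e / (2 * D)) * D"
    using \<open>D > 0\<close> e(1) unfolding dist_norm[of y] norm_minus_commute[of y]
    by (simp only: norm_mult norm_of_real) (simp add: D_def dist_norm norm_minus_commute[of y])
  also have "\<dots> > D" using \<open>D > 0\<close> e(1) by (simp add: distrib_right)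
  finally have "dist y (f u) > dist y (f m)" using u D_def by simp
  with m(2)[of u] u(1) show False by simp
qed

text \<open>In logarithmic polar coordinates the annulus between the radii r * exp (- m) and r is a
  rectangle of width m and height 2 pi, and the dilatation bound is unchanged since exp is
  conformal. A short vertical segment is a circle whose image stays near one of its points, and so
  does the image of the enclosed disk, which contains x. The outer factor 2 comes from the triangle
  inequality through that point.\<close>

lemma courant_lebesgue:
  fixes f :: "complex \<Rightarrow> complex"
  assumes f: "C1_on S f" "inj_on f S" and S: "open S" "cball z0 r \<subseteq> S" and "r > 0"
    and k: "0 \<le> k" "k < 1" and qc: "\<And>z. z \<in> S \<Longrightarrow> norm (dzbar f z) \<le> k * norm (dz f z)"
    and img: "f ` S \<subseteq> cbox p q" and A: "(Re q - Re p) * (Im q - Im p) \<le> A" "A > 0"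
    and "m > 0" and x: "dist z0 x \<le> r * exp (- m)"
  shows "norm (f x - f z0) \<le> 2 * sqrt (4 * pi * ((1 + k) / (1 - k)) * A / m)"
proof -
  define E where "E = (\<lambda>\<zeta>. z0 + exp \<zeta>)"
  define T where "T = E -` S"
  define G where "G = (\<lambda>\<zeta>. f (E \<zeta>))"
  define \<Lambda> where "\<Lambda> = sqrt (4 * pi * ((1 + k) / (1 - k)) * A / m)"
  have E: "E holomorphic_on A" for A unfolding E_def by (intro holomorphic_intros)
  have "open T" unfolding T_def
    by (rule open_vimage[OF S(1)]) (auto simp: E_def intro!: continuous_intros)
  have dE: "(E has_field_derivative exp \<zeta>) (at \<zeta>)" for \<zeta>
    unfolding E_def by (auto intro!: derivative_eq_intros)
  have G: "C1_on T G" unfolding G_def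
    by (rule C1_on_compose[OF C1_on_holomorphic[OF E \<open>open T\<close>] f(1)]) (auto simp: T_def)
  have W: "has_wirtinger G (dz f (E \<zeta>) * exp \<zeta>) (dzbar f (E \<zeta>) * cnj (exp \<zeta>)) \<zeta>" if "\<zeta> \<in> T" for \<zeta>
    using has_wirtinger_compose[OF has_wirtinger_field_derivative[OF dE] C1_on_wirtingerD(1)[OF f(1)]] that
    by (auto simp: T_def G_def)
  have qcG: "norm (dzbar G \<zeta>) \<le> k * norm (dz G \<zeta>)" if "\<zeta> \<in> T" for \<zeta>
  proof -
    have "norm (dzbar f (E \<zeta>)) * exp (Re \<zeta>) \<le> k * norm (dz f (E \<zeta>)) * exp (Re \<zeta>)"
      using qc[of "E \<zeta>"] that by (intro mult_right_mono) (auto simp: T_def)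
    thus ?thesis unfolding has_wirtinger_unique[OF W[OF that]] by (simp add: norm_mult mult.assoc)
  qed
  have E_sphere: "E (Complex s t) \<in> sphere z0 (exp s)" for s t
    by (simp add: E_def dist_norm)
  have exp_le: "exp s \<le> r" if "s \<le> ln r" for s using that \<open>r > 0\<close> by (metis exp_le_cancel_iff exp_ln)
  have T: "Complex s t \<in> T" if "s \<in> {ln r - m..ln r}" for s t
    using E_sphere[of s t] exp_le[of s] that S(2) by (auto simp: T_def subset_iff)
  have "\<exists>s\<in>{ln r - m..ln r}. \<forall>t\<in>{0..2*pi}. norm (G (Complex s t) - G (Complex s 0))
      \<le> sqrt ((2*pi - 0) * ((1 + k) / (1 - k)) * (2 * A / (ln r - (ln r - m))))"
  proof (rule short_segment_in_rectangle[OF G T _ _ _ _ k qcG A])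
    show "inj_on G {z. ln r - m < Re z \<and> Re z < ln r \<and> 0 < Im z \<and> Im z < 2 * pi}"
    proof (rule inj_onI)
      fix u v assume u: "u \<in> {z. ln r - m < Re z \<and> Re z < ln r \<and> 0 < Im z \<and> Im z < 2 * pi}"
        and v: "v \<in> {z. ln r - m < Re z \<and> Re z < ln r \<and> 0 < Im z \<and> Im z < 2 * pi}" and eq: "G u = G v"
      have "u \<in> T" "v \<in> T" using T[of "Re u" "Im u"] T[of "Re v" "Im v"] u v by auto
      hence "E u = E v" using inj_onD[OF f(2) eq[unfolded G_def]] by (auto simp: T_def)
      hence "exp u = exp v" by (simp add: E_def)
      thus "u = v" by (rule exp_complex_eqI[rotated]) (use u v in auto)
    qed
  qed (use \<open>m > 0\<close> img T in \<open>auto simp: G_def T_def\<close>)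
  then obtain s where s: "s \<in> {ln r - m..ln r}" "\<And>t. t \<in> {0..2*pi} \<Longrightarrow> norm (G (Complex s t) - G (Complex s 0)) \<le> \<Lambda>"
    by (auto simp: \<Lambda>_def mult_ac)
  have sph: "f ` sphere z0 (exp s) \<subseteq> cball (G (Complex s 0)) \<Lambda>"
  proof (rule image_subsetI)
    fix y assume y: "y \<in> sphere z0 (exp s)"
    define t where "t = Arg2pi (y - z0)"
    have "y = E (Complex s t)"
    proof -
      have "norm (y - z0) = exp s" using y by (simp add: dist_norm norm_minus_commute)
      hence "y - z0 = of_real (exp s) * exp (\<i> * of_real t)" using Arg2pi_eq[of "y - z0"] by (simp add: t_def)
      also have "\<dots> = exp (Complex s t)" by (simp add: exp_of_real[symmetric] exp_add[symmetric] Complex_eq)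
      finally show ?thesis by (simp add: E_def algebra_simps)
    qed
    moreover have "t \<in> {0..2*pi}" using Arg2pi_ge_0 Arg2pi_lt_2pi by (auto simp: t_def less_imp_le)
    ultimately show "f y \<in> cball (G (Complex s 0)) \<Lambda>"
      using s(2)[of t] by (simp add: G_def dist_norm norm_minus_commute)
  qed
  have es: "r * exp (- m) \<le> exp s"
  proof -
    have "r * exp (- m) = exp (ln r - m)" using \<open>r > 0\<close> by (simp add: exp_diff exp_minus field_simps)
    thus ?thesis using s(1) by simp
  qed
  have sub: "cball z0 (exp s) \<subseteq> S" using exp_le[of s] s(1) S(2) by (force simp: subset_iff)
  note in_cball = inj_image_in_cball_of_sphere[OF C1_on_imp_continuous_on[OF f(1)] f(2) sub _ sph]
  have "f x \<in> cball (G (Complex s 0)) \<Lambda>" using x es by (intro in_cball) auto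
  moreover have "f z0 \<in> cball (G (Complex s 0)) \<Lambda>" by (intro in_cball) auto
  ultimately have "dist (f x) (f z0) \<le> \<Lambda> + \<Lambda>"
    using dist_triangle_le[of "f x" "G (Complex s 0)" "f z0"] by (simp add: dist_commute)
  thus ?thesis by (simp add: \<Lambda>_def dist_norm)
qed

section \<open>Normal families of quasiconformal self-maps\<close>

text \<open>Collects what the length-area estimates use and what composition with disk automorphisms
  preserves with the same k, so that one k serves all normalized maps.\<close>

definition qc_selfmap :: "real \<Rightarrow> (complex \<Rightarrow> complex) \<Rightarrow> bool"
  where "qc_selfmap k f \<longleftrightarrow> C1_on \<bbbU> f \<and> inj_on f \<bbbU> \<and> f ` \<bbbU> \<subseteq> \<bbbU> \<and>
    (\<forall>z\<in>\<bbbU>. cmod (dzbar f z) \<le> k * cmod (dz f z))"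

text \<open>The estimate of \<open>courant_lebesgue\<close> sees f only through k and the area of a
  box around its image. For self-maps a box of area 4 will do, so one \<delta> serves the whole
  family.\<close>

lemma qc_selfmap_equicontinuous:
  assumes k: "0 \<le> k" "k < 1" and x: "x \<in> \<bbbU>" and "e > 0"
  shows "\<exists>\<delta>>0. \<forall>f y. qc_selfmap k f \<longrightarrow> dist x y < \<delta> \<longrightarrow> norm (f y - f x) < e"
proof -
  define r where "r = (1 - norm x) / 2"
  have r: "r > 0" "cball x r \<subseteq> \<bbbU>"
  proof -
    show "r > 0" using x by (simp add: r_def)
    show "cball x r \<subseteq> \<bbbU>"
    proof
      fix y assume "y \<in> cball x r"
      hence "norm (y - x) \<le> r" by (simp add: dist_norm norm_minus_commute)
      thus "y \<in> \<bbbU>" using norm_triangle_sub[of y x] \<open>r > 0\<close> unfolding r_def by simp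
    qed
  qed
  define K where "K = (1 + k) / (1 - k)"
  have "K \<ge> 0" using k by (simp add: K_def)
  \<comment> \<open>Chosen to make the bound for area 4 at most 2 * (e / 4).\<close>
  define m where "m = 4 * pi * K * 4 / (e / 4)\<^sup>2 + 1"
  have m: "m > 0" using \<open>K \<ge> 0\<close> \<open>e > 0\<close> by (simp add: m_def add_nonneg_pos)
  have small: "2 * sqrt (4 * pi * K * 4 / m) < e"
  proof -
    have "4 * pi * K * 4 \<le> m * (e / 4)\<^sup>2" using \<open>e > 0\<close> by (simp add: m_def distrib_right)
    hence "4 * pi * K * 4 / m \<le> (e / 4)\<^sup>2" using m by (simp add: divide_le_eq mult.commute)
    hence "sqrt (4 * pi * K * 4 / m) \<le> e / 4" using \<open>e > 0\<close> by (intro real_le_lsqrt) auto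
    thus ?thesis using \<open>e > 0\<close> by simp
  qed
  have "norm (f y - f x) < e" if f: "qc_selfmap k f" and y: "dist x y < r * exp (- m)" for f y
  proof -
    have img: "f ` \<bbbU> \<subseteq> cbox (Complex (-1) (-1)) (Complex 1 1)"
    proof
      fix w assume "w \<in> f ` \<bbbU>"
      hence "norm w < 1" using f by (auto simp: qc_selfmap_def)
      hence "\<bar>Re w\<bar> \<le> 1" "\<bar>Im w\<bar> \<le> 1" using abs_Re_le_cmod[of w] abs_Im_le_cmod[of w] by linarith+
      thus "w \<in> cbox (Complex (-1) (-1)) (Complex 1 1)" by (auto simp: in_cbox_complex_iff)
    qed
    have "norm (f y - f x) \<le> 2 * sqrt (4 * pi * ((1 + k) / (1 - k)) * 4 / m)"
      by (rule courant_lebesgue[OF _ _ open_ball r(2,1) k _ img _ _ m])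
         (use f y in \<open>auto simp: qc_selfmap_def\<close>)
    thus ?thesis using small by (simp add: K_def)
  qed
  moreover have "r * exp (- m) > 0" using r by simp
  ultimately show ?thesis by blast
qed

text \<open>Post-composing with a logarithm whose singularity lies just outside the disk near
  \<^term>\<open>f z\<close> gives an image of area comparable to \<^term>\<open>ln (1 / (1 - cmod (f z)))\<close>, hence an
  oscillation of the order of its square root; but the logarithm itself is of that size at
  \<^term>\<open>f z\<close>.\<close>

lemma qc_selfmap_bounded_away:
  assumes k: "0 \<le> k" "k < 1" and R: "0 < R" "R < 1"
  shows "\<exists>\<eta>>0. \<forall>f. qc_selfmap k f \<and> f 0 = 0 \<longrightarrow> (\<forall>z\<in>cball 0 R. norm (f z) \<le> 1 - \<eta>)"
proof -
  define K where "K = (1 + k) / (1 - k)"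
  have "K \<ge> 0" using k by (simp add: K_def)
  define r where "r = (1 - R) / 2"
  have r: "r > 0" using R by (simp add: r_def)
  define C where "C = 2 * sqrt (4 * pi * K * (2 * pi))"
  have "C \<ge> 0" using \<open>K \<ge> 0\<close> by (simp add: C_def)
  \<comment> \<open>The segment from 0 to z is divided into N steps of length at most r * exp (- 1),
    the reach of \<open>courant_lebesgue\<close> with m = 1.\<close>
  obtain N :: nat where N: "real N > R / (r * exp (- 1))" using reals_Archimedean2 by blast
  have "N > 0" using N R r by (intro gr0I) (auto simp: field_simps)
  \<comment> \<open>For d = 1 - |f z| and l = ln (4 / d) the estimates below give l \<le> N * C *
    sqrt l + ln 8, which forces sqrt l \<le> B and so d \<ge> 4 * exp (- B^2). The minimum with 1
    covers f z = 0.\<close>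
  define B where "B = 1 + N * C + ln 8"
  define \<eta> where "\<eta> = min 1 (4 * exp (- B\<^sup>2))"
  have "norm (f z) \<le> 1 - \<eta>" if f: "qc_selfmap k f" "f 0 = 0" and z: "z \<in> cball 0 R" for f z
  proof (cases "f z = 0")
    case True
    thus ?thesis by (simp add: \<eta>_def)
  next
    case False
    have fU: "norm (f x) < 1" if "x \<in> \<bbbU>" for x
    proof -
      have "f x \<in> \<bbbU>" using f(1) that unfolding qc_selfmap_def by blast
      thus ?thesis by simp
    qed
    have zU: "z \<in> \<bbbU>" using z R by simp
    define d where "d = 1 - norm (f z)"
    have d: "0 < d" "d < 1" using fU[OF zU] False by (auto simp: d_def)
    define l where "l = ln (4 / d)"
    have "l > 0" using d by (simp add: l_def)
    \<comment> \<open>The singularity of the logarithm: on the ray through f z, at distance d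
      outside the unit circle. This makes Re (1 - w / e) at least d / 2 on the closed disk, away
      from the branch cut.\<close>
    define e where "e = of_real (1 + d) * (f z / of_real (norm (f z)))"
    have norm_e: "norm e = 1 + d" using False d by (simp add: e_def norm_mult norm_divide del: of_real_add)
    have "e \<noteq> 0" using norm_e d by auto
    define h where "h = (\<lambda>w. Ln (1 - w / e))"
    have small: "norm (w / e) \<le> 1 / (1 + d)" if "norm w \<le> 1" for w
      using that d norm_e by (simp add: norm_divide divide_right_mono)
    have Re_pos: "Re (1 - w / e) \<ge> d / 2" if "norm w \<le> 1" for w
    proof -
      have "Re (w / e) \<le> 1 / (1 + d)" using complex_Re_le_cmod[of "w/e"] small[OF that] by linarith
      moreover have "1 / (1 + d) \<le> 1 - d / 2"
      proof -
        have "1 \<le> (1 - d / 2) * (1 + d)" using d mult_left_mono[of d 1 d] by (simp add: algebra_simps)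
        thus ?thesis using d by (simp add: divide_le_eq)
      qed
      ultimately show ?thesis by simp
    qed
    have dh: "(h has_field_derivative (inverse (1 - w / e) * (- (1 / e)))) (at w)" if "norm w \<le> 1" for w
    proof -
      have "1 - w / e \<notin> \<real>\<^sub>\<le>\<^sub>0" using Re_pos[OF that] d by (auto simp: complex_nonpos_Reals_iff)
      moreover have "((\<lambda>w. 1 - w / e) has_field_derivative (- (1 / e))) (at w)"
        using \<open>e \<noteq> 0\<close> by (auto intro!: derivative_eq_intros)
      ultimately show ?thesis unfolding h_def by (rule has_field_derivative_Ln[THEN DERIV_chain2])
    qed
    have h: "h holomorphic_on \<bbbU>"
      unfolding holomorphic_on_open[OF open_ball] by (intro ballI exI) (rule dh, simp)
    define g where "g = (\<lambda>x. h (f x))"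
    have f1: "C1_on \<bbbU> f" "inj_on f \<bbbU>" "f ` \<bbbU> \<subseteq> \<bbbU>" using f by (auto simp: qc_selfmap_def)
    have g1: "C1_on \<bbbU> g" unfolding g_def
      by (rule C1_on_compose[OF f1(1) C1_on_holomorphic[OF h open_ball] f1(3)])
    have inj: "inj_on g \<bbbU>"
    proof (rule inj_onI)
      fix x y assume xy: "x \<in> \<bbbU>" "y \<in> \<bbbU>" and eq: "g x = g y"
      have "1 - f x / e \<noteq> 0" "1 - f y / e \<noteq> 0"
        using Re_pos[of "f x"] Re_pos[of "f y"] fU[OF xy(1)] fU[OF xy(2)] d by force+
      hence "1 - f x / e = 1 - f y / e" using eq by (metis g_def h_def exp_Ln)
      hence "f x = f y" using \<open>e \<noteq> 0\<close> by simp
      thus "x = y" using inj_onD[OF f1(2)] xy by blast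
    qed
    have qc: "norm (dzbar g x) \<le> k * norm (dz g x)" if x: "x \<in> \<bbbU>" for x
    proof -
      define D where "D = deriv h (f x)"
      have "f x \<in> \<bbbU>" using fU[OF x] by simp
      have W: "has_wirtinger g (D * dz f x) (D * dzbar f x) x"
        using has_wirtinger_compose[OF C1_on_wirtingerD(1)[OF f1(1) x]
           has_wirtinger_field_derivative[OF holomorphic_derivI[OF h open_ball \<open>f x \<in> \<bbbU>\<close>]]]
        by (simp add: g_def D_def)
      have "norm D * norm (dzbar f x) \<le> norm D * (k * norm (dz f x))"
        using f(1) x by (intro mult_left_mono) (auto simp: qc_selfmap_def)
      thus ?thesis unfolding has_wirtinger_unique[OF W] by (simp add: norm_mult mult_ac)
    qed
    \<comment> \<open>The modulus of 1 - w / e lies between d / 2 and 2, so the box has width l and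
      height 2 pi.\<close>
    have img: "g ` \<bbbU> \<subseteq> cbox (Complex (ln (d/2)) (-pi)) (Complex (ln 2) pi)"
    proof (rule image_subsetI)
      fix x assume x: "x \<in> \<bbbU>"
      define w where "w = 1 - f x / e"
      have w: "Re w \<ge> d / 2" using Re_pos[of "f x"] fU[OF x] by (simp add: w_def)
      hence "w \<noteq> 0" "norm w \<ge> d / 2" using d complex_Re_le_cmod[of w] by (auto intro: order_trans)
      moreover have "norm w \<le> 1 + norm (f x / e)" unfolding w_def using norm_triangle_ineq4[of 1 "f x / e"] by simp
      hence "norm w \<le> 2" using small[of "f x"] fU[OF x] d by (smt (verit) divide_le_eq_1)
      ultimately have "ln (d / 2) \<le> Re (Ln w)" "Re (Ln w) \<le> ln 2" "- pi \<le> Im (Ln w)" "Im (Ln w) \<le> pi"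
        using d Im_Ln_le_pi mpi_less_Im_Ln[of w] by (auto simp: less_imp_le)
      thus "g x \<in> cbox (Complex (ln (d/2)) (-pi)) (Complex (ln 2) pi)"
        by (auto simp: g_def h_def w_def in_cbox_complex_iff)
    qed
    have area: "(Re (Complex (ln 2) pi) - Re (Complex (ln (d/2)) (-pi))) *
       (Im (Complex (ln 2) pi) - Im (Complex (ln (d/2)) (-pi))) \<le> 2 * pi * l"
    proof -
      have "ln (2::real) - ln (d / 2) = l" using d by (simp add: l_def ln_div[symmetric] ln_divide_pos[symmetric])
      thus ?thesis by simp
    qed
    have area_pos: "2 * pi * l > 0" using \<open>l > 0\<close> by simp
    have step: "norm (g y - g x) \<le> C * sqrt l" if x: "x \<in> cball 0 R" and xy: "dist x y \<le> r * exp (- 1)" for x y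
    proof -
      have sub: "cball x r \<subseteq> \<bbbU>"
      proof
        fix y assume "y \<in> cball x r"
        hence "norm (y - x) \<le> r" by (simp add: dist_norm norm_minus_commute)
        thus "y \<in> \<bbbU>" using x norm_triangle_sub[of y x] R unfolding r_def by simp
      qed
      have "norm (g y - g x) \<le> 2 * sqrt (4 * pi * ((1 + k) / (1 - k)) * (2 * pi * l) / 1)"
        by (rule courant_lebesgue[OF g1 inj open_ball sub r k qc img area area_pos _ xy]) simp_all
      also have "4 * pi * ((1 + k) / (1 - k)) * (2 * pi * l) / 1 = 4 * pi * K * (2 * pi) * l"
        by (simp add: K_def)
      also have "2 * sqrt \<dots> = C * sqrt l"
        unfolding C_def real_sqrt_mult[of "4 * pi * K * (2 * pi)" l] by (simp only: mult.assoc)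
      finally show ?thesis .
    qed
    \<comment> \<open>Equally spaced points from 0 to z; the chain starts at g 0 = Ln 1 = 0 because
      f fixes the origin.\<close>
    define P where "P = (\<lambda>j::nat. of_real (j / N) * z)"
    have P: "norm (g (P j)) \<le> j * (C * sqrt l)" if "j \<le> N" for j
      using that
    proof (induction j)
      case 0
      thus ?case by (simp add: P_def g_def h_def f(2))
    next
      case (Suc j)
      have "\<bar>real j / real N\<bar> \<le> 1" using Suc.prems \<open>N > 0\<close> by simp
      hence "norm (P j) \<le> 1 * R" unfolding P_def norm_mult norm_of_real
        by (rule mult_mono) (use z in auto)
      hence "P j \<in> cball 0 R" by simp
      moreover have "dist (P j) (P (Suc j)) \<le> r * exp (- 1)"
      proof -
        have "P j - P (Suc j) = - (of_real (1 / N) * z)"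
          by (simp add: P_def add_divide_distrib algebra_simps)
        hence "dist (P j) (P (Suc j)) = norm z / N" by (simp add: dist_norm norm_mult norm_divide)
        also have "\<dots> \<le> R / N" using z by (simp add: divide_right_mono)
        also have "\<dots> \<le> r * exp (- 1)" using N \<open>N > 0\<close> r by (simp add: field_simps)
        finally show ?thesis .
      qed
      ultimately have "norm (g (P (Suc j)) - g (P j)) \<le> C * sqrt l" by (rule step)
      thus ?case using Suc norm_triangle_sub[of "g (P (Suc j))" "g (P j)"] by (simp add: algebra_simps)
    qed
    have "P N = z" using \<open>N > 0\<close> by (simp add: P_def)
    with P[of N] have up: "norm (g z) \<le> N * C * sqrt l" by simp
    have fe: "f z / e = of_real ((1 - d) / (1 + d))"
    proof -
      have "norm (f z) = 1 - d" by (simp add: d_def)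
      thus ?thesis using False d unfolding e_def
        by (simp add: divide_simps del: of_real_add of_real_diff)
    qed
    have "1 - (1 - d) / (1 + d) = 2 * d / (1 + d)" using d by (simp add: field_simps)
    hence "1 - f z / e = of_real (2 * d / (1 + d))"
      unfolding fe by (metis of_real_1 of_real_diff)
    hence gz: "g z = of_real (ln (2 * d / (1 + d)))" using d by (simp add: g_def h_def Ln_of_real del: of_real_divide of_real_mult)
    \<comment> \<open>The competing lower bound for |g z|: the number 1 / (2 d) is an eighth of 4 /
      d and lies below (1 + d) / (2 d).\<close>
    have "l - ln 8 = ln (1 / (2 * d))" using d by (simp add: l_def ln_div[symmetric] ln_divide_pos[symmetric])
    also have "\<dots> \<le> ln ((1 + d) / (2 * d))" using d by (simp add: divide_right_mono)
    also have "\<dots> = - ln (2 * d / (1 + d))" using d by (simp add: ln_div)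
    also have "\<dots> \<le> norm (g z)" unfolding gz norm_of_real by linarith
    finally have "l - ln 8 \<le> N * C * sqrt l" using up by linarith
    hence q: "sqrt l * sqrt l \<le> N * C * sqrt l + ln 8" using \<open>l > 0\<close> by simp
    have "sqrt l \<le> B"
    proof (cases "sqrt l \<le> 1")
      case True
      thus ?thesis using \<open>C \<ge> 0\<close> by (simp add: B_def add_increasing2)
    next
      case False
      have "ln 8 * 1 \<le> ln 8 * sqrt l" using False by (intro mult_left_mono) auto
      hence "sqrt l * sqrt l \<le> (N * C + ln 8) * sqrt l"
        using q distrib_right[of "N * C" "ln 8" "sqrt l"] by linarith
      moreover have "sqrt l > 0" using False by linarith
      ultimately have "sqrt l \<le> N * C + ln 8" by (rule mult_right_le_imp_le)
      thus ?thesis by (simp add: B_def)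
    qed
    hence "l \<le> B\<^sup>2" by (rule sqrt_le_D)
    moreover have "4 / d = exp l" using d by (simp add: l_def)
    ultimately have "4 / d \<le> exp (B\<^sup>2)" by simp
    hence "4 * exp (- B\<^sup>2) \<le> d" using d by (simp add: exp_minus field_simps)
    thus ?thesis by (simp add: \<eta>_def d_def)
  qed
  moreover have "\<eta> > 0" by (simp add: \<eta>_def)
  ultimately show ?thesis by blast
qed

text \<open>Multiplying by \<^term>\<open>1 - norm z\<close> makes the family equicontinuous up to the boundary, so that
  a single application of Arzela-Ascoli on the closed disk suffices.\<close>

lemma qc_selfmap_normal_family:
  fixes f :: "nat \<Rightarrow> complex \<Rightarrow> complex"
  assumes k: "0 \<le> k" "k < 1" and f: "\<And>n. qc_selfmap k (f n)" "\<And>n. f n 0 = 0"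
  obtains s f0 where "strict_mono (s :: nat \<Rightarrow> nat)" "f0 ` \<bbbU> \<subseteq> \<bbbU>"
    "\<And>K. compact K \<Longrightarrow> K \<subseteq> \<bbbU> \<Longrightarrow> uniform_limit K (\<lambda>n. f (s n)) f0 sequentially"
proof -
  define F where "F = (\<lambda>n z. if z \<in> \<bbbU> then of_real (1 - norm z) * f n z else 0)"
  have fU: "norm (f n z) < 1" if "z \<in> \<bbbU>" for n z
  proof -
    have "f n z \<in> \<bbbU>" using f(1)[of n] that unfolding qc_selfmap_def by blast
    thus ?thesis by simp
  qed
  have F_bd: "norm (F n z) \<le> 1 - norm z" if "z \<in> cball 0 1" for n z
  proof (cases "z \<in> \<bbbU>")
    case True
    have "norm (F n z) = (1 - norm z) * norm (f n z)"
      using True by (simp add: F_def norm_mult del: of_real_diff)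
    also have "\<dots> \<le> (1 - norm z) * 1" using True fU[OF True, of n] by (intro mult_left_mono) auto
    finally show ?thesis by simp
  qed (use that in \<open>simp add: F_def\<close>)
  have equi: "\<exists>d. 0 < d \<and> (\<forall>n y. y \<in> cball 0 1 \<and> norm (x - y) < d \<longrightarrow> norm (F n x - F n y) < e)"
    if x: "x \<in> cball 0 1" and "0 < e" for x e
  proof (cases "x \<in> \<bbbU>")
    case False
    hence x1: "norm x = 1" using x by simp
    show ?thesis
    proof (intro exI[of _ e] conjI allI impI \<open>0 < e\<close>)
      fix n y assume y: "y \<in> cball 0 1 \<and> norm (x - y) < e"
      have "norm (F n x - F n y) = norm (F n y)" using False by (simp add: F_def)
      also have "\<dots> \<le> norm x - norm y" using F_bd[of y n] y x1 by simp
      also have "\<dots> \<le> norm (x - y)" by (rule norm_triangle_ineq2)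
      finally show "norm (F n x - F n y) < e" using y by linarith
    qed
  next
    case True
    obtain \<delta> where \<delta>: "\<delta> > 0" "\<And>f y. qc_selfmap k f \<Longrightarrow> dist x y < \<delta> \<Longrightarrow> norm (f y - f x) < e / 2"
      using qc_selfmap_equicontinuous[OF k True, of "e/2"] \<open>0 < e\<close> by auto
    define d where "d = min (1 - norm x) (min \<delta> (e / 2))"
    have "d > 0" using \<delta>(1) \<open>0 < e\<close> True by (simp add: d_def)
    moreover have "norm (F n x - F n y) < e" if y: "norm (x - y) < d" for n y
    proof -
      have "norm (x - y) < 1 - norm x" using y by (simp add: d_def)
      hence yU: "y \<in> \<bbbU>" using norm_triangle_sub[of y x] by (simp add: norm_minus_commute)
      \<comment> \<open>The first term is small because the weight 1 - |z| is Lipschitz and f is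
        bounded, the second by equicontinuity at the fixed point x.\<close>
      have "F n x - F n y = of_real (norm y - norm x) * f n y - of_real (1 - norm x) * (f n y - f n x)"
        using True yU by (simp add: F_def algebra_simps)
      hence "norm (F n x - F n y) \<le> \<bar>norm y - norm x\<bar> * norm (f n y) + \<bar>1 - norm x\<bar> * norm (f n y - f n x)"
        by (metis norm_mult norm_of_real norm_triangle_ineq4)
      also have "\<bar>norm y - norm x\<bar> * norm (f n y) \<le> norm (x - y) * 1"
        using fU[OF yU, of n] norm_triangle_ineq3[of y x] by (intro mult_mono) (auto simp: norm_minus_commute)
      also have "\<bar>1 - norm x\<bar> * norm (f n y - f n x) \<le> 1 * (e / 2)"
        using \<delta>(2)[OF f(1)[of n], of y] y True by (intro mult_mono) (auto simp: d_def dist_norm)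
      finally show ?thesis using y by (simp add: d_def)
    qed
    ultimately show ?thesis by blast
  qed
  obtain g s where g: "strict_mono (s :: nat \<Rightarrow> nat)"
      "\<And>e. 0 < e \<Longrightarrow> \<exists>N. \<forall>n x. n \<ge> N \<and> x \<in> cball 0 1 \<longrightarrow> norm (F (s n) x - g x) < e"
  proof (rule Arzela_Ascoli[of "cball 0 1" F 1])
    show "norm (F n x) \<le> 1" if "x \<in> cball 0 1" for n x using F_bd[OF that, of n] norm_ge_zero[of x] by linarith
  qed (use equi in auto)
  define f0 where "f0 = (\<lambda>z. g z / of_real (1 - norm z))"
  have lim: "uniform_limit (cball 0 R) (\<lambda>n. f (s n)) f0 sequentially" if R: "0 < R" "R < 1" for R
  proof (rule uniform_limitI)
    fix e :: real assume "e > 0"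
    obtain N where N: "\<And>n x. n \<ge> N \<Longrightarrow> x \<in> cball 0 1 \<Longrightarrow> norm (F (s n) x - g x) < e * (1 - R)"
      using g(2)[of "e * (1 - R)"] \<open>e > 0\<close> R by auto
    have "dist (f (s n) x) (f0 x) < e" if n: "n \<ge> N" and x: "x \<in> cball 0 R" for n x
    proof -
      have x1: "1 - norm x \<ge> 1 - R" "1 - norm x > 0" using x R by auto
      have "f (s n) x - f0 x = (F (s n) x - g x) / of_real (1 - norm x)"
        using x1 by (simp add: F_def f0_def field_simps)
      hence "dist (f (s n) x) (f0 x) = norm (F (s n) x - g x) / (1 - norm x)"
        using x1 by (simp add: dist_norm norm_divide del: of_real_diff)
      also have "\<dots> < e * (1 - R) / (1 - norm x)"
        using N[OF n, of x] x1 by (intro divide_strict_right_mono) auto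
      also have "\<dots> \<le> e * (1 - norm x) / (1 - norm x)"
        using x1 \<open>e > 0\<close> by (intro divide_right_mono mult_left_mono) auto
      finally show ?thesis using x1 by simp
    qed
    thus "\<forall>\<^sub>F n in sequentially. \<forall>x\<in>cball 0 R. dist (f (s n) x) (f0 x) < e"
      by (intro eventually_sequentiallyI[of N] ballI)
  qed
  have sub: "\<exists>R. 0 < R \<and> R < 1 \<and> K \<subseteq> cball 0 R" if K: "compact K" "K \<subseteq> \<bbbU>" for K :: "complex set"
  proof (cases "K = {}")
    case True
    thus ?thesis by (intro exI[of _ "1/2"]) auto
  next
    case False
    obtain m where "m \<in> K" "\<And>x. x \<in> K \<Longrightarrow> norm x \<le> norm m"
      using continuous_attains_sup[OF K(1) False, of norm] continuous_on_norm_id by blast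
    moreover have "norm m < 1" using \<open>m \<in> K\<close> K(2) by auto
    ultimately show ?thesis
      by (intro exI[of _ "(norm m + 1) / 2"]) (force simp: add_nonneg_pos)
  qed
  have "f0 z \<in> \<bbbU>" if z: "z \<in> \<bbbU>" for z
  proof -
    define R where "R = (norm z + 1) / 2"
    have R: "0 < R" "R < 1" "z \<in> cball 0 R" using z by (auto simp: R_def add_nonneg_pos)
    \<comment> \<open>Pointwise convergence alone would only place the limit in the closed disk; the
      uniform gap \<eta> keeps it off the circle.\<close>
    obtain \<eta> where \<eta>: "\<eta> > 0" "\<And>n. norm (f (s n) z) \<le> 1 - \<eta>"
      using qc_selfmap_bounded_away[OF k R(1,2)] f R(3) by blast
    have "(\<lambda>n. f (s n) z) \<longlonglongrightarrow> f0 z" by (rule tendsto_uniform_limitI[OF lim[OF R(1,2)] R(3)])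
    hence "norm (f0 z) \<le> 1 - \<eta>" by (rule Lim_norm_ubound[rotated]) (simp_all add: \<eta>)
    thus ?thesis using \<eta>(1) by simp
  qed
  hence "f0 ` \<bbbU> \<subseteq> \<bbbU>" by blast
  moreover have "uniform_limit K (\<lambda>n. f (s n)) f0 sequentially" if "compact K" "K \<subseteq> \<bbbU>" for K
    using sub[OF that] lim uniform_limit_on_subset by blast
  ultimately show ?thesis using g(1) that by blast
qed

section \<open>Pull-back of metrics and Moebius transformations\<close>

text \<open>Densities are real-valued while the rules above concern complex-valued functions; this
  moves regularity between the two.\<close>

lemma C1_on_of_real_iff: "C1_on S (\<lambda>x. complex_of_real (\<rho> x)) \<longleftrightarrow> C1_on S \<rho>"
proof
  assume \<rho>: "C1_on S \<rho>"
  have "(\<rho> has_derivative frechet_derivative \<rho> (at z)) (at z)" if "z \<in> S" for z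
    using \<rho> that by (auto simp: C1_on_def frechet_derivative_works)
  thus "C1_on S (\<lambda>x. complex_of_real (\<rho> x))"
    by (intro C1_onI[of _ _ "\<lambda>z h. of_real (frechet_derivative \<rho> (at z) h)"] has_derivative_of_real)
       (use \<rho> in \<open>auto simp: C1_on_def pd_x_def[abs_def] pd_y_def[abs_def] intro: continuous_intros\<close>)
next
  assume \<rho>: "C1_on S (\<lambda>x. complex_of_real (\<rho> x))"
  let ?f = "\<lambda>x. complex_of_real (\<rho> x)"
  have "(?f has_derivative frechet_derivative ?f (at z)) (at z)" if "z \<in> S" for z
    using \<rho> that by (auto simp: C1_on_def frechet_derivative_works)
  from bounded_linear.has_derivative[OF bounded_linear_Re this]
  have "(\<rho> has_derivative (\<lambda>h. Re (frechet_derivative ?f (at z) h))) (at z)" if "z \<in> S" for z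
    using that by simp
  thus "C1_on S \<rho>"
    by (rule C1_onI)
       (use \<rho> in \<open>auto simp: C1_on_def pd_x_def[abs_def] pd_y_def[abs_def] intro!: continuous_on_Re\<close>)
qed

text \<open>Dividing by a keeps the argument of the logarithm near 1 when w is near a, hence off the
  branch cut. The identity itself is global, as only the real part of the logarithm enters.\<close>

lemma of_real_ln_norm_square_eq:
  assumes "a \<noteq> 0" "w \<noteq> 0"
  shows "complex_of_real (ln ((norm w)\<^sup>2)) = Ln (w / a) + cnj (Ln (w / a)) + of_real (ln ((norm a)\<^sup>2))"
proof -
  have "Re (Ln (w / a)) = ln (norm w) - ln (norm a)"
    using assms by (simp add: norm_divide ln_div)
  thus ?thesis using assms by (intro complex_eqI) (simp_all add: ln_realpow)
qed

lemma has_wirtinger_ln_norm_square: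
  assumes g: "g holomorphic_on S" and S: "open S" and z: "z \<in> S" and nz: "\<And>x. x \<in> S \<Longrightarrow> g x \<noteq> 0"
  shows "has_wirtinger (\<lambda>x. of_real (ln ((norm (g x))\<^sup>2))) (deriv g z / g z) (cnj (deriv g z / g z)) z"
proof -
  have "((\<lambda>x. g x / g z) has_field_derivative deriv g z / g z) (at z)"
    by (rule DERIV_cdivide[OF holomorphic_derivI[OF g S z]])
  moreover have "g z / g z = 1" using nz[OF z] by simp
  hence "(Ln has_field_derivative inverse (g z / g z)) (at (g z / g z))"
    by (intro has_field_derivative_Ln) simp
  ultimately have D: "((\<lambda>x. Ln (g x / g z)) has_field_derivative inverse (g z / g z) * (deriv g z / g z)) (at z)"
    by (rule DERIV_chain2[rotated])
  have "((\<lambda>x. Ln (g x / g z)) has_field_derivative deriv g z / g z) (at z)"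
    using D nz[OF z] by simp
  note W = has_wirtinger_field_derivative[OF this]
  have "has_wirtinger (\<lambda>x. of_real (ln ((norm (g z))\<^sup>2))) 0 0 z"
    by (simp add: has_wirtinger_def)
  from has_wirtinger_add[OF has_wirtinger_add[OF W has_wirtinger_cnj[OF W]] this]
  have "has_wirtinger (\<lambda>x. Ln (g x / g z) + cnj (Ln (g x / g z)) + of_real (ln ((norm (g z))\<^sup>2)))
     (deriv g z / g z) (cnj (deriv g z / g z)) z" by simp
  thus ?thesis
    by (rule has_wirtinger_transform[OF _ S z])
       (rule of_real_ln_norm_square_eq[symmetric, OF nz[OF z] nz])
qed

text \<open>The modulus is the exponential of half of log |g|^2, whose Wirtinger derivatives are
  known.\<close>

lemma C1_on_norm_holomorphic:
  assumes g: "g holomorphic_on S" and S: "open S" and nz: "\<And>x. x \<in> S \<Longrightarrow> g x \<noteq> 0"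
  shows "C1_on S (\<lambda>x. complex_of_real (norm (g x)))"
proof -
  have "continuous_on S (\<lambda>z. deriv g z / g z)"
    by (intro continuous_intros holomorphic_on_imp_continuous_on holomorphic_deriv g S) (use nz in auto)
  hence "C1_on S (\<lambda>x. complex_of_real (ln ((norm (g x))\<^sup>2)))"
    by (intro C1_on_wirtingerI[OF has_wirtinger_ln_norm_square[OF g S _ nz]] continuous_on_cnj)
  moreover have "(\<lambda>w :: complex. exp (w / 2)) holomorphic_on UNIV" by (intro holomorphic_intros) auto
  ultimately have "C1_on S (\<lambda>x. exp (complex_of_real (ln ((norm (g x))\<^sup>2)) / 2))"
    by (rule C1_on_compose[OF _ C1_on_holomorphic[OF _ open_UNIV]]) auto
  thus ?thesis
  proof (rule C1_on_transform[OF _ S])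
    fix x assume "x \<in> S"
    hence "exp (ln ((norm (g x))\<^sup>2) / 2) = norm (g x)" using nz by (simp add: ln_realpow)
    thus "exp (of_real (ln ((norm (g x))\<^sup>2)) / 2) = complex_of_real (norm (g x))"
      by (metis exp_of_real of_real_divide of_real_numeral)
  qed
qed

text \<open>log \<rho>^2 is log \<sigma>^2 composed with \<psi> plus log |\<psi>'|^2, and
  \<open>dz\<close> of the last term is \<psi>'' / \<psi>'. The target T is left general to allow a
  density on the disk as well as the constant 1 on the plane.\<close>

lemma pullback_density:
  fixes \<sigma> :: "complex \<Rightarrow> real"
  assumes T: "open T" and \<sigma>: "C1_on T \<sigma>" "\<And>w. w \<in> T \<Longrightarrow> \<sigma> w > 0"
    and \<psi>: "\<psi> holomorphic_on \<bbbU>" "\<psi> ` \<bbbU> \<subseteq> T" "\<And>x. x \<in> \<bbbU> \<Longrightarrow> deriv \<psi> x \<noteq> 0"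
  defines "\<rho> \<equiv> \<lambda>x. \<sigma> (\<psi> x) * norm (deriv \<psi> x)"
  shows "disk_metric \<rho>"
    and "x \<in> \<bbbU> \<Longrightarrow> dlog_density \<rho> x = dlog_density \<sigma> (\<psi> x) * deriv \<psi> x + deriv (deriv \<psi>) x / deriv \<psi> x"
proof -
  have d\<psi>: "deriv \<psi> holomorphic_on \<bbbU>" by (intro holomorphic_deriv \<psi> open_ball)
  have "C1_on \<bbbU> (\<lambda>x. complex_of_real (\<sigma> (\<psi> x)))"
    by (rule C1_on_compose[OF C1_on_holomorphic[OF \<psi>(1) open_ball] C1_on_of_real_iff[THEN iffD2, OF \<sigma>(1)] \<psi>(2)])
  hence "C1_on \<bbbU> (\<lambda>x. of_real (\<sigma> (\<psi> x)) * complex_of_real (norm (deriv \<psi> x)))"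
    by (intro C1_on_mult C1_on_norm_holomorphic d\<psi> open_ball \<psi>(3)) auto
  hence "C1_on \<bbbU> \<rho>" unfolding \<rho>_def using C1_on_of_real_iff[of \<bbbU> \<rho>] by (simp add: \<rho>_def)
  moreover have "\<rho> w > 0" if "w \<in> \<bbbU>" for w
  proof -
    have "\<psi> w \<in> T" using \<psi>(2) that by blast
    thus ?thesis using \<sigma>(2)[of "\<psi> w"] \<psi>(3)[OF that] by (simp add: \<rho>_def)
  qed
  ultimately show "disk_metric \<rho>" by (simp add: disk_metric_def)
  assume x: "x \<in> \<bbbU>"
  define \<Lambda> where "\<Lambda> = (\<lambda>w. complex_of_real (ln ((\<sigma> w)\<^sup>2)))"
  have "\<psi> x \<in> T" using x \<psi>(2) by blast
  have "\<Lambda> differentiable (at (\<psi> x))"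
  proof -
    have "(\<sigma> has_derivative frechet_derivative \<sigma> (at (\<psi> x))) (at (\<psi> x))"
      using \<sigma>(1) \<open>\<psi> x \<in> T\<close> by (auto simp: C1_on_def frechet_derivative_works)
    moreover have "\<sigma> (\<psi> x) > 0" using \<sigma>(2) \<open>\<psi> x \<in> T\<close> .
    ultimately have "((\<lambda>w. complex_of_real (ln ((\<sigma> w)\<^sup>2))) has_derivative
        (\<lambda>h. of_real (2 * frechet_derivative \<sigma> (at (\<psi> x)) h / \<sigma> (\<psi> x)))) (at (\<psi> x))"
      by (auto intro!: derivative_eq_intros simp: fun_eq_iff power2_eq_square field_simps)
    thus ?thesis unfolding \<Lambda>_def differentiable_def by blast
  qed
  hence "has_wirtinger \<Lambda> (dlog_density \<sigma> (\<psi> x)) (dzbar \<Lambda> (\<psi> x)) (\<psi> x)"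
    using differentiable_imp_has_wirtinger[of \<Lambda>] by (simp add: dlog_density_def \<Lambda>_def)
  from has_wirtinger_compose[OF has_wirtinger_field_derivative[OF holomorphic_derivI[OF \<psi>(1) open_ball x]] this]
  have "has_wirtinger (\<lambda>x. \<Lambda> (\<psi> x)) (dlog_density \<sigma> (\<psi> x) * deriv \<psi> x) (dzbar \<Lambda> (\<psi> x) * cnj (deriv \<psi> x)) x" by simp
  from has_wirtinger_add[OF this has_wirtinger_ln_norm_square[OF d\<psi> open_ball x \<psi>(3)]]
  have W: "has_wirtinger (\<lambda>x. \<Lambda> (\<psi> x) + of_real (ln ((norm (deriv \<psi> x))\<^sup>2)))
     (dlog_density \<sigma> (\<psi> x) * deriv \<psi> x + deriv (deriv \<psi>) x / deriv \<psi> x)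
     (dzbar \<Lambda> (\<psi> x) * cnj (deriv \<psi> x) + cnj (deriv (deriv \<psi>) x / deriv \<psi> x)) x" by simp
  have "has_wirtinger (\<lambda>w. complex_of_real (ln ((\<rho> w)\<^sup>2)))
     (dlog_density \<sigma> (\<psi> x) * deriv \<psi> x + deriv (deriv \<psi>) x / deriv \<psi> x)
     (dzbar \<Lambda> (\<psi> x) * cnj (deriv \<psi> x) + cnj (deriv (deriv \<psi>) x / deriv \<psi> x)) x"
  proof (rule has_wirtinger_transform[OF W open_ball x])
    fix y assume y: "y \<in> \<bbbU>"
    have "\<sigma> (\<psi> y) > 0" "deriv \<psi> y \<noteq> 0" using \<sigma>(2) \<psi>(2,3) y by blast+
    thus "\<Lambda> (\<psi> y) + of_real (ln ((norm (deriv \<psi> y))\<^sup>2)) = of_real (ln ((\<rho> y)\<^sup>2))"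
      by (simp add: \<Lambda>_def \<rho>_def power_mult_distrib ln_mult flip: of_real_add)
  qed
  thus "dlog_density \<rho> x = dlog_density \<sigma> (\<psi> x) * deriv \<psi> x + deriv (deriv \<psi>) x / deriv \<psi> x"
    unfolding dlog_density_def by (rule has_wirtinger_unique)
qed

text \<open>Harmonicity only depends on the metric up to a conformal change of coordinates in the target.\<close>

lemma rho_harmonic_pullback:
  fixes \<sigma> :: "complex \<Rightarrow> real"
  assumes T: "open T" and \<sigma>: "C1_on T \<sigma>" "\<And>w. w \<in> T \<Longrightarrow> \<sigma> w > 0"
    and \<psi>: "\<psi> holomorphic_on \<bbbU>" "\<psi> ` \<bbbU> \<subseteq> T" "\<And>x. x \<in> \<bbbU> \<Longrightarrow> deriv \<psi> x \<noteq> 0"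
    and f: "C2_on \<bbbU> f" "f ` \<bbbU> \<subseteq> \<bbbU>"
    and eq: "\<And>z. z \<in> \<bbbU> \<Longrightarrow> dzbar (dz (\<lambda>z. \<psi> (f z))) z +
       dlog_density \<sigma> (\<psi> (f z)) * dz (\<lambda>z. \<psi> (f z)) z * dzbar (\<lambda>z. \<psi> (f z)) z = 0"
  shows "rho_harmonic (\<lambda>x. \<sigma> (\<psi> x) * norm (deriv \<psi> x)) f"
  unfolding rho_harmonic_def
proof (intro conjI ballI f)
  fix z :: complex assume z: "z \<in> \<bbbU>"
  hence fz: "f z \<in> \<bbbU>" using f(2) by blast
  note D = dzbar_dz_holomorphic_compose[OF f(1) open_ball \<psi>(1) open_ball f(2) z]
  define p where "p = deriv \<psi> (f z)"
  have "p \<noteq> 0" using \<psi>(3)[OF fz] by (simp add: p_def)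
  \<comment> \<open>Multiplied by p = \<psi>'(f z), the equation for the pulled-back density is the
    assumed equation for \<psi> o f: the \<psi>'' term is the one produced by the chain
    rule.\<close>
  have "p * (dzbar (dz f) z + (dlog_density \<sigma> (\<psi> (f z)) * p + deriv (deriv \<psi>) (f z) / p) * dz f z * dzbar f z)
    = (p * dzbar (dz f) z + deriv (deriv \<psi>) (f z) * dz f z * dzbar f z) +
       dlog_density \<sigma> (\<psi> (f z)) * (p * dz f z) * (p * dzbar f z)"
    using \<open>p \<noteq> 0\<close> by (simp add: field_simps)
  also have "\<dots> = 0" using eq[OF z] unfolding D p_def .
  finally have "dzbar (dz f) z + (dlog_density \<sigma> (\<psi> (f z)) * p + deriv (deriv \<psi>) (f z) / p) * dz f z * dzbar f z = 0"
    using \<open>p \<noteq> 0\<close> by simp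
  moreover have "dlog_density (\<lambda>x. \<sigma> (\<psi> x) * norm (deriv \<psi> x)) (f z) =
      dlog_density \<sigma> (\<psi> (f z)) * p + deriv (deriv \<psi>) (f z) / p"
    unfolding p_def by (rule pullback_density(2)[OF T \<sigma> \<psi> fz])
  ultimately show "dzbar (dz f) z + dlog_density (\<lambda>x. \<sigma> (\<psi> x) * norm (deriv \<psi> x)) (f z) * dz f z * dzbar f z = 0"
    by simp
qed

section \<open>Automorphisms of the disk\<close>

lemma cnj_mult_neq_one:
  assumes "norm a < 1" "norm x < 1"
  shows "1 - cnj a * x \<noteq> 0"
proof
  assume "1 - cnj a * x = 0"
  hence "norm (cnj a * x) = 1" by (metis eq_iff_diff_eq_0 norm_one)
  moreover have "norm a * norm x < 1" using assms norm_mult_less[of a 1 x 1] by (simp add: norm_mult)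
  ultimately show False by (simp add: norm_mult)
qed

text \<open>The Schwarz lemma bounds the derivatives at 0 of f and of its inverse by 1, and their
  product is 1; the equality case gives a rotation.\<close>

lemma disk_automorphism_fixing_zero:
  assumes f: "f holomorphic_on \<bbbU>" "inj_on f \<bbbU>" "f ` \<bbbU> = \<bbbU>" "f 0 = 0"
  shows "\<exists>\<alpha>. norm \<alpha> = 1 \<and> (\<forall>z\<in>\<bbbU>. f z = \<alpha> * z)"
proof -
  obtain g where g: "g holomorphic_on \<bbbU>" "\<And>z. z \<in> \<bbbU> \<Longrightarrow> deriv f z * deriv g (f z) = 1" "\<And>z. z \<in> \<bbbU> \<Longrightarrow> g (f z) = z"
    using holomorphic_has_inverse[OF f(1) open_ball f(2)] f(3) by metis
  have fno: "norm (f z) < 1" if "norm z < 1" for z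
  proof -
    have "f z \<in> \<bbbU>" using f(3) that by (metis imageI mem_ball_0)
    thus ?thesis by simp
  qed
  have g0: "g 0 = 0" using g(3)[of 0] f(4) by simp
  have gno: "norm (g z) < 1" if "norm z < 1" for z
  proof -
    have "z \<in> f ` \<bbbU>" using that f(3) by simp
    then obtain y where "y \<in> \<bbbU>" "z = f y" by blast
    thus ?thesis using g(3)[of y] by simp
  qed
  have "norm (deriv f 0) \<le> 1" by (rule Schwarz_Lemma(2)[OF f(1,4) fno, of 0]) auto
  moreover have "norm (deriv g 0) \<le> 1" by (rule Schwarz_Lemma(2)[OF g(1) g0 gno, of 0]) auto
  moreover have "norm (deriv f 0) * norm (deriv g 0) = 1"
    using g(2)[of 0] f(4) by (metis centre_in_ball norm_mult norm_one zero_less_one)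
  ultimately have "norm (deriv f 0) = 1"
    by (smt (verit) mult_left_le norm_ge_zero)
  thus ?thesis using Schwarz_Lemma(3)[OF f(1,4) fno, of 0] by fastforce
qed

text \<open>After this the coefficients are forgotten: the maps enter as holomorphic bijections of
  the disk, and the Schwarz lemma supplies their normal form.\<close>

lemma disk_moebius_automorphism:
  assumes "disk_moebius p"
  shows "p holomorphic_on \<bbbU>" "inj_on p \<bbbU>" "p ` \<bbbU> = \<bbbU>"
proof -
  obtain a b c d where det: "a * d - b * c \<noteq> 0"
    and p: "\<And>z. z \<in> \<bbbU> \<Longrightarrow> c * z + d \<noteq> 0" "\<And>z. z \<in> \<bbbU> \<Longrightarrow> p z = (a * z + b) / (c * z + d)"
    using assms unfolding disk_moebius_def moebius_def by metis
  have "(\<lambda>z. (a * z + b) / (c * z + d)) holomorphic_on \<bbbU>"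
    by (intro holomorphic_intros p)
  thus "p holomorphic_on \<bbbU>" by (rule holomorphic_transform) (simp add: p)
  show "inj_on p \<bbbU>"
  proof (rule inj_onI)
    fix x y assume xy: "x \<in> \<bbbU>" "y \<in> \<bbbU>" "p x = p y"
    hence "(a * x + b) * (c * y + d) = (a * y + b) * (c * x + d)"
      using p by (simp add: frac_eq_eq)
    hence "(a * d - b * c) * (x - y) = 0" by (simp add: algebra_simps)
    thus "x = y" using det by simp
  qed
  show "p ` \<bbbU> = \<bbbU>" using assms by (simp add: disk_moebius_def)
qed

lemma Moebius_function_automorphism:
  assumes "norm a < 1"
  shows "Moebius_function 0 a holomorphic_on \<bbbU>" "inj_on (Moebius_function 0 a) \<bbbU>"
    "Moebius_function 0 a ` \<bbbU> = \<bbbU>"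
proof -
  have inv: "Moebius_function 0 a (Moebius_function 0 (- a) z) = z"
       "Moebius_function 0 (- a) (Moebius_function 0 a z) = z" if "z \<in> \<bbbU>" for z
    using Moebius_function_compose[of a "-a" z] Moebius_function_compose[of "-a" a z] assms that by auto
  have m: "Moebius_function 0 a z \<in> \<bbbU>" "Moebius_function 0 (- a) z \<in> \<bbbU>" if "z \<in> \<bbbU>" for z
    using Moebius_function_norm_lt_1[of a z 0] Moebius_function_norm_lt_1[of "-a" z 0] assms that by auto
  show "Moebius_function 0 a holomorphic_on \<bbbU>" by (rule Moebius_function_holomorphic[OF assms])
  show "inj_on (Moebius_function 0 a) \<bbbU>" using inv(2) by (metis inj_onI)
  show "Moebius_function 0 a ` \<bbbU> = \<bbbU>" using inv(1) m by (metis (no_types, lifting) image_eqI image_subsetI subsetI subset_antisym)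
qed

lemma automorphism_compose:
  assumes "f holomorphic_on \<bbbU>" "inj_on f \<bbbU>" "f ` \<bbbU> = \<bbbU>"
    and "g holomorphic_on \<bbbU>" "inj_on g \<bbbU>" "g ` \<bbbU> = \<bbbU>"
  shows "(\<lambda>z. g (f z)) holomorphic_on \<bbbU>" "inj_on (\<lambda>z. g (f z)) \<bbbU>" "(\<lambda>z. g (f z)) ` \<bbbU> = \<bbbU>"
  using holomorphic_on_compose_gen[OF assms(1,4)] comp_inj_on[OF assms(2), of g] assms image_comp[of g f \<bbbU>]
  by (simp_all add: o_def)

text \<open>Composed with the automorphism taking 0 to a, the map p fixes the origin, so it becomes
  a rotation. The normal form exposes bounded parameters, from which convergent subsequences can be
  drawn.\<close>

lemma disk_moebius_zero_form:
  assumes p: "disk_moebius p" and a: "norm a < 1" "p a = 0"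
  shows "\<exists>\<alpha>. norm \<alpha> = 1 \<and> (\<forall>x\<in>\<bbbU>. p x = \<alpha> * ((x - a) / (1 - cnj a * x)))"
proof -
  have "norm (- a) < 1" using a by simp
  note A = automorphism_compose[OF Moebius_function_automorphism[OF this] disk_moebius_automorphism[OF p]]
  have "p (Moebius_function 0 (- a) 0) = 0" using a by (simp add: Moebius_function_simple)
  from disk_automorphism_fixing_zero[OF A this] obtain \<alpha> where
    \<alpha>: "norm \<alpha> = 1" "\<And>z. z \<in> \<bbbU> \<Longrightarrow> p (Moebius_function 0 (- a) z) = \<alpha> * z" by blast
  have "p x = \<alpha> * ((x - a) / (1 - cnj a * x))" if x: "x \<in> \<bbbU>" for x
  proof -
    have "Moebius_function 0 a x \<in> \<bbbU>" using Moebius_function_norm_lt_1[of a x 0] a x by simp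
    from \<alpha>(2)[OF this] show ?thesis
      using Moebius_function_compose[of "-a" a x] a x by (simp add: Moebius_function_simple)
  qed
  with \<alpha>(1) show ?thesis by blast
qed

lemma disk_moebius_at_zero_form:
  assumes q: "disk_moebius q" and b: "norm b < 1" "q 0 = b"
  shows "\<exists>\<beta>. norm \<beta> = 1 \<and> (\<forall>x\<in>\<bbbU>. q x = (\<beta> * x + b) / (1 + cnj b * (\<beta> * x)))"
proof -
  note A = automorphism_compose[OF disk_moebius_automorphism[OF q] Moebius_function_automorphism[OF b(1)]]
  have "Moebius_function 0 b (q 0) = 0" using b by (simp add: Moebius_function_simple)
  from disk_automorphism_fixing_zero[OF A this] obtain \<beta> where
    \<beta>: "norm \<beta> = 1" "\<And>z. z \<in> \<bbbU> \<Longrightarrow> Moebius_function 0 b (q z) = \<beta> * z" by blast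
  have "q x = (\<beta> * x + b) / (1 + cnj b * (\<beta> * x))" if x: "x \<in> \<bbbU>" for x
  proof -
    have "q x \<in> \<bbbU>" using disk_moebius_automorphism(3)[OF q] x by blast
    hence "Moebius_function 0 (- b) (Moebius_function 0 b (q x)) = q x"
      using Moebius_function_compose[of "-b" b "q x"] b by simp
    thus ?thesis unfolding \<beta>(2)[OF x] by (simp add: Moebius_function_simple)
  qed
  with \<beta>(1) show ?thesis by blast
qed

lemma qc_selfmap_compose_automorphisms:
  assumes w: "qc_selfmap k w"
    and p: "p holomorphic_on \<bbbU>" "inj_on p \<bbbU>" "p ` \<bbbU> = \<bbbU>"
    and q: "q holomorphic_on \<bbbU>" "inj_on q \<bbbU>" "q ` \<bbbU> = \<bbbU>"
  shows "qc_selfmap k (p \<circ> w \<circ> q)"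
proof -
  have w1: "C1_on \<bbbU> w" "inj_on w \<bbbU>" "w ` \<bbbU> \<subseteq> \<bbbU>"
    "\<And>z. z \<in> \<bbbU> \<Longrightarrow> cmod (dzbar w z) \<le> k * cmod (dz w z)" using w by (auto simp: qc_selfmap_def)
  have mem: "q z \<in> \<bbbU>" "w (q z) \<in> \<bbbU>" "p (w (q z)) \<in> \<bbbU>" if "z \<in> \<bbbU>" for z
    using that p(3) q(3) w1(3) by blast+
  have wq: "C1_on \<bbbU> (\<lambda>z. w (q z))"
    by (rule C1_on_compose[OF C1_on_holomorphic[OF q(1) open_ball] w1(1)]) (simp add: q(3))
  have "C1_on \<bbbU> (\<lambda>z. p (w (q z)))"
    by (rule C1_on_compose[OF wq C1_on_holomorphic[OF p(1) open_ball]]) (use mem in auto)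
  moreover have "inj_on (\<lambda>z. p (w (q z))) \<bbbU>"
    using inj_onD[OF p(2)] inj_onD[OF q(2)] inj_onD[OF w1(2)] mem unfolding inj_on_def by meson
  moreover have "cmod (dzbar (\<lambda>z. p (w (q z))) z) \<le> k * cmod (dz (\<lambda>z. p (w (q z))) z)" if z: "z \<in> \<bbbU>" for z
  proof -
    have "has_wirtinger (\<lambda>z. w (q z)) (dz w (q z) * deriv q z) (dzbar w (q z) * cnj (deriv q z)) z"
      using has_wirtinger_compose[OF has_wirtinger_field_derivative[OF holomorphic_derivI[OF q(1) open_ball z]]
          C1_on_wirtingerD(1)[OF w1(1) mem(1)[OF z]]] by simp
    from has_wirtinger_compose[OF this has_wirtinger_field_derivative[OF holomorphic_derivI[OF p(1) open_ball mem(2)[OF z]]]]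
    have W: "has_wirtinger (\<lambda>z. p (w (q z))) (deriv p (w (q z)) * (dz w (q z) * deriv q z))
       (deriv p (w (q z)) * (dzbar w (q z) * cnj (deriv q z))) z" by simp
    have "norm (deriv p (w (q z))) * norm (deriv q z) * norm (dzbar w (q z)) \<le>
       norm (deriv p (w (q z))) * norm (deriv q z) * (k * norm (dz w (q z)))"
      by (intro mult_left_mono w1(4) mem z) auto
    thus ?thesis unfolding has_wirtinger_unique[OF W] by (simp add: norm_mult mult_ac)
  qed
  ultimately show ?thesis using mem by (auto simp: qc_selfmap_def o_def)
qed

text \<open>The limit theorem yields smoothness only on balls of radius below 1; smoothness being
  local, these suffice.\<close>

lemma C2_on_disk_if_on_balls:
  fixes f :: "complex \<Rightarrow> complex"
  assumes "\<And>r. 0 < r \<Longrightarrow> r < 1 \<Longrightarrow> C2_on (ball 0 r) f"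
  shows "C2_on \<bbbU> f"
proof -
  have C1: "C1_on \<bbbU> g" if g: "\<And>r. 0 < r \<Longrightarrow> r < 1 \<Longrightarrow> C1_on (ball 0 r) g" for g :: "complex \<Rightarrow> complex"
  proof -
    have pt: "\<exists>r. 0 < r \<and> r < 1 \<and> z \<in> ball 0 r" if "z \<in> \<bbbU>" for z :: complex
      using that by (intro exI[of _ "(norm z + 1) / 2"]) (auto simp: add_nonneg_pos)
    have "continuous_on \<bbbU> h" if "\<And>r. 0 < r \<Longrightarrow> r < 1 \<Longrightarrow> continuous_on (ball 0 r) h" for h :: "complex \<Rightarrow> complex"
      unfolding continuous_on_eq_continuous_at[OF open_ball]
      using pt that[unfolded continuous_on_eq_continuous_at[OF open_ball]] by meson
    thus ?thesis using g pt unfolding C1_on_def by meson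
  qed
  show ?thesis using assms unfolding C2_on_def by (auto intro!: C1)
qed

section \<open>The limit map\<close>

lemma C2_on_transform:
  fixes f g :: "complex \<Rightarrow> complex"
  assumes f: "C2_on S f" and S: "open S" and eq: "\<And>x. x \<in> S \<Longrightarrow> f x = g x"
  shows "C2_on S g"
    and "z \<in> S \<Longrightarrow> dz g z = dz f z" "z \<in> S \<Longrightarrow> dzbar g z = dzbar f z"
    and "z \<in> S \<Longrightarrow> dzbar (dz g) z = dzbar (dz f) z"
proof -
  have f1: "C1_on S f" "C1_on S (dz f)" "C1_on S (dzbar f)" using f by (auto simp: C2_on_iff)
  have W: "has_wirtinger g (dz f x) (dzbar f x) x" if "x \<in> S" for x
    using C1_on_wirtingerD(1)[OF f1(1) that] by (rule has_wirtinger_transform[OF _ S that eq])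
  note D = has_wirtinger_unique[OF W]
  have W2: "has_wirtinger (dz g) (dz (dz f) x) (dzbar (dz f) x) x" if "x \<in> S" for x
    using C1_on_wirtingerD(1)[OF f1(2) that] by (rule has_wirtinger_transform[OF _ S that]) (simp add: D)
  show "z \<in> S \<Longrightarrow> dz g z = dz f z" "z \<in> S \<Longrightarrow> dzbar g z = dzbar f z" by (fact D)+
  show "z \<in> S \<Longrightarrow> dzbar (dz g) z = dzbar (dz f) z" using has_wirtinger_unique(2)[OF W2] .
  show "C2_on S g" unfolding C2_on_iff
    using C1_on_transform[OF f1(1) S eq] C1_on_transform[OF f1(2) S, of "dz g"]
      C1_on_transform[OF f1(3) S, of "dzbar g"] D by auto
qed

text \<open>Conformal invariance in the source: both sides of the equation acquire the factor
  |q'|^2.\<close>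

lemma rho_harmonic_compose_holomorphic:
  assumes w: "rho_harmonic \<rho> w" and q: "q holomorphic_on \<bbbU>" "q ` \<bbbU> \<subseteq> \<bbbU>"
  shows "C2_on \<bbbU> (\<lambda>z. w (q z))"
    and "z \<in> \<bbbU> \<Longrightarrow> dzbar (dz (\<lambda>z. w (q z))) z =
      - (dlog_density \<rho> (w (q z)) * dz (\<lambda>z. w (q z)) z * dzbar (\<lambda>z. w (q z)) z)"
proof -
  have w1: "C2_on \<bbbU> w"
    "\<And>z. z \<in> \<bbbU> \<Longrightarrow> dzbar (dz w) z + dlog_density \<rho> (w z) * dz w z * dzbar w z = 0"
    using w by (auto simp: rho_harmonic_def)
  show "C2_on \<bbbU> (\<lambda>z. w (q z))"
    by (rule C2_on_compose[OF C2_on_holomorphic[OF q(1) open_ball] w1(1) q(2) open_ball])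
  assume z: "z \<in> \<bbbU>"
  hence "q z \<in> \<bbbU>" using q(2) by blast
  from w1(2)[OF this] have "dzbar (dz w) (q z) = - (dlog_density \<rho> (w (q z)) * dz w (q z) * dzbar w (q z))"
    by (simp add: eq_neg_iff_add_eq_0)
  thus "dzbar (dz (\<lambda>z. w (q z))) z =
      - (dlog_density \<rho> (w (q z)) * dz (\<lambda>z. w (q z)) z * dzbar (\<lambda>z. w (q z)) z)"
    unfolding dzbar_dz_compose_holomorphic[OF w1(1) open_ball q z] by (simp add: algebra_simps)
qed

lemma rotation_automorphism:
  assumes "norm c = 1"
  shows "(*) c holomorphic_on \<bbbU>" "inj_on ((*) c) \<bbbU>" "(*) c ` \<bbbU> = \<bbbU>"
proof -
  have "c \<noteq> 0" using assms by auto
  show "(*) c holomorphic_on \<bbbU>" by (intro holomorphic_intros)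
  show "inj_on ((*) c) \<bbbU>" using \<open>c \<noteq> 0\<close> by (auto intro: inj_onI)
  have "z \<in> (*) c ` \<bbbU>" if "z \<in> \<bbbU>" for z
    by (rule image_eqI[of _ _ "z / c"]) (use that assms \<open>c \<noteq> 0\<close> in \<open>auto simp: norm_divide\<close>)
  thus "(*) c ` \<bbbU> = \<bbbU>" using assms by (auto simp: norm_mult)
qed

text \<open>The map \<psi> undoes the outer Moebius map, so \<psi> o f = w o Q, which solves the
  equation for \<rho> itself. The metric for f is therefore the pull-back of \<rho> by
  \<psi>.\<close>

lemma moebius_conjugate_rho_harmonic:
  assumes \<rho>: "disk_metric \<rho>" and w: "rho_harmonic \<rho> w"
    and "norm a < 1" "norm \<alpha> = 1" "norm b < 1" "norm \<beta> = 1"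
    and f: "\<And>z. z \<in> \<bbbU> \<Longrightarrow> f z = \<alpha> * Moebius_function 0 a (w (Moebius_function 0 b (\<beta> * z)))"
  shows "\<exists>\<rho>0. disk_metric \<rho>0 \<and> rho_harmonic \<rho>0 f"
proof -
  define Q where "Q = (\<lambda>z. Moebius_function 0 b (\<beta> * z))"
  define P where "P = (\<lambda>x. \<alpha> * Moebius_function 0 a x)"
  define \<psi> where "\<psi> = (\<lambda>x. Moebius_function 0 (- a) (inverse \<alpha> * x))"
  have a': "norm (- a) < 1" "norm (inverse \<alpha>) = 1" "\<alpha> \<noteq> 0" using assms by (auto simp: norm_inverse)
  note Q = automorphism_compose[OF rotation_automorphism[OF \<open>norm \<beta> = 1\<close>] Moebius_function_automorphism[OF \<open>norm b < 1\<close>], folded Q_def]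
  note P = automorphism_compose[OF Moebius_function_automorphism[OF \<open>norm a < 1\<close>] rotation_automorphism[OF \<open>norm \<alpha> = 1\<close>], folded P_def]
  note \<psi> = automorphism_compose[OF rotation_automorphism[OF a'(2)] Moebius_function_automorphism[OF a'(1)], folded \<psi>_def]
  have wU: "w ` \<bbbU> \<subseteq> \<bbbU>" using w by (simp add: rho_harmonic_def)
  have Qsub: "Q ` \<bbbU> \<subseteq> \<bbbU>" using Q(3) by blast
  note wQ = rho_harmonic_compose_holomorphic[OF w Q(1) Qsub]
  have feq: "P (w (Q z)) = f z" if "z \<in> \<bbbU>" for z using f[OF that] by (simp add: P_def Q_def)
  have wQU: "w (Q z) \<in> \<bbbU>" if "z \<in> \<bbbU>" for z using wU Qsub that by blast
  have fC2: "C2_on \<bbbU> f"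
    by (rule C2_on_transform(1)[OF C2_on_compose[OF wQ(1) C2_on_holomorphic[OF P(1) open_ball] _ open_ball] open_ball feq])
       (use wQU in auto)
  have fU: "f ` \<bbbU> \<subseteq> \<bbbU>"
  proof
    fix y assume "y \<in> f ` \<bbbU>"
    then obtain z where z: "z \<in> \<bbbU>" "y = f z" by blast
    have "P (w (Q z)) \<in> \<bbbU>" using P(3) wQU[OF z(1)] by blast
    thus "y \<in> \<bbbU>" using feq z by simp
  qed
  have \<psi>f: "w (Q z) = \<psi> (f z)" if "z \<in> \<bbbU>" for z
  proof -
    have "\<psi> (f z) = Moebius_function 0 (- a) (Moebius_function 0 a (w (Q z)))"
      unfolding feq[OF that, symmetric] \<psi>_def P_def using a'(3) by (simp flip: mult.assoc)
    also have "\<dots> = w (Q z)"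
      using wQU[OF that] a' by (intro Moebius_function_compose) auto
    finally show ?thesis ..
  qed
  have \<psi>1: "\<psi> ` \<bbbU> \<subseteq> \<bbbU>" using \<psi>(3) by simp
  have \<psi>': "deriv \<psi> x \<noteq> 0" if "x \<in> \<bbbU>" for x
    by (rule holomorphic_injective_imp_regular[OF \<psi>(1) open_ball \<psi>(2) that])
  have \<sigma>: "C1_on \<bbbU> \<rho>" "\<And>w. w \<in> \<bbbU> \<Longrightarrow> \<rho> w > 0" using \<rho> by (auto simp: disk_metric_def)
  have "rho_harmonic (\<lambda>x. \<rho> (\<psi> x) * norm (deriv \<psi> x)) f"
  proof (rule rho_harmonic_pullback[OF open_ball \<sigma> \<psi>(1) \<psi>1 \<psi>' fC2 fU])
    fix z :: complex assume z: "z \<in> \<bbbU>"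
    have T: "dz (\<lambda>z. \<psi> (f z)) z = dz (\<lambda>z. w (Q z)) z" "dzbar (\<lambda>z. \<psi> (f z)) z = dzbar (\<lambda>z. w (Q z)) z"
      "dzbar (dz (\<lambda>z. \<psi> (f z))) z = dzbar (dz (\<lambda>z. w (Q z))) z"
      by (rule C2_on_transform(2-4)[OF wQ(1) open_ball \<psi>f z]; assumption)+
    show "dzbar (dz (\<lambda>z. \<psi> (f z))) z +
       dlog_density \<rho> (\<psi> (f z)) * dz (\<lambda>z. \<psi> (f z)) z * dzbar (\<lambda>z. \<psi> (f z)) z = 0"
      unfolding T wQ(2)[OF z] \<psi>f[OF z, symmetric] by simp
  qed
  moreover have "disk_metric (\<lambda>x. \<rho> (\<psi> x) * norm (deriv \<psi> x))"
    by (rule pullback_density(1)[OF open_ball \<sigma> \<psi>(1) \<psi>1 \<psi>'])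
  ultimately show ?thesis by blast
qed

lemma uniform_limit_const_sequence:
  assumes "c \<longlonglongrightarrow> l"
  shows "uniform_limit S (\<lambda>n _. c n) (\<lambda>_. l) sequentially"
  using assms by (auto simp: uniform_limit_iff tendsto_iff elim!: eventually_mono)

text \<open>When \<^term>\<open>a n\<close> tends to the circle, \<^term>\<open>v n = (w (q n z) - a n) / (1 - (norm (a n))\<^sup>2)\<close>
  is almost harmonic, and \<^term>\<open>f n\<close> is a Moebius image of it.\<close>

lemma boundary_limit_rho_harmonic:
  fixes f :: "nat \<Rightarrow> complex \<Rightarrow> complex"
  assumes w: "rho_harmonic \<rho> w" and M: "\<And>x. x \<in> \<bbbU> \<Longrightarrow> norm (dlog_density \<rho> x) \<le> M"
    and a: "\<And>n. norm (a n) < 1" "a \<longlonglongrightarrow> a0" "norm a0 = 1"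
    and \<alpha>: "\<And>n. norm (\<alpha> n) = 1" "\<alpha> \<longlonglongrightarrow> \<alpha>0"
    and q: "\<And>n. q n holomorphic_on \<bbbU>" "\<And>n. q n ` \<bbbU> \<subseteq> \<bbbU>"
    and f: "\<And>n z. z \<in> \<bbbU> \<Longrightarrow> f n z = \<alpha> n * ((w (q n z) - a n) / (1 - cnj (a n) * w (q n z)))"
    and away: "\<And>R. 0 < R \<Longrightarrow> R < 1 \<Longrightarrow> \<exists>\<eta>>0. \<forall>n. \<forall>z\<in>cball 0 R. norm (f n z) \<le> 1 - \<eta>"
    and lim: "\<And>K. compact K \<Longrightarrow> K \<subseteq> \<bbbU> \<Longrightarrow> uniform_limit K f f0 sequentially"
    and f0: "f0 ` \<bbbU> \<subseteq> \<bbbU>"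
  shows "\<exists>\<rho>0. disk_metric \<rho>0 \<and> rho_harmonic \<rho>0 f0"
proof -
  define c where "c = (\<lambda>n. 1 - (norm (a n))\<^sup>2)"
  have c: "c n > 0" for n using a(1)[of n] by (simp add: c_def abs_square_less_1)
  have c': "complex_of_real (c n) = 1 - cnj (a n) * a n" for n
    by (simp add: c_def complex_norm_square mult.commute del: of_real_power)
  have "M \<ge> 0" using order_trans[OF norm_ge_zero M[of 0]] by simp
  define v where "v = (\<lambda>n z. (w (q n z) - a n) / of_real (c n))"
  \<comment> \<open>The limit of the Moebius maps taking \<open>f n\<close> to \<open>v n\<close>.
    As |a0| = 1 its pole lies on the unit circle, so the disk goes to a half-plane; \<phi> is the
    inverse.\<close>
  define \<psi> where "\<psi> = (\<lambda>x. x / (\<alpha>0 + cnj a0 * x))"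
  define \<phi> where "\<phi> = (\<lambda>y. \<alpha>0 * y / (1 - cnj a0 * y))"
  have "(\<lambda>n. norm (\<alpha> n)) \<longlonglongrightarrow> norm \<alpha>0" by (intro tendsto_norm \<alpha>)
  hence \<alpha>0: "norm \<alpha>0 = 1" using \<alpha>(1) by (simp add: LIMSEQ_const_iff)
  hence "\<alpha>0 \<noteq> 0" by auto
  have wqU: "w (q n z) \<in> \<bbbU>" if "z \<in> \<bbbU>" for n z
    using w q(2)[of n] that unfolding rho_harmonic_def by blast
  have v_f: "v n z = f n z / (\<alpha> n + cnj (a n) * f n z)" if z: "z \<in> \<bbbU>" for n z
  proof -
    define x where "x = w (q n z)"
    have d: "1 - cnj (a n) * x \<noteq> 0" using cnj_mult_neq_one[OF a(1)[of n], of x] wqU[OF z, of n] by (simp add: x_def)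
    have "\<alpha> n \<noteq> 0" using \<alpha>(1)[of n] by auto
    have fx: "f n z = \<alpha> n * ((x - a n) / (1 - cnj (a n) * x))" using f[OF z] by (simp add: x_def)
    have "\<alpha> n + cnj (a n) * f n z = \<alpha> n * of_real (c n) / (1 - cnj (a n) * x)"
      unfolding fx c' using d by (simp add: field_simps)
    moreover have "complex_of_real (c n) \<noteq> 0" using c[of n] by simp
    ultimately show ?thesis unfolding fx v_def x_def[symmetric] using d \<open>\<alpha> n \<noteq> 0\<close> by simp
  qed
  have vC2: "C2_on \<bbbU> (v n)" and lap: "z \<in> \<bbbU> \<Longrightarrow> norm (dzbar (dz (v n)) z) \<le> M * c n * norm (dz (v n) z) * norm (dzbar (v n) z)" for n z
  proof -
    define h where "h = (\<lambda>y. (y - a n) / complex_of_real (c n))"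
    have cn: "complex_of_real (c n) \<noteq> 0" using c[of n] by simp
    have h: "h holomorphic_on UNIV" unfolding h_def by (intro holomorphic_intros) (use cn in auto)
    have dh: "deriv h = (\<lambda>_. 1 / of_real (c n))"
      unfolding h_def using cn by (intro ext DERIV_imp_deriv) (auto intro!: derivative_eq_intros)
    note wq = rho_harmonic_compose_holomorphic[OF w q(1)[of n] q(2)[of n]]
    have veq: "v n = (\<lambda>z. h (w (q n z)))" by (simp add: v_def h_def)
    show "C2_on \<bbbU> (v n)" unfolding veq
      by (rule C2_on_compose[OF wq(1) C2_on_holomorphic[OF h open_UNIV] _ open_ball]) auto
    assume z: "z \<in> \<bbbU>"
    define A B D where "A = dz (\<lambda>z. w (q n z)) z" and "B = dzbar (\<lambda>z. w (q n z)) z"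
      and "D = dlog_density \<rho> (w (q n z))"
    note E = dzbar_dz_holomorphic_compose[OF wq(1) open_ball h open_UNIV subset_UNIV z, folded veq,
       unfolded dh wq(2)[OF z], folded A_def B_def D_def]
    \<comment> \<open>All derivatives of \<open>v n\<close> carry one factor 1 / \<open>c n\<close>,
      but the nonlinear term is quadratic in them; expressing it through \<open>v n\<close> leaves a
      factor \<open>c n\<close> over, which is the smallness.\<close>
    have "norm (dzbar (dz (v n)) z) = norm D * (norm A * norm B / c n)"
      unfolding E using c[of n] by (simp add: norm_mult norm_divide)
    also have "\<dots> \<le> M * (norm A * norm B / c n)"
      using M[OF wqU[OF z]] c[of n] by (intro mult_right_mono) (auto simp: D_def less_imp_le)
    also have "\<dots> = M * c n * norm (dz (v n) z) * norm (dzbar (v n) z)"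
      unfolding E using c[of n] by (simp add: norm_mult norm_divide field_simps)
    finally show "norm (dzbar (dz (v n)) z) \<le> M * c n * norm (dz (v n) z) * norm (dzbar (v n) z)" .
  qed
  have den0: "1 - norm x \<le> norm (\<alpha>0 + cnj a0 * x)" for x
    using norm_diff_ineq[of \<alpha>0 "cnj a0 * x"] \<alpha>0 a(3) by (simp add: norm_mult)
  have ball_harm: "C2_on (ball 0 R) (\<lambda>z. \<psi> (f0 z))" "z \<in> ball 0 R \<Longrightarrow> dzbar (dz (\<lambda>z. \<psi> (f0 z))) z = 0"
    if R: "0 < R" "R < 1" for R z
  proof -
    have sub: "cball 0 R \<subseteq> \<bbbU>" using R by auto
    obtain \<eta> where \<eta>: "\<eta> > 0" "\<And>n z. z \<in> cball 0 R \<Longrightarrow> norm (f n z) \<le> 1 - \<eta>"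
      using away[OF R] by blast
    note lim' = lim[OF compact_cball sub]
    have f0\<eta>: "norm (f0 z) \<le> 1 - \<eta>" if "z \<in> cball 0 R" for z
      by (rule Lim_norm_ubound[OF sequentially_bot tendsto_uniform_limitI[OF lim' that] always_eventually])
         (simp only: \<eta>(2)[OF that] simp_thms)
    have bdd: "bounded (f0 ` cball 0 R)"
      unfolding bounded_iff using f0\<eta> by blast
    \<comment> \<open>The limit denominator is bounded below by \<eta>, so uniform convergence
      passes to the quotient that represents \<open>v n\<close>.\<close>
    have "uniform_limit (cball 0 R) (\<lambda>n z. \<alpha> n + cnj (a n) * f n z) (\<lambda>z. \<alpha>0 + cnj a0 * f0 z) sequentially"
      by (intro uniform_limit_add uniform_lim_mult lim' bdd uniform_limit_const_sequence \<alpha> tendsto_cnj a)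
         (simp add: image_constant_conv)
    hence "uniform_limit (cball 0 R) (\<lambda>n z. f n z / (\<alpha> n + cnj (a n) * f n z)) (\<lambda>z. f0 z / (\<alpha>0 + cnj a0 * f0 z)) sequentially"
    proof (rule uniform_lim_divide[OF lim' _ bdd _ \<eta>(1)])
      show "\<eta> \<le> norm (\<alpha>0 + cnj a0 * f0 z)" if "z \<in> cball 0 R" for z
        using den0[of "f0 z"] f0\<eta>[OF that] by linarith
    qed
    hence vlim: "uniform_limit (cball 0 R) v (\<lambda>z. \<psi> (f0 z)) sequentially"
      unfolding \<psi>_def by (rule uniform_limit_cong'[THEN iffD1, rotated -1]) (use v_f sub in auto)
    have vB: "norm (v n z) \<le> 1 / \<eta>" if z: "z \<in> cball 0 R" for n z
    proof -
      have zU: "z \<in> \<bbbU>" using z sub by blast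
      have f1: "norm (f n z) \<le> 1 - \<eta>" by (rule \<eta>(2)[OF z])
      have "norm (cnj (a n) * f n z) \<le> 1 * norm (f n z)"
        unfolding norm_mult by (rule mult_right_mono) (use a(1)[of n] in auto)
      hence "\<eta> \<le> norm (\<alpha> n + cnj (a n) * f n z)"
        using norm_diff_ineq[of "\<alpha> n" "cnj (a n) * f n z"] \<alpha>(1)[of n] f1 by simp
      hence "norm (f n z) / norm (\<alpha> n + cnj (a n) * f n z) \<le> 1 / \<eta>"
        using f1 \<eta>(1) by (intro frac_le) auto
      thus ?thesis unfolding v_f[OF zU] norm_divide .
    qed
    have e: "M * c n \<ge> 0" for n using \<open>M \<ge> 0\<close> c[of n] by (simp add: less_imp_le)
    \<comment> \<open>The only place where |a0| = 1 makes the nonlinearity disappear in the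
      limit.\<close>
    have "(\<lambda>n. M * c n) \<longlonglongrightarrow> M * (1 - (norm a0)\<^sup>2)" unfolding c_def by (intro tendsto_intros a)
    hence e0: "(\<lambda>n. M * c n) \<longlonglongrightarrow> 0" using a(3) by simp
    have lapR: "norm (dzbar (dz (v n)) z) \<le> M * c n * norm (dz (v n) z) * norm (dzbar (v n) z)" if "z \<in> ball 0 R" for n z
      using that R by (intro lap) auto
    note L = almost_harmonic_limit[OF open_ball sub R(1) vC2 vB e e0 lapR vlim]
    show "C2_on (ball 0 R) (\<lambda>z. \<psi> (f0 z))" by (rule L(1))
    show "z \<in> ball 0 R \<Longrightarrow> dzbar (dz (\<lambda>z. \<psi> (f0 z))) z = 0" by (rule L(2))
  qed
  have \<psi>C2: "C2_on \<bbbU> (\<lambda>z. \<psi> (f0 z))" by (rule C2_on_disk_if_on_balls[OF ball_harm(1)])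
  have harm: "dzbar (dz (\<lambda>z. \<psi> (f0 z))) z = 0" if "z \<in> \<bbbU>" for z
    by (rule ball_harm(2)[of "(norm z + 1) / 2"]) (use that in \<open>auto simp: add_nonneg_pos\<close>)
  have den: "\<alpha>0 + cnj a0 * x \<noteq> 0" if "x \<in> \<bbbU>" for x
    using den0[of x] that by auto
  have \<psi>_hol: "\<psi> holomorphic_on \<bbbU>" unfolding \<psi>_def by (intro holomorphic_intros den)
  have d\<psi>: "deriv \<psi> x \<noteq> 0" if "x \<in> \<bbbU>" for x
  proof -
    have "(\<psi> has_field_derivative \<alpha>0 / (\<alpha>0 + cnj a0 * x)\<^sup>2) (at x)"
      unfolding \<psi>_def using den[OF that]
      by (auto intro!: derivative_eq_intros simp: power2_eq_square)
    hence "deriv \<psi> x = \<alpha>0 / (\<alpha>0 + cnj a0 * x)\<^sup>2" by (rule DERIV_imp_deriv)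
    thus ?thesis using den[OF that] \<open>\<alpha>0 \<noteq> 0\<close> by simp
  qed
  define T where "T = {y. 1 - cnj a0 * y \<noteq> 0}"
  have "open T" unfolding T_def by (intro open_Collect_neq continuous_intros)
  have \<phi>: "\<phi> holomorphic_on T" unfolding \<phi>_def T_def by (intro holomorphic_intros) auto
  have f0U: "f0 z \<in> \<bbbU>" if "z \<in> \<bbbU>" for z using f0 that by blast
  have one: "1 - cnj a0 * \<psi> x = \<alpha>0 / (\<alpha>0 + cnj a0 * x)" if "x \<in> \<bbbU>" for x
    using den[OF that] by (simp add: \<psi>_def field_simps)
  have \<psi>T: "\<psi> x \<in> T" if "x \<in> \<bbbU>" for x
    unfolding T_def mem_Collect_eq one[OF that] using den[OF that] \<open>\<alpha>0 \<noteq> 0\<close> by simp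
  have \<phi>\<psi>: "\<phi> (\<psi> x) = x" if "x \<in> \<bbbU>" for x
    unfolding \<phi>_def one[OF that] using den[OF that] \<open>\<alpha>0 \<noteq> 0\<close> by (simp add: \<psi>_def)
  \<comment> \<open>So far smoothness is known for \<psi> o f0; the inverse \<phi> transfers it to
    \<open>f0\<close>.\<close>
  have f0C2: "C2_on \<bbbU> f0"
    by (rule C2_on_transform(1)[OF C2_on_compose[OF \<psi>C2 C2_on_holomorphic[OF \<phi> \<open>open T\<close>] _ open_ball] open_ball \<phi>\<psi>])
       (use \<psi>T f0U in blast)+
  have \<sigma>: "C1_on UNIV (\<lambda>_. 1 :: real)" "\<And>w. w \<in> UNIV \<Longrightarrow> (1::real) > 0"
    by (auto intro: C1_onI[of _ _ "\<lambda>_ _. 0"])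
  have dlog1: "dlog_density (\<lambda>_. 1) x = 0" for x
    unfolding dlog_density_def by (rule has_wirtinger_unique(1)[of _ _ 0]) (simp add: has_wirtinger_def)
  have "rho_harmonic (\<lambda>x. 1 * norm (deriv \<psi> x)) f0"
    by (rule rho_harmonic_pullback[OF open_UNIV \<sigma> \<psi>_hol subset_UNIV d\<psi> f0C2 f0])
       (auto simp: harm dlog1 simp del: mem_ball_0)
  moreover have "disk_metric (\<lambda>x. 1 * norm (deriv \<psi> x))"
    by (rule pullback_density(1)[OF open_UNIV \<sigma> \<psi>_hol subset_UNIV d\<psi>])
  ultimately show ?thesis by blast
qed

theorem theorem1p4:
  fixes \<rho> :: "complex \<Rightarrow> real" and w :: "complex \<Rightarrow> complex"
    and z :: "nat \<Rightarrow> complex" and p q :: "nat \<Rightarrow> complex \<Rightarrow> complex"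
  assumes "approximate_analytic \<rho>"
    and "rho_harmonic \<rho> w"
    and "quasiconformal_on \<bbbU> w"
    and "w ` \<bbbU> = \<bbbU>"
    and "\<And>n. z n \<in> \<bbbU>"
    and "\<And>n. disk_moebius (p n)"
    and "\<And>n. disk_moebius (q n)"
    and "\<And>n. p n (w (z n)) = 0"
    and "\<And>n. q n 0 = z n"
  shows "\<exists>\<rho>0 w0 s. disk_metric \<rho>0 \<and> rho_harmonic \<rho>0 w0 \<and> strict_mono (s :: nat \<Rightarrow> nat) \<and>
    (\<forall>K. compact K \<and> K \<subseteq> \<bbbU> \<longrightarrow>
      uniform_limit K (\<lambda>n. p (s n) \<circ> w \<circ> q (s n)) w0 sequentially)"
proof -
  obtain M where \<rho>: "disk_metric \<rho>" and M: "\<And>x. x \<in> \<bbbU> \<Longrightarrow> cmod (dlog_density \<rho> x) \<le> M"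
    using assms(1) unfolding approximate_analytic_def by blast
  obtain g k where C2: "C2_on \<bbbU> w" and homeo: "homeomorphism \<bbbU> \<bbbU> w g" and k: "0 \<le> k" "k < 1"
    and dil: "\<And>z. z \<in> \<bbbU> \<Longrightarrow> cmod (dzbar w z) \<le> k * cmod (dz w z)"
    using assms(3) unfolding quasiconformal_on_def assms(4) by blast
  have "inj_on w \<bbbU>" using homeomorphism_apply1[OF homeo] by (metis inj_onI)
  hence qcw: "qc_selfmap k w"
    using C2 dil assms(4) by (simp add: qc_selfmap_def C2_on_def)
  define a where "a = (\<lambda>n. w (z n))"
  have aU: "norm (a n) < 1" for n
  proof -
    have "a n \<in> \<bbbU>" using assms(4,5) unfolding a_def by blast
    thus ?thesis by simp
  qed
  have zU: "norm (z n) < 1" for n using assms(5)[of n] by simp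
  have "\<exists>\<alpha>. norm \<alpha> = 1 \<and> (\<forall>x\<in>\<bbbU>. p n x = \<alpha> * ((x - a n) / (1 - cnj (a n) * x)))" for n
    by (rule disk_moebius_zero_form[OF assms(6) aU]) (simp add: a_def assms(8))
  then obtain \<alpha> where \<alpha>: "\<And>n. norm (\<alpha> n) = 1"
     "\<And>n x. x \<in> \<bbbU> \<Longrightarrow> p n x = \<alpha> n * ((x - a n) / (1 - cnj (a n) * x))" by metis
  have "\<exists>\<beta>. norm \<beta> = 1 \<and> (\<forall>x\<in>\<bbbU>. q n x = (\<beta> * x + z n) / (1 + cnj (z n) * (\<beta> * x)))" for n
    by (rule disk_moebius_at_zero_form[OF assms(7) zU assms(9)])
  then obtain \<beta> where \<beta>: "\<And>n. norm (\<beta> n) = 1"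
     "\<And>n x. x \<in> \<bbbU> \<Longrightarrow> q n x = (\<beta> n * x + z n) / (1 + cnj (z n) * (\<beta> n * x))" by metis
  define f where "f = (\<lambda>n. p n \<circ> w \<circ> q n)"
  have f_qc: "qc_selfmap k (f n)" for n
    unfolding f_def by (intro qc_selfmap_compose_automorphisms[OF qcw] disk_moebius_automorphism assms)
  have f_0: "f n 0 = 0" for n by (simp add: f_def assms(8,9))
  \<comment> \<open>All four parameters are collected in one compact product, so a single
    subsequence makes them converge together.\<close>
  define X where "X = (\<lambda>n. (a n, z n, \<alpha> n, \<beta> n))"
  define S where "S = cball (0::complex) 1 \<times> cball (0::complex) 1 \<times> cball (0::complex) 1 \<times> cball (0::complex) 1"
  have "compact S" unfolding S_def by (intro compact_Times compact_cball)
  moreover have "\<forall>n. X n \<in> S"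
    using aU zU \<alpha>(1) \<beta>(1) by (simp add: S_def X_def less_imp_le)
  ultimately obtain l r where l: "l \<in> S" "strict_mono (r :: nat \<Rightarrow> nat)" "(X \<circ> r) \<longlonglongrightarrow> l"
    unfolding compact_def by metis
  obtain a0 z0 \<alpha>0 \<beta>0 where l4: "l = (a0, z0, \<alpha>0, \<beta>0)" by (cases l)
  \<comment> \<open>Chosen inside the subsequence \<open>r\<close>, so the parameters still converge
    along it.\<close>
  obtain s f0 where s: "strict_mono (s :: nat \<Rightarrow> nat)" and f0U: "f0 ` \<bbbU> \<subseteq> \<bbbU>"
    and lim: "\<And>K. compact K \<Longrightarrow> K \<subseteq> \<bbbU> \<Longrightarrow> uniform_limit K (\<lambda>n. f (r (s n))) f0 sequentially"
    using qc_selfmap_normal_family[OF k, of "\<lambda>n. f (r n)"] f_qc f_0 by metis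
  define t where "t = (\<lambda>n. r (s n))"
  have t: "strict_mono t" using strict_mono_o[OF l(2) s] by (simp add: t_def o_def)
  have "(\<lambda>n. X (t n)) \<longlonglongrightarrow> l"
    using LIMSEQ_subseq_LIMSEQ[OF l(3) s] by (simp add: o_def t_def)
  note lim4 = this[unfolded X_def l4]
  have lims: "(\<lambda>n. a (t n)) \<longlonglongrightarrow> a0" "(\<lambda>n. z (t n)) \<longlonglongrightarrow> z0" "(\<lambda>n. \<alpha> (t n)) \<longlonglongrightarrow> \<alpha>0" "(\<lambda>n. \<beta> (t n)) \<longlonglongrightarrow> \<beta>0"
    using tendsto_fst[OF lim4] tendsto_fst[OF tendsto_snd[OF lim4]]
      tendsto_fst[OF tendsto_snd[OF tendsto_snd[OF lim4]]]
      tendsto_snd[OF tendsto_snd[OF tendsto_snd[OF lim4]]] by simp_all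
  have lim': "uniform_limit K (\<lambda>n. f (t n)) f0 sequentially" if "compact K" "K \<subseteq> \<bbbU>" for K
    using lim[OF that] by (simp add: t_def)
  have norm1: "norm \<alpha>0 = 1" "norm \<beta>0 = 1"
    using tendsto_norm[OF lims(3)] tendsto_norm[OF lims(4)] \<alpha>(1) \<beta>(1) by (simp_all add: LIMSEQ_const_iff)
  have "norm a0 \<le> 1" using l(1) by (simp add: S_def l4)
  have qU: "q n x \<in> \<bbbU>" "w (q n x) \<in> \<bbbU>" if "x \<in> \<bbbU>" for n x
    using disk_moebius_automorphism(3)[OF assms(7)[of n]] assms(4) that by blast+
  have "\<exists>\<rho>0. disk_metric \<rho>0 \<and> rho_harmonic \<rho>0 f0"
  proof (cases "norm a0 < 1")
    case True
    hence a0U: "a0 \<in> \<bbbU>" by simp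
    \<comment> \<open>Continuity of the inverse homeomorphism gives z0 = g a0, an interior point, so
      the inner Moebius maps do not degenerate.\<close>
    have "isCont g a0"
      using homeomorphism_cont2[OF homeo] a0U continuous_on_eq_continuous_at[OF open_ball] by blast
    hence "(\<lambda>n. g (a (t n))) \<longlonglongrightarrow> g a0" by (rule isCont_tendsto_compose[OF _ lims(1)])
    moreover have "g (a n) = z n" for n unfolding a_def by (rule homeomorphism_apply1[OF homeo assms(5)])
    ultimately have "z0 = g a0" using LIMSEQ_unique lims(2) by simp
    moreover have "g a0 \<in> \<bbbU>" using homeomorphism_image2[OF homeo] a0U by blast
    ultimately have z0: "norm z0 < 1" by simp
    show ?thesis
    proof (rule moebius_conjugate_rho_harmonic[OF \<rho> assms(2) True norm1(1) _ norm1(2)])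
      \<comment> \<open>The maps \<open>q n\<close> take 0 to \<open>z n\<close>, hence have the
        form \<open>Moebius_function 0 (- z n)\<close> after a rotation; this accounts for the
        sign.\<close>
      show "norm (- z0) < 1" using z0 by simp
      fix x :: complex assume x: "x \<in> \<bbbU>"
      define y where "y = Moebius_function 0 (- z0) (\<beta>0 * x)"
      have bx: "norm (\<beta>0 * x) < 1" using x norm1 by (simp add: norm_mult)
      have "y \<in> \<bbbU>" using Moebius_function_norm_lt_1[of "-z0" "\<beta>0 * x" 0] z0 bx by (simp add: y_def)
      have "1 + cnj z0 * (\<beta>0 * x) \<noteq> 0" using cnj_mult_neq_one[of "-z0" "\<beta>0 * x"] z0 bx by simp
      hence "(\<lambda>n. (\<beta> (t n) * x + z (t n)) / (1 + cnj (z (t n)) * (\<beta> (t n) * x))) \<longlonglongrightarrow>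
         (\<beta>0 * x + z0) / (1 + cnj z0 * (\<beta>0 * x))" by (intro tendsto_intros lims)
      hence "(\<lambda>n. q (t n) x) \<longlonglongrightarrow> y" using \<beta>(2)[OF x] by (simp add: y_def Moebius_function_simple)
      moreover have "isCont w y"
        using homeomorphism_cont1[OF homeo] \<open>y \<in> \<bbbU>\<close> continuous_on_eq_continuous_at[OF open_ball] by blast
      ultimately have wy: "(\<lambda>n. w (q (t n) x)) \<longlonglongrightarrow> w y" by (rule isCont_tendsto_compose[rotated])
      have "w y \<in> \<bbbU>" using assms(4) \<open>y \<in> \<bbbU>\<close> by blast
      hence "1 - cnj a0 * w y \<noteq> 0" using True by (intro cnj_mult_neq_one) auto
      hence "(\<lambda>n. \<alpha> (t n) * ((w (q (t n) x) - a (t n)) / (1 - cnj (a (t n)) * w (q (t n) x)))) \<longlonglongrightarrow>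
         \<alpha>0 * ((w y - a0) / (1 - cnj a0 * w y))" by (intro tendsto_intros lims wy)
      hence "(\<lambda>n. f (t n) x) \<longlonglongrightarrow> \<alpha>0 * ((w y - a0) / (1 - cnj a0 * w y))"
        using \<alpha>(2)[OF qU(2)[OF x]] by (simp add: f_def)
      moreover have "(\<lambda>n. f (t n) x) \<longlonglongrightarrow> f0 x"
        by (rule tendsto_uniform_limitI[OF lim'[of "{x}"]]) (use x in auto)
      ultimately show "f0 x = \<alpha>0 * Moebius_function 0 a0 (w (Moebius_function 0 (- z0) (\<beta>0 * x)))"
        using LIMSEQ_unique by (simp add: y_def Moebius_function_simple)
    qed
  next
    case False
    hence a0: "norm a0 = 1" using \<open>norm a0 \<le> 1\<close> by simp
    show ?thesis
    proof (rule boundary_limit_rho_harmonic[OF assms(2) M aU lims(1) a0 \<alpha>(1) lims(3) _ _ _ _ lim' f0U])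
      show "q (t n) holomorphic_on \<bbbU>" "q (t n) ` \<bbbU> \<subseteq> \<bbbU>" for n
        using disk_moebius_automorphism[OF assms(7)[of "t n"]] by simp_all
      show "f (t n) x = \<alpha> (t n) * ((w (q (t n) x) - a (t n)) / (1 - cnj (a (t n)) * w (q (t n) x)))"
        if "x \<in> \<bbbU>" for n x
        using \<alpha>(2)[OF qU(2)[OF that]] by (simp add: f_def)
      show "\<exists>\<eta>>0. \<forall>n. \<forall>x\<in>cball 0 R. norm (f (t n) x) \<le> 1 - \<eta>" if "0 < R" "R < 1" for R
        using qc_selfmap_bounded_away[OF k that] f_qc f_0 by blast
    qed
  qed
  thus ?thesis using t lim' unfolding f_def by blast
qed

end
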